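(* For every integer $r\geq 1$, \begin{align*} \det \big(\mathrm{IKM}_{2r-1}(i-1,2j-2)\big)_{1\leq i,j\leq r} &=\sqrt{\pi}^{\,r(r+1)}\sqrt{2}^{\,r(r-3)}\prod_{a=1}^{r-1}\dfrac{a^{r-a}}{\sqrt{2a+1}^{\,2a+1}},\\ \det \big(\mathrm{IKM}_{2r}(i-1,2j-2)\big)_{1\leq i,j\leq r} &=\dfrac{\sqrt{\pi}^{\,(r+1)^{2}}}{\Gamma\left(\frac{r+1}{2}\right)}\dfrac{1}{\sqrt{2}^{\,r(r+3)}}\prod_{a=1}^{r-1}\dfrac{(2a+1)^{r-a}}{(a+1)^{a+1}}. \end{align*}
   Context: $I_0(t),K_0(t)$ are the modified Bessel functions of order $0$, and the Bessel moments are $\mathrm{IKM}_{k}(a,b)=\int_{0}^{\infty}I_{0}(t)^{a}K_{0}(t)^{k-a}t^{b}\,\mathrm{d}t$ (all the integrals occurring here converge). *)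

theory Defs
  imports "HOL-Analysis.Analysis" "Jordan_Normal_Form.Determinant"
begin

definition bessel_I0 :: "real \<Rightarrow> real" where
  "bessel_I0 t = (\<Sum>n. (t / 2) ^ (2 * n) / (fact n)\<^sup>2)"

(* Integral representation of K_0, valid for t > 0, which is the only range used. *)
definition bessel_K0 :: "real \<Rightarrow> real" where
  "bessel_K0 t = (LINT u:{0<..}|lborel. exp (- t * cosh u))"

(* The subtraction k - a is on nat, so IKM k a b is meaningful only for a \<le> k. *)
definition IKM :: "nat \<Rightarrow> nat \<Rightarrow> nat \<Rightarrow> real" where
  "IKM k a b = (LINT t:{0<..}|lborel. bessel_I0 t ^ a * bessel_K0 t ^ (k - a) * t ^ b)"

end

theory Submission
  imports Defs "HOL-Probability.Distributions" "HOL-Real_Asymp.Real_Asymp"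
begin

text \<open>
  Write \<open>D(s)\<close> for the determinant of the moments with \<open>t\<^bsup>s+2j\<^esup>\<close> in place of \<open>t\<^bsup>2j\<^esup>\<close>.
  All products \<open>I\<^sub>0\<^bsup>a\<^esup> K\<^sub>0\<^bsup>k-a\<^esup>\<close> are annihilated by the symmetric power of the Bessel operator,
  so for fixed \<open>k\<close> their Mellin transforms obey one common linear recurrence in \<open>s\<close> with step 2,
  whose order is the size of the matrix. Hence \<open>D(s + 2)/D(s)\<close> is, up to sign, the quotient of
  the outer coefficients of that recurrence, an explicit rational function of \<open>s\<close>.
  As \<open>s\<close> grows, only the behaviour of \<open>I\<^sub>0\<close> and \<open>K\<^sub>0\<close> at infinity matters: row \<open>a\<close> behaves like
  \<open>\<kappa>\<^sub>a \<Gamma>(z) (k - 2a)\<^bsup>-z\<^esup>\<close> with \<open>z = s + 2j + 1 - k/2\<close>, and \<open>D(s)\<close> is asymptotic to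
  an explicit multiple of the Vandermonde determinant with nodes \<open>(k - 2a)\<^bsup>-2\<^esup>\<close>.
  Comparing this limit with the first-order recurrence yields \<open>D(0)\<close>.
\<close>

text \<open>The rows are those with 2a < k: there the product decays like exp(-(k - 2a)t), so the
  integrals converge and integration by parts leaves nothing at infinity. Their number
  \<open>Suc k div 2\<close> is the order of the recurrence, so D(s) is its Casorati determinant,
  and raising s by 2 multiplies the matrix by a companion matrix. Since only even integers s occur,
  no analytic continuation in s is needed.

  The lowest coefficient of the recurrence is a pure power of -(s + 1). The top one depends on the
  parity of k: it is constant for odd k and linear in s for even k, and the product of these linear
  factors is the source of the Gamma value in the second formula. The solved recurrence contains
  powers of (2m - 1)!!, whose growth is matched with the Gamma factors of the asymptotics by Gamma(m
  + a) ~ m! m^(a - 1).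

  The behaviour of I_0 at infinity is not obtained from an integral for I_0: it is deduced from that
  of K_0 through their Wronskian.\<close>

section \<open>Integration over the half-line and Euler's integral\<close>

lemma set_integral_FTC_Ioi:
  fixes f F :: "real \<Rightarrow> real"
  assumes F: "\<And>x. x > 0 \<Longrightarrow> (F has_real_derivative f x) (at x)"
    and f: "\<And>x. x > 0 \<Longrightarrow> isCont f x"
    and int: "set_integrable lborel {0<..} f"
    and A: "(F \<longlongrightarrow> A) (at_right 0)" and B: "(F \<longlongrightarrow> B) at_top"
  shows "(LINT x:{0<..}|lborel. f x) = B - A"
proof -
  have "(LBINT x=0..\<infinity>. f x) = B - A"
  proof (rule interval_integral_FTC_integrable[where F=F])
    show "set_integrable lborel (einterval 0 \<infinity>) f"
      using int by (simp add: einterval_def greaterThan_def)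
    show "((F \<circ> real_of_ereal) \<longlongrightarrow> A) (at_right 0)"
      using A by (simp add: zero_ereal_def ereal_tendsto_simps)
    show "((F \<circ> real_of_ereal) \<longlongrightarrow> B) (at_left \<infinity>)"
      using B by (simp add: ereal_tendsto_simps)
  qed (use F f in \<open>auto simp: has_real_derivative_iff_has_vector_derivative[symmetric]\<close>)
  then show ?thesis
    by (simp add: interval_lebesgue_integral_0_infty)
qed

lemma has_bochner_integral_Gamma:
  fixes p l :: real
  assumes "p > 0" "l > 0"
  shows "has_bochner_integral lborel (\<lambda>t. indicator {0<..} t *\<^sub>R (t powr (p - 1) * exp (- l * t)))
    (Gamma p / l powr p)"
proof -
  let ?f = "\<lambda>t::real. indicator {0<..} t *\<^sub>R (t powr (p - 1) * exp (- t))"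
  have "has_bochner_integral lborel ?f (Gamma p)"
  proof (rule has_bochner_integral_nn_integral)
    show "(\<integral>\<^sup>+ t. ennreal (?f t) \<partial>lborel) = ennreal (Gamma p)"
      unfolding Gamma_conv_nn_integral_real[OF assms(1)]
      by (intro nn_integral_cong) (auto split: split_indicator simp: exp_minus field_simps)
  qed (use assms in \<open>auto simp: Gamma_real_nonneg\<close>)
  then have "has_bochner_integral lborel (\<lambda>t. ?f (0 + l * t)) (Gamma p /\<^sub>R \<bar>l\<bar>)"
    using assms by (subst (asm) lborel_has_bochner_integral_real_affine_iff[of l _ _ 0]) auto
  then have "has_bochner_integral lborel (\<lambda>t. l powr (1 - p) * ?f (0 + l * t))
      (l powr (1 - p) * (Gamma p /\<^sub>R \<bar>l\<bar>))"
    by (intro has_bochner_integral_mult_right) auto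
  also have "(\<lambda>t. l powr (1 - p) * ?f (0 + l * t)) =
      (\<lambda>t. indicator {0<..} t *\<^sub>R (t powr (p - 1) * exp (- l * t)))"
    using assms by (auto simp: fun_eq_iff zero_less_mult_iff powr_mult powr_diff field_simps
        split: split_indicator)
  also have "l powr (1 - p) * (Gamma p /\<^sub>R \<bar>l\<bar>) = Gamma p / l powr p"
    using assms by (simp add: powr_diff field_simps)
  finally show ?thesis .
qed

lemma set_integrable_Gamma:
  assumes "p > 0" "(l::real) > 0"
  shows "set_integrable lborel {0<..} (\<lambda>t. t powr (p - 1) * exp (- l * t))"
  using has_bochner_integral_Gamma[OF assms] by (simp add: set_integrable_def has_bochner_integral_iff)

lemma set_integral_Gamma:
  assumes "p > 0" "(l::real) > 0"
  shows "(LINT t:{0<..}|lborel. t powr (p - 1) * exp (- l * t)) = Gamma p / l powr p"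
  using has_bochner_integral_Gamma[OF assms]
  by (simp add: set_lebesgue_integral_def has_bochner_integral_iff)

lemma set_integrable_dominated:
  fixes f g :: "real \<Rightarrow> real"
  assumes "set_integrable lborel {0<..} g" "f \<in> borel_measurable borel"
    "\<And>x. x > 0 \<Longrightarrow> \<bar>f x\<bar> \<le> g x"
  shows "set_integrable lborel {0<..} f"
  by (rule set_integrable_bound[OF assms(1)])
     (use assms in \<open>auto simp: set_borel_measurable_def intro!: AE_I2 order_trans[OF assms(3)]\<close>)

lemma set_integral_exp_minus:
  "set_integrable lborel {0<..} (\<lambda>u::real. exp (- u))"
  "(LINT u:{0<..}|lborel. exp (- u)) = (1::real)"
proof -
  show int: "set_integrable lborel {0<..} (\<lambda>u::real. exp (- u))"
    by (rule set_integrable_dominated[OF set_integrable_Gamma[of 1 1]]) auto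
  have "(LINT u:{0<..}|lborel. exp (- u)) = (LINT t:{0<..}|lborel. t powr (1 - 1) * exp (- (1::real) * t))"
    by (rule set_lebesgue_integral_cong) auto
  then show "(LINT u:{0<..}|lborel. exp (- u)) = (1::real)"
    by (subst (asm) set_integral_Gamma) auto
qed

subsection \<open>The Macdonald function\<close>

lemma borel_measurable_cosh [measurable]: "(cosh :: real \<Rightarrow> real) \<in> borel_measurable borel"
  by (intro borel_measurable_continuous_onI continuous_intros)

lemma cosh_ge_half_exp: "cosh (u::real) \<ge> exp u / 2"
  by (simp add: cosh_field_def)

lemma sinh_ge_self: "u \<ge> 0 \<Longrightarrow> sinh (u::real) \<ge> u"
proof -
  assume u: "u \<ge> 0"
  have "sinh 0 - 0 \<le> sinh u - u"
    by (rule DERIV_nonneg_imp_nondecreasing[OF u])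
       (auto intro!: exI derivative_eq_intros simp: cosh_real_ge_1)
  then show ?thesis by simp
qed

text \<open>Half-angle formula cosh u = 1 + 2 sinh(u/2)^2 together with sinh x \<ge> x. This
  minorant turns exp(- t cosh u) into a Gaussian.\<close>

lemma cosh_ge_square: "cosh (u::real) \<ge> 1 + u\<^sup>2 / 2"
proof -
  have "(\<bar>u\<bar> / 2)\<^sup>2 \<le> (sinh (\<bar>u\<bar> / 2))\<^sup>2"
    by (intro power_mono sinh_ge_self) auto
  then show ?thesis
    using cosh_double[of "\<bar>u\<bar> / 2"] cosh_square_eq[of "\<bar>u\<bar> / 2"]
    by (simp add: power_divide)
qed

text \<open>This is (-1)^n times the n-th derivative of K_0; n = 1 gives the Macdonald function K_1.
  Treating all n at once reduces differentiation under the integral to a single lemma.\<close>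

definition cosh_laplace :: "nat \<Rightarrow> real \<Rightarrow> real" where
  "cosh_laplace n t = (LINT u:{0<..}|lborel. cosh u ^ n * exp (- t * cosh u))"

lemma bessel_K0_eq: "bessel_K0 = cosh_laplace 0"
  by (auto simp: fun_eq_iff bessel_K0_def cosh_laplace_def)

text \<open>The inequality (1 + x/N)^N \<le> exp x with N = n + 1 absorbs one power of cosh u more
  than required; the spare factor is then exchanged for decay by 1 / cosh u \<le> 2 exp(-
  u).\<close>

lemma cosh_laplace_kernel_bound:
  assumes "t > 0"
  shows "cosh u ^ n * exp (- t * cosh u) \<le> 2 * (real (Suc n) / t) ^ Suc n * exp (- u)"
proof -
  let ?c = "cosh u"
  have c: "?c \<ge> 1" by (rule cosh_real_ge_1)
  have "(t * ?c / real (Suc n)) ^ Suc n \<le> (1 + t * ?c / real (Suc n)) ^ Suc n"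
    using assms c by (intro power_mono) auto
  also have "\<dots> \<le> exp (t * ?c)"
    using assms c by (intro exp_ge_one_plus_x_over_n_power_n) (auto intro: order_trans[of _ 0])
  finally have "?c ^ Suc n \<le> (real (Suc n) / t) ^ Suc n * exp (t * ?c)"
    using assms by (simp add: power_mult_distrib power_divide field_simps del: power_Suc)
  then have "?c ^ Suc n * exp (- t * ?c) \<le> (real (Suc n) / t) ^ Suc n"
    by (simp add: exp_minus field_simps del: power_Suc)
  then have "?c ^ n * exp (- t * ?c) * ?c \<le> (real (Suc n) / t) ^ Suc n * 1"
    by (simp add: mult_ac)
  also have "\<dots> \<le> (real (Suc n) / t) ^ Suc n * (2 * exp (- u) * ?c)"
    using cosh_ge_half_exp[of u] assms
    by (intro mult_left_mono) (auto simp: exp_minus field_simps)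
  finally have "cosh u ^ n * exp (- t * cosh u) * ?c
      \<le> 2 * (real (Suc n) / t) ^ Suc n * exp (- u) * ?c"
    by (simp only: mult_ac)
  then show ?thesis
    using c by (elim mult_right_le_imp_le) linarith
qed

lemma cosh_laplace_integrable:
  assumes "(t::real) > 0"
  shows "set_integrable lborel {0<..} (\<lambda>u. cosh u ^ n * exp (- t * cosh u))"
proof (rule set_integrable_dominated)
  show "set_integrable lborel {0<..} (\<lambda>u. 2 * (real (Suc n) / t) ^ Suc n * exp (- u))"
    using set_integral_exp_minus(1) by (rule set_integrable_mult_right)
  show "\<bar>cosh u ^ n * exp (- t * cosh u)\<bar> \<le> 2 * (real (Suc n) / t) ^ Suc n * exp (- u)" for u
    using cosh_laplace_kernel_bound[OF assms, of u n] by (simp add: abs_mult)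
qed auto

lemma exp_taylor1_bound: "\<bar>exp y - 1 - y\<bar> \<le> y\<^sup>2 * exp \<bar>y\<bar>" for y :: real
proof -
  have le: "exp z - 1 \<le> z * exp z" for z :: real
    using exp_ge_add_one_self[of "-z"] by (simp add: exp_minus field_simps)
  have "exp y - 1 - y \<ge> 0" using exp_ge_add_one_self[of y] by linarith
  moreover have "exp y - 1 - y \<le> y * (exp y - 1)" using le[of y] by (simp add: algebra_simps)
  moreover have "y * (exp y - 1) \<le> y\<^sup>2 * exp \<bar>y\<bar>"
  proof (cases "y \<ge> 0")
    case True
    then show ?thesis using mult_left_mono[OF le[of y] True] by (simp add: power2_eq_square mult_ac)
  next
    case False
    have "y * (exp y - 1) \<le> y * y"
      using False exp_ge_add_one_self[of y] by (intro mult_left_mono_neg) linarith+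
    also have "\<dots> \<le> y\<^sup>2 * exp \<bar>y\<bar>"
      using mult_left_mono[of 1 "exp \<bar>y\<bar>" "y\<^sup>2"] by (simp add: power2_eq_square)
    finally show ?thesis .
  qed
  ultimately show ?thesis by linarith
qed

text \<open>The second-order Taylor bound for exp is integrated pointwise. Its loss
  exp(\<bar>h\<bar> cosh u) is paid for by half of the decay exp(- t cosh u), hence the argument t /
  2 on the right; the factor h^2 cosh(u)^2 raises the index by two.\<close>

lemma cosh_laplace_increment:
  assumes t: "t > 0" and h: "\<bar>h\<bar> \<le> t / 2"
  shows "\<bar>cosh_laplace n (t + h) - cosh_laplace n t + h * cosh_laplace (Suc n) t\<bar>
           \<le> h\<^sup>2 * cosh_laplace (n + 2) (t / 2)"
proof -
  have th: "t + h > 0" using t h by linarith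
  let ?k = "\<lambda>n t u. cosh u ^ n * exp (- t * cosh u)"
  let ?d = "\<lambda>u. ?k n (t + h) u - ?k n t u + h * ?k (Suc n) t u"
  note I = cosh_laplace_integrable
  have int: "set_integrable lborel {0<..} ?d"
    using I[OF th, of n] I[OF t, of n] I[OF t, of "Suc n"]
    by (intro set_integral_add set_integral_diff set_integrable_mult_right) auto
  have "cosh_laplace n (t + h) - cosh_laplace n t + h * cosh_laplace (Suc n) t
      = (LINT u:{0<..}|lborel. ?d u)" (is "?D = _")
    unfolding cosh_laplace_def using I[OF th, of n] I[OF t, of n] I[OF t, of "Suc n"]
    by (simp only: set_integral_add set_integral_diff set_integrable_mult_right set_integral_mult_right)
  then have "\<bar>?D\<bar> = \<bar>LINT u:{0<..}|lborel. ?d u\<bar>"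
    by (rule arg_cong)
  also have "\<dots> \<le> (LINT u:{0<..}|lborel. \<bar>?d u\<bar>)"
    unfolding set_lebesgue_integral_def by (rule order_trans[OF integral_abs_bound]) (simp add: abs_mult)
  also have "\<dots> \<le> (LINT u:{0<..}|lborel. h\<^sup>2 * ?k (n + 2) (t / 2) u)"
  proof (rule set_integral_mono)
    show "set_integrable lborel {0<..} (\<lambda>u. h\<^sup>2 * ?k (n + 2) (t / 2) u)"
      by (rule set_integrable_mult_right, rule I) (use t in simp)
    show "set_integrable lborel {0<..} (\<lambda>u. \<bar>?d u\<bar>)"
      using int by (rule set_integrable_abs)
    fix u :: real
    have e1: "exp (- (t + h) * cosh u) = exp (- t * cosh u) * exp (- h * cosh u)"
      unfolding exp_add[symmetric] by (simp add: algebra_simps)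
    have e2: "exp (- t * cosh u) * exp (t / 2 * cosh u) = exp (- (t / 2) * cosh u)"
      unfolding exp_add[symmetric] by (simp add: field_simps)
    have "\<bar>- h * cosh u\<bar> \<le> t / 2 * cosh u"
      unfolding abs_mult using h by (intro mult_mono) auto
    then have e3: "exp \<bar>- h * cosh u\<bar> \<le> exp (t / 2 * cosh u)" by simp
    have eq: "?d u = ?k n t u * (exp (- h * cosh u) - 1 - (- h * cosh u))"
      unfolding e1 by (simp add: algebra_simps)
    have "\<bar>?d u\<bar> = ?k n t u * \<bar>exp (- h * cosh u) - 1 - (- h * cosh u)\<bar>"
      unfolding eq abs_mult by simp
    also have "\<dots> \<le> ?k n t u * ((- h * cosh u)\<^sup>2 * exp \<bar>- h * cosh u\<bar>)"
      by (intro mult_left_mono exp_taylor1_bound) auto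
    also have "\<dots> \<le> ?k n t u * ((- h * cosh u)\<^sup>2 * exp (t / 2 * cosh u))"
      by (intro mult_left_mono e3) auto
    also have "\<dots> = h\<^sup>2 * ?k (n + 2) (t / 2) u"
      unfolding e2[symmetric] by (simp add: power_mult_distrib power_add power2_eq_square)
    finally show "\<bar>?d u\<bar> \<le> h\<^sup>2 * ?k (n + 2) (t / 2) u" .
  qed
  finally show ?thesis unfolding cosh_laplace_def by simp
qed

lemma DERIV_cosh_laplace:
  assumes t: "t > 0"
  shows "(cosh_laplace n has_real_derivative - cosh_laplace (Suc n) t) (at t)"
  unfolding DERIV_def
proof (rule LIM_zero_cancel, rule Lim_null_comparison)
  let ?M = "cosh_laplace (n + 2) (t / 2)"
  have "\<forall>\<^sub>F h in at (0::real). \<bar>h\<bar> < t / 2 \<and> h \<noteq> 0"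
    unfolding eventually_at using t by (intro exI[of _ "t/2"]) (simp add: dist_real_def)
  then show "\<forall>\<^sub>F h in at 0. norm ((cosh_laplace n (t + h) - cosh_laplace n t) / h
      - - cosh_laplace (Suc n) t) \<le> \<bar>h\<bar> * ?M"
  proof eventually_elim
    case (elim h)
    have "(cosh_laplace n (t + h) - cosh_laplace n t) / h - - cosh_laplace (Suc n) t
       = (cosh_laplace n (t + h) - cosh_laplace n t + h * cosh_laplace (Suc n) t) / h"
      using elim by (simp add: field_simps)
    then have "norm ((cosh_laplace n (t + h) - cosh_laplace n t) / h - - cosh_laplace (Suc n) t)
       = \<bar>cosh_laplace n (t + h) - cosh_laplace n t + h * cosh_laplace (Suc n) t\<bar> / \<bar>h\<bar>"
      by (simp only: real_norm_def abs_divide)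
    also have "\<dots> \<le> h\<^sup>2 * ?M / \<bar>h\<bar>"
      using elim t by (intro divide_right_mono cosh_laplace_increment) auto
    also have "\<dots> = \<bar>h\<bar> * ?M"
      using elim by (cases "h > 0") (simp_all add: power2_eq_square)
    finally show ?case .
  qed
  show "((\<lambda>h. \<bar>h\<bar> * ?M) \<longlongrightarrow> 0) (at 0)"
    by (auto intro!: tendsto_eq_intros)
qed

lemma sinh_le_cosh_real: "sinh x \<le> cosh (x::real)"
  by (rule less_imp_le) (rule sinh_less_cosh_real)

lemma sinh_kernel_limits:
  assumes "(t::real) > 0"
  shows "((\<lambda>u::real. exp (- t * cosh u)) \<longlongrightarrow> exp (- t)) (at_right 0)"
    "((\<lambda>u::real. sinh u * exp (- t * cosh u)) \<longlongrightarrow> 0) (at_right 0)"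
    "((\<lambda>u::real. exp (- t * cosh u)) \<longlongrightarrow> 0) at_top"
    "((\<lambda>u::real. sinh u * exp (- t * cosh u)) \<longlongrightarrow> 0) at_top"
proof -
  have "isCont (\<lambda>u::real. exp (- t * cosh u)) 0" by (intro continuous_intros)
  then show "((\<lambda>u::real. exp (- t * cosh u)) \<longlongrightarrow> exp (- t)) (at_right 0)"
    by (auto simp: isCont_def dest: tendsto_mono[OF at_le, rotated])
  have "isCont (\<lambda>u::real. sinh u * exp (- t * cosh u)) 0" by (intro continuous_intros)
  then show "((\<lambda>u::real. sinh u * exp (- t * cosh u)) \<longlongrightarrow> 0) (at_right 0)"
    by (auto simp: isCont_def dest: tendsto_mono[OF at_le, rotated])
  have lim: "((\<lambda>u::real. C * exp (- u)) \<longlongrightarrow> 0) at_top" for C :: real by real_asymp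
  show "((\<lambda>u::real. exp (- t * cosh u)) \<longlongrightarrow> 0) at_top"
    by (rule Lim_null_comparison[OF _ lim[of "2 * (real (Suc 0) / t) ^ Suc 0"]], rule always_eventually)
       (use cosh_laplace_kernel_bound[OF assms, of _ 0] in simp)
  show "((\<lambda>u::real. sinh u * exp (- t * cosh u)) \<longlongrightarrow> 0) at_top"
  proof (rule Lim_null_comparison[OF _ lim[of "2 * (real (Suc 1) / t) ^ Suc 1"]],
      rule eventually_mono[OF eventually_ge_at_top[of 0]])
    fix u :: real assume u: "u \<ge> 0"
    have "norm (sinh u * exp (- t * cosh u)) \<le> cosh u ^ 1 * exp (- t * cosh u)"
      using u sinh_less_cosh_real[of u] by (auto simp: abs_mult intro!: mult_right_mono)
    also have "\<dots> \<le> 2 * (real (Suc 1) / t) ^ Suc 1 * exp (- u)"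
      by (rule cosh_laplace_kernel_bound[OF assms])
    finally show "norm (sinh u * exp (- t * cosh u)) \<le> 2 * (real (Suc 1) / t) ^ Suc 1 * exp (- u)" .
  qed
qed

lemma sinh_laplace:
  assumes t: "(t::real) > 0"
  shows "set_integrable lborel {0<..} (\<lambda>u. sinh u * exp (- t * cosh u))"
    and "t * (LINT u:{0<..}|lborel. sinh u * exp (- t * cosh u)) = exp (- t)"
proof -
  show int: "set_integrable lborel {0<..} (\<lambda>u. sinh u * exp (- t * cosh u))"
    by (rule set_integrable_dominated[OF cosh_laplace_integrable[OF t, of 1]])
       (auto simp: abs_mult sinh_le_cosh_real
          intro!: borel_measurable_continuous_onI continuous_intros)
  have "(LINT u:{0<..}|lborel. t * (sinh u * exp (- t * cosh u))) = 0 - (- exp (- t))"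
  proof (rule set_integral_FTC_Ioi[where F = "\<lambda>u. - exp (- t * cosh u)"])
    show "set_integrable lborel {0<..} (\<lambda>u. t * (sinh u * exp (- t * cosh u)))"
      by (rule set_integrable_mult_right) (rule int)
    show "((\<lambda>u. - exp (- t * cosh u)) has_real_derivative t * (sinh u * exp (- t * cosh u))) (at u)" for u
      by (auto intro!: derivative_eq_intros)
    show "isCont (\<lambda>u. t * (sinh u * exp (- t * cosh u))) u" for u
      by (intro continuous_intros)
    show "((\<lambda>u. - exp (- t * cosh u)) \<longlongrightarrow> - exp (- t)) (at_right 0)"
      by (intro tendsto_minus sinh_kernel_limits t)
    show "((\<lambda>u. - exp (- t * cosh u)) \<longlongrightarrow> 0) at_top"
      using tendsto_minus[OF sinh_kernel_limits(3)[OF t]] by simp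
  qed
  then show "t * (LINT u:{0<..}|lborel. sinh u * exp (- t * cosh u)) = exp (- t)"
    by simp
qed

text \<open>Integrate the u-derivative of sinh u exp(- t cosh u), whose boundary values vanish. In
  terms of derivatives of K_0 this is Bessel's equation t K_0'' + K_0' = t K_0.\<close>

lemma cosh_laplace_recurrence:
  assumes t: "t > 0"
  shows "cosh_laplace 1 t = t * (cosh_laplace 2 t - cosh_laplace 0 t)"
proof -
  let ?k = "\<lambda>n u. cosh u ^ n * exp (- t * cosh u)"
  note I = cosh_laplace_integrable[OF t]
  have int: "set_integrable lborel {0<..} (\<lambda>u. ?k 1 u - t * (?k 2 u - ?k 0 u))"
    by (intro set_integral_diff set_integrable_mult_right I)
  have "(LINT u:{0<..}|lborel. ?k 1 u - t * (?k 2 u - ?k 0 u)) = 0 - 0"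
  proof (rule set_integral_FTC_Ioi[where F = "\<lambda>u. sinh u * exp (- t * cosh u)"])
    fix u :: real
    have "((\<lambda>u. sinh u * exp (- t * cosh u)) has_real_derivative
        cosh u * exp (- t * cosh u) - t * (sinh u ^ 2 * exp (- t * cosh u))) (at u)"
      by (auto intro!: derivative_eq_intros simp: power2_eq_square)
    then show "((\<lambda>u. sinh u * exp (- t * cosh u)) has_real_derivative ?k 1 u - t * (?k 2 u - ?k 0 u)) (at u)"
      by (simp add: sinh_square_eq left_diff_distrib)
    show "isCont (\<lambda>u. ?k 1 u - t * (?k 2 u - ?k 0 u)) u"
      by (intro continuous_intros)
  qed (use int sinh_kernel_limits[OF t] in auto)
  also have "(LINT u:{0<..}|lborel. ?k 1 u - t * (?k 2 u - ?k 0 u))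
      = cosh_laplace 1 t - t * (cosh_laplace 2 t - cosh_laplace 0 t)"
    unfolding cosh_laplace_def
    by (subst set_integral_diff, rule I, intro set_integral_diff set_integrable_mult_right I,
        subst set_integral_mult_right, subst set_integral_diff) (use I[of 0] I[of 1] I[of 2] in auto)
  finally show ?thesis by simp
qed

text \<open>Split cosh u = sinh u + exp(- u): the sinh part integrates exactly to exp(- t) / t, the
  remainder lies between 0 and exp(- t). The two bounds pin down t K_1(t) \<rightarrow> 1 at 0 and
  give the decay at infinity.\<close>

lemma cosh_laplace_1_bounds:
  assumes t: "t > 0"
  shows "exp (- t) \<le> t * cosh_laplace 1 t" "t * cosh_laplace 1 t \<le> (1 + t) * exp (- t)"
proof -
  note S = sinh_laplace[OF t]
  have "(LINT u:{0<..}|lborel. sinh u * exp (- t * cosh u)) \<le> cosh_laplace 1 t"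
    unfolding cosh_laplace_def
    by (rule set_integral_mono[OF S(1) cosh_laplace_integrable[OF t]])
       (simp add: sinh_le_cosh_real)
  from mult_left_mono[OF this less_imp_le[OF t]] S(2)
  show "exp (- t) \<le> t * cosh_laplace 1 t" by simp
  have "cosh_laplace 1 t \<le> (LINT u:{0<..}|lborel. sinh u * exp (- t * cosh u) + exp (- t) * exp (- u))"
    unfolding cosh_laplace_def
  proof (rule set_integral_mono[OF cosh_laplace_integrable[OF t]])
    show "set_integrable lborel {0<..} (\<lambda>u. sinh u * exp (- t * cosh u) + exp (- t) * exp (- u))"
      by (intro set_integral_add set_integrable_mult_right S set_integral_exp_minus)
    fix u :: real
    have "cosh u ^ 1 * exp (- t * cosh u) = sinh u * exp (- t * cosh u) + exp (- u) * exp (- t * cosh u)"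
      using cosh_minus_sinh[of u] by (simp add: algebra_simps flip: cosh_minus_sinh)
    also have "exp (- u) * exp (- t * cosh u) \<le> exp (- u) * exp (- t)"
      using t cosh_real_ge_1[of u] by (intro mult_left_mono) auto
    finally show "cosh u ^ 1 * exp (- t * cosh u) \<le> sinh u * exp (- t * cosh u) + exp (- t) * exp (- u)"
      by (simp add: mult_ac)
  qed
  also have "\<dots> = (LINT u:{0<..}|lborel. sinh u * exp (- t * cosh u)) + exp (- t)"
    by (subst set_integral_add) (use S(1) in \<open>auto simp: set_integral_exp_minus intro!: set_integrable_mult_right\<close>)
  finally have "t * cosh_laplace 1 t
      \<le> t * ((LINT u:{0<..}|lborel. sinh u * exp (- t * cosh u)) + exp (- t))"
    using t by (intro mult_left_mono) auto
  then show "t * cosh_laplace 1 t \<le> (1 + t) * exp (- t)"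
    using S(2) by (simp add: algebra_simps)
qed

section \<open>Laplace's method and uniform bounds for K_0\<close>

lemma has_bochner_integral_gaussian_half:
  "has_bochner_integral lborel (\<lambda>v::real. indicator {0<..} v *\<^sub>R exp (- v\<^sup>2 / 2)) (sqrt (pi / 2))"
proof -
  have "has_bochner_integral lborel
      (\<lambda>x. indicator {0..} (0 + 1 / sqrt 2 * x) *\<^sub>R exp (- (0 + 1 / sqrt 2 * x)\<^sup>2)) ((sqrt pi / 2) /\<^sub>R \<bar>1 / sqrt 2\<bar>)"
    using gaussian_moment_0 by (subst (asm) lborel_has_bochner_integral_real_affine_iff[of "1 / sqrt 2" _ _ 0]) auto
  also have "(sqrt pi / 2) /\<^sub>R \<bar>1 / sqrt 2\<bar> = sqrt (pi / 2)"
    by (simp add: real_sqrt_divide field_simps)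
  finally show ?thesis
  proof (rule has_bochner_integral_cong_AE[THEN iffD1, rotated 3])
    show "AE x in lborel. indicator {0..} (0 + 1 / sqrt 2 * x) *\<^sub>R exp (- (0 + 1 / sqrt 2 * x)\<^sup>2) =
        indicator {0<..} x *\<^sub>R exp (- x\<^sup>2 / 2)"
      by (rule AE_I[where N = "{0}"])
         (auto split: split_indicator simp: power2_eq_square zero_le_divide_iff)
  qed auto
qed

text \<open>Substitution u = v / sqrt t, the natural width of the peak of exp(- t cosh u) at u =
  0.\<close>

lemma bessel_K0_scaled:
  assumes t: "t > 0"
  shows "sqrt t * exp t * bessel_K0 t
      = (LINT v|lborel. indicator {0<..} v *\<^sub>R exp (- t * (cosh (v / sqrt t) - 1)))"
proof -
  let ?f = "\<lambda>u. indicator {0<..} u *\<^sub>R exp (- t * cosh u)"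
  have "bessel_K0 t = (1 / sqrt t) * (LINT v|lborel. ?f (0 + 1 / sqrt t * v))"
    unfolding bessel_K0_def set_lebesgue_integral_def
    using t by (subst lborel_integral_real_affine[of "1 / sqrt t" _ 0]) auto
  then have "sqrt t * exp t * bessel_K0 t = (LINT v|lborel. exp t * ?f (0 + 1 / sqrt t * v))"
    using t by simp
  also have "\<dots> = (LINT v|lborel. indicator {0<..} v *\<^sub>R exp (- t * (cosh (v / sqrt t) - 1)))"
    using t by (intro Bochner_Integration.integral_cong)
      (auto split: split_indicator simp: zero_less_divide_iff algebra_simps simp flip: exp_add)
  finally show ?thesis .
qed

text \<open>The Gaussian majorant is independent of t, so it serves both as the dominating function
  for the limit t \<rightarrow> \<infinity> and as a bound valid for every t.\<close>

lemma scaled_kernel_le: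
  assumes "t > 0"
  shows "exp (- t * (cosh (v / sqrt t) - 1)) \<le> exp (- v\<^sup>2 / 2)"
proof -
  have "t * (1 + (v / sqrt t)\<^sup>2 / 2) \<le> t * cosh (v / sqrt t)"
    using assms by (intro mult_left_mono cosh_ge_square) auto
  then show ?thesis using assms by (simp add: power_divide ring_distribs)
qed

lemma bessel_K0_asymp: "((\<lambda>t. sqrt t * exp t * bessel_K0 t) \<longlongrightarrow> sqrt (pi / 2)) at_top"
proof -
  let ?w = "\<lambda>v::real. indicator {0<..} v *\<^sub>R exp (- v\<^sup>2 / 2)"
  note G = has_bochner_integral_gaussian_half[unfolded has_bochner_integral_iff]
  have "((\<lambda>t. LINT v|lborel. indicator {0<..} v *\<^sub>R exp (- t * (cosh (v / sqrt t) - 1)))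
      \<longlongrightarrow> (LINT v|lborel. ?w v)) at_top"
  proof (rule integral_dominated_convergence_at_top[where w = ?w])
    show "AE v in lborel. ((\<lambda>t. indicator {0<..} v *\<^sub>R exp (- t * (cosh (v / sqrt t) - 1))) \<longlongrightarrow> ?w v) at_top"
    proof (rule AE_I2)
      fix v :: real
      have "((\<lambda>t. exp (- t * ((exp (v / sqrt t) + exp (- (v / sqrt t))) / 2 - 1))) \<longlongrightarrow> exp (- (v * v / 2))) at_top"
        by real_asymp
      then show "((\<lambda>t. indicator {0<..} v *\<^sub>R exp (- t * (cosh (v / sqrt t) - 1))) \<longlongrightarrow> ?w v) at_top"
        unfolding cosh_field_def by (intro tendsto_scaleR tendsto_const) (simp add: power2_eq_square)
    qed
    show "\<forall>\<^sub>F t in at_top. AE v in lborel.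
        norm (indicator {0<..} v *\<^sub>R exp (- t * (cosh (v / sqrt t) - 1))) \<le> ?w v"
      using eventually_gt_at_top[of 0]
    proof eventually_elim
      case (elim t)
      show ?case using scaled_kernel_le[OF elim] by (auto split: split_indicator intro!: AE_I2)
    qed
  qed (use G in auto)
  then have "((\<lambda>t. LINT v|lborel. indicator {0<..} v *\<^sub>R exp (- t * (cosh (v / sqrt t) - 1)))
      \<longlongrightarrow> sqrt (pi / 2)) at_top"
    using G by simp
  then show ?thesis
    by (rule Lim_transform_eventually)
       (use bessel_K0_scaled in \<open>auto intro!: eventually_mono[OF eventually_gt_at_top[of 0]]\<close>)
qed

lemma bessel_K0_nonneg: "bessel_K0 t \<ge> 0"
  unfolding bessel_K0_def set_lebesgue_integral_def by (rule Bochner_Integration.integral_nonneg) auto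

lemma bessel_K0_le_exp:
  assumes t: "t > 0"
  shows "sqrt t * exp t * bessel_K0 t \<le> sqrt (pi / 2)"
proof -
  note G = has_bochner_integral_gaussian_half[unfolded has_bochner_integral_iff]
  have "(LINT v|lborel. indicator {0<..} v *\<^sub>R exp (- t * (cosh (v / sqrt t) - 1)))
     \<le> (LINT v|lborel. indicator {0<..} v *\<^sub>R exp (- v\<^sup>2 / 2))"
  proof (rule integral_mono)
    show "integrable lborel (\<lambda>v. indicator {0<..} v *\<^sub>R exp (- t * (cosh (v / sqrt t) - 1)))"
      by (rule Bochner_Integration.integrable_bound[OF conjunct1[OF G]])
         (use scaled_kernel_le[OF t] in \<open>auto split: split_indicator\<close>)
  qed (use G scaled_kernel_le[OF t] in \<open>auto split: split_indicator\<close>)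
  then show ?thesis using bessel_K0_scaled[OF t] G by simp
qed

text \<open>K_0 is logarithmic at 0; a power t^(-e) dominates it, and e can be chosen so small that
  a k-fold product stays integrable. The bound is exp(- x) \<le> x^(-e) at x = t exp(u) / 2.\<close>

lemma bessel_K0_le_powr:
  assumes t: "t > 0" and e: "0 < e" "e \<le> 1"
  shows "bessel_K0 t \<le> 2 / e * t powr (- e)"
proof -
  have ex: "exp (- x) \<le> x powr (- e)" if "x > 0" for x :: real
  proof -
    have "x powr e \<le> exp x"
    proof (cases "x \<ge> 1")
      case True
      then have "x powr e \<le> x powr 1" using e by (intro powr_mono) auto
      also have "\<dots> \<le> exp x" using that exp_ge_add_one_self[of x] by (simp; linarith)
      finally show ?thesis .
    next
      case False
      then have "x powr e \<le> 1 powr e" using that e by (intro powr_mono2) auto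
      also have "\<dots> \<le> exp x" using that by simp
      finally show ?thesis .
    qed
    then show ?thesis using that by (simp add: powr_minus exp_minus field_simps)
  qed
  have bd: "exp (- t * cosh u) \<le> 2 * t powr (- e) * exp (- e * u)" for u
  proof -
    have "exp (- t * cosh u) \<le> exp (- (t * exp u / 2))"
      using cosh_ge_half_exp[of u] t by simp
    also have "\<dots> \<le> (t * exp u / 2) powr (- e)" by (rule ex) (use t in simp)
    also have "\<dots> = 2 powr e * t powr (- e) * exp (- e * u)"
      using t by (simp add: powr_mult powr_divide powr_minus exp_powr_real exp_minus field_simps)
    also have "\<dots> \<le> 2 * t powr (- e) * exp (- e * u)"
      using powr_mono[of e 1 2] e by (intro mult_right_mono) auto
    finally show ?thesis .
  qed
  have I: "set_integrable lborel {0<..} (\<lambda>u::real. exp (- e * u))"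
    by (rule set_integrable_dominated[OF set_integrable_Gamma[of 1 e]]) (use e in auto)
  have "(LINT u:{0<..}|lborel. exp (- e * u)) = (LINT u:{0<..}|lborel. u powr (1 - 1) * exp (- e * u))"
    by (rule set_lebesgue_integral_cong) auto
  also have "\<dots> = 1 / e" using e by (subst set_integral_Gamma) auto
  finally have J: "(LINT u:{0<..}|lborel. exp (- e * u)) = 1 / e" .
  have "bessel_K0 t \<le> (LINT u:{0<..}|lborel. 2 * t powr (- e) * exp (- e * u))"
    unfolding bessel_K0_def
    by (rule set_integral_mono)
       (use cosh_laplace_integrable[OF t, of 0] bd set_integrable_mult_right[OF I] in simp_all)
  also have "\<dots> = 2 / e * t powr (- e)" using J by simp
  finally show ?thesis .
qed

text \<open>Up to t = 1 the small negative power controls the singularity; beyond 1 the factor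
  t^(-1/2) of the exponential bound is at most t^(-e), which is why e \<le> 1/2 is assumed.\<close>

lemma bessel_K0_bound:
  assumes e: "0 < e" "e \<le> 1 / 2"
  obtains C where "C \<ge> 1" "\<And>t. t > 0 \<Longrightarrow> bessel_K0 t \<le> C * t powr (- e) * exp (- t)"
proof
  let ?C = "max (2 / e * exp 1) (sqrt (pi / 2))"
  have "1 \<le> 2 / e * 1" using e by (simp add: field_simps)
  also have "\<dots> \<le> 2 / e * exp 1" using e by (intro mult_left_mono) auto
  finally show "?C \<ge> 1" by simp
  fix t :: real assume t: "t > 0"
  show "bessel_K0 t \<le> ?C * t powr (- e) * exp (- t)"
  proof (cases "t \<le> 1")
    case True
    have "bessel_K0 t \<le> 2 / e * t powr (- e) * 1" using bessel_K0_le_powr[OF t, of e] e by simp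
    also have "\<dots> \<le> 2 / e * t powr (- e) * (exp 1 * exp (- t))"
      using True e by (intro mult_left_mono) (auto simp flip: exp_add)
    also have "\<dots> = 2 / e * exp 1 * t powr (- e) * exp (- t)" by (simp only: mult_ac)
    also have "\<dots> \<le> ?C * t powr (- e) * exp (- t)" by (intro mult_right_mono) auto
    finally show ?thesis .
  next
    case False
    have "bessel_K0 t \<le> sqrt (pi / 2) * t powr (- (1 / 2)) * exp (- t)"
      using bessel_K0_le_exp[OF t] t by (simp add: powr_minus powr_half_sqrt exp_minus field_simps)
    also have "\<dots> \<le> ?C * t powr (- e) * exp (- t)"
      using False e by (intro mult_mono powr_mono mult_nonneg_nonneg) (auto simp: le_max_iff_disj)
    finally show ?thesis .
  qed
qed

subsection \<open>The functions $I_0$ and $K_0$ with their logarithmic derivatives\<close>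

text \<open>\<open>theta_I0\<close> and \<open>theta_K0\<close> are the images under \<open>\<theta> = t d/dt\<close>.\<close>

definition theta_I0 :: "real \<Rightarrow> real" where
  "theta_I0 t = (\<Sum>n. 2 * real n * (t / 2) ^ (2 * n) / (fact n)\<^sup>2)"

definition theta_K0 :: "real \<Rightarrow> real" where
  "theta_K0 t = - t * cosh_laplace 1 t"

lemma summable_bessel_coeffs:
  fixes x :: real
  assumes "\<And>n. \<bar>c n\<bar> \<le> 1 / fact n"
  shows "summable (\<lambda>n. c n * x ^ n)"
proof (rule summable_comparison_test[OF _ summable_exp[of "\<bar>x\<bar>"]], intro exI allI impI)
  fix n
  show "norm (c n * x ^ n) \<le> inverse (fact n) * \<bar>x\<bar> ^ n"
    using mult_right_mono[OF assms[of n], of "\<bar>x\<bar> ^ n"]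
    by (simp add: abs_mult power_abs inverse_eq_divide)
qed

text \<open>I_0 and half of its image under \<theta> are the power series with coefficients
  \<open>c\<close> and \<open>e\<close> in x = t^2/4. The identity \<open>diffs e = c\<close> is
  Bessel's equation for I_0 on the level of coefficients.\<close>

lemma bessel_series:
  defines "c \<equiv> \<lambda>n. 1 / (fact n)\<^sup>2 :: real" and "e \<equiv> \<lambda>n. real n / (fact n)\<^sup>2"
  shows "summable (\<lambda>n. c n * x ^ n)" "summable (\<lambda>n. e n * x ^ n)"
    "summable (\<lambda>n. diffs c n * x ^ n)"
    "diffs e = c" "(\<Sum>n. e n * x ^ n) = x * (\<Sum>n. diffs c n * x ^ n)"
    "diffs c n = 1 / (fact n * fact (Suc n))"
proof -
  have f: "(fact n :: real) \<ge> 1" for n by (rule fact_ge_1)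
  have fn: "(fact n :: real) \<ge> real n" for n
    using fact_ge_self[of n] by (metis of_nat_fact of_nat_le_iff)
  have d: "diffs c n = 1 / (fact n * fact (Suc n))" for n
    by (simp add: diffs_def c_def power2_eq_square field_simps del: of_nat_Suc)
  from d show "diffs c n = 1 / (fact n * fact (Suc n))" .
  show s1: "summable (\<lambda>n. c n * x ^ n)"
    by (rule summable_bessel_coeffs) (use f in \<open>auto simp: c_def power2_eq_square field_simps\<close>)
  show s2: "summable (\<lambda>n. e n * x ^ n)"
    by (rule summable_bessel_coeffs) (use fn in \<open>auto simp: e_def power2_eq_square field_simps\<close>)
  show s3: "summable (\<lambda>n. diffs c n * x ^ n)"
  proof (rule summable_bessel_coeffs)
    fix n show "\<bar>diffs c n\<bar> \<le> 1 / fact n"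
      unfolding d using f[of "Suc n"] f[of n] by (simp add: divide_le_eq field_simps del: fact_Suc)
  qed
  show "diffs e = c"
  proof
    fix n
    have "diffs e n = real (Suc n) * real (Suc n) / (real (Suc n) * fact n)\<^sup>2"
      by (simp add: diffs_def e_def del: of_nat_Suc)
    then show "diffs e n = c n"
      by (simp add: c_def power2_eq_square del: of_nat_Suc)
  qed
  have "(\<Sum>n. e n * x ^ n) = e 0 + (\<Sum>n. e (Suc n) * x ^ n) * x"
    using powser_split_head(1)[OF s2] by simp
  also have "e 0 = 0" by (simp add: e_def)
  also have "(\<lambda>n. e (Suc n) * x ^ n) = (\<lambda>n. diffs c n * x ^ n)"
    by (rule ext) (simp add: e_def c_def diffs_def)
  finally show "(\<Sum>n. e n * x ^ n) = x * (\<Sum>n. diffs c n * x ^ n)" by simp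
qed

lemma half_power_even: "((t::real) / 2) ^ (2 * n) = (t\<^sup>2 / 4) ^ n"
  by (simp add: power_mult power_divide)

lemma bessel_I0_eq: "bessel_I0 t = (\<Sum>n. 1 / (fact n)\<^sup>2 * (t\<^sup>2 / 4) ^ n)"
  unfolding bessel_I0_def half_power_even by simp

lemma theta_I0_eq: "theta_I0 t = 2 * (\<Sum>n. real n / (fact n)\<^sup>2 * (t\<^sup>2 / 4) ^ n)"
  unfolding theta_I0_def half_power_even
  by (subst suminf_mult[OF bessel_series(2), symmetric]) (simp add: mult_ac)

lemma DERIV_bessel_I0:
  assumes "t > 0"
  shows "(bessel_I0 has_real_derivative theta_I0 t / t) (at t)"
proof -
  let ?c = "\<lambda>n. 1 / (fact n)\<^sup>2 :: real"
  have "((\<lambda>x. \<Sum>n. ?c n * x ^ n) has_real_derivative (\<Sum>n. diffs ?c n * (t\<^sup>2 / 4) ^ n)) (at (t\<^sup>2 / 4))"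
    by (rule termdiffs_strong_converges_everywhere) (rule bessel_series)
  moreover have "((\<lambda>t. t\<^sup>2 / 4) has_real_derivative t / 2) (at t)"
    by (auto intro!: derivative_eq_intros)
  ultimately have "((\<lambda>t. \<Sum>n. ?c n * (t\<^sup>2 / 4) ^ n) has_real_derivative
      (\<Sum>n. diffs ?c n * (t\<^sup>2 / 4) ^ n) * (t / 2)) (at t)"
    by (rule DERIV_chain2)
  also have "(\<Sum>n. diffs ?c n * (t\<^sup>2 / 4) ^ n) * (t / 2) = theta_I0 t / t"
    using assms unfolding theta_I0_eq bessel_series(5) by (simp add: power2_eq_square)
  finally show ?thesis by (simp add: bessel_I0_eq[abs_def])
qed

lemma DERIV_theta_I0:
  "(theta_I0 has_real_derivative t * bessel_I0 t) (at t)"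
proof -
  let ?e = "\<lambda>n. real n / (fact n)\<^sup>2 :: real"
  have "((\<lambda>x. \<Sum>n. ?e n * x ^ n) has_real_derivative (\<Sum>n. diffs ?e n * (t\<^sup>2 / 4) ^ n)) (at (t\<^sup>2 / 4))"
    by (rule termdiffs_strong_converges_everywhere) (rule bessel_series)
  moreover have "((\<lambda>t. t\<^sup>2 / 4) has_real_derivative t / 2) (at t)"
    by (auto intro!: derivative_eq_intros)
  ultimately have "((\<lambda>t. \<Sum>n. ?e n * (t\<^sup>2 / 4) ^ n) has_real_derivative
      (\<Sum>n. diffs ?e n * (t\<^sup>2 / 4) ^ n) * (t / 2)) (at t)"
    by (rule DERIV_chain2)
  from DERIV_cmult[OF this, of 2] show ?thesis
    unfolding bessel_series(4) by (simp add: theta_I0_eq[abs_def] bessel_I0_eq mult_ac)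
qed

lemma DERIV_bessel_K0:
  assumes "t > 0"
  shows "(bessel_K0 has_real_derivative theta_K0 t / t) (at t)"
  using DERIV_cosh_laplace[OF assms, of 0] assms by (simp add: bessel_K0_eq theta_K0_def)

lemma DERIV_theta_K0:
  assumes t: "t > 0"
  shows "(theta_K0 has_real_derivative t * bessel_K0 t) (at t)"
proof -
  have "(theta_K0 has_real_derivative - cosh_laplace 1 t + t * cosh_laplace 2 t) (at t)"
    unfolding theta_K0_def
    by (auto intro!: derivative_eq_intros DERIV_cosh_laplace t simp: numeral_2_eq_2)
  also have "- cosh_laplace 1 t + t * cosh_laplace 2 t = t * bessel_K0 t"
    using cosh_laplace_recurrence[OF t] by (simp add: bessel_K0_eq algebra_simps)
  finally show ?thesis .
qed

text \<open>With a_n = (t/2)^n / n! the functions are the sums of a_n a_n and of t a_n a_(n+1). One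
  factor is bounded by exp(t/2), the other sums to exp(t/2).\<close>

lemma bessel_I0_bounds:
  assumes t: "t \<ge> 0"
  shows "0 \<le> bessel_I0 t" "bessel_I0 t \<le> exp t" "0 \<le> theta_I0 t" "theta_I0 t \<le> t * exp t"
proof -
  define a where "a n = (t / 2) ^ n / fact n" for n
  have a0: "a n \<ge> 0" for n using t by (simp add: a_def)
  have sa: "a sums exp (t / 2)"
    using exp_converges[of "t / 2"] by (simp add: a_def[abs_def] field_simps)
  have le: "a n \<le> exp (t / 2)" for n
    using sum_le_suminf[of a "{n}"] sa a0 by (auto simp: sums_iff)
  have ssum: "summable (\<lambda>n. a n * exp (t / 2))" "(\<Sum>n. a n * exp (t / 2)) = exp t"
    using sums_mult2[OF sa, of "exp (t / 2)"] by (simp_all add: sums_iff flip: exp_add)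
  have I: "bessel_I0 t = (\<Sum>n. a n * a n)"
    unfolding bessel_I0_def a_def power_even_eq by (simp add: power2_eq_square)
  have sI: "summable (\<lambda>n. a n * a n)"
    by (rule summable_comparison_test'[OF ssum(1)]) (use a0 le in \<open>auto intro!: mult_left_mono\<close>)
  show "0 \<le> bessel_I0 t" unfolding I using a0 by (intro suminf_nonneg sI) auto
  show "bessel_I0 t \<le> exp t"
    unfolding I ssum(2)[symmetric] using a0 le by (intro suminf_le sI ssum mult_left_mono) auto
  let ?d = "diffs (\<lambda>n. 1 / (fact n)\<^sup>2 :: real)"
  have d: "t / 2 * (?d n * (t\<^sup>2 / 4) ^ n) = a n * a (Suc n)" for n
    unfolding half_power_even[symmetric]
    unfolding bessel_series(6) power_even_eq by (simp add: a_def power2_eq_square mult_ac del: fact_Suc)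
  have sJ: "summable (\<lambda>n. a n * a (Suc n))"
    by (rule summable_comparison_test'[OF ssum(1)]) (use a0 le in \<open>auto intro!: mult_left_mono\<close>)
  have "theta_I0 t = t * (t / 2 * (\<Sum>n. ?d n * (t\<^sup>2 / 4) ^ n))"
    unfolding theta_I0_eq bessel_series(5) by (simp add: power2_eq_square)
  also have "t / 2 * (\<Sum>n. ?d n * (t\<^sup>2 / 4) ^ n) = (\<Sum>n. a n * a (Suc n))"
    unfolding d[symmetric] by (rule suminf_mult[symmetric]) (rule bessel_series)
  finally have J: "theta_I0 t = t * (\<Sum>n. a n * a (Suc n))" .
  show "0 \<le> theta_I0 t" unfolding J using a0 t by (intro mult_nonneg_nonneg suminf_nonneg sJ) auto
  show "theta_I0 t \<le> t * exp t"
    unfolding J ssum(2)[symmetric] using a0 le t by (intro mult_left_mono suminf_le sJ ssum) auto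
qed

text \<open>Bessel's equation makes the derivative of the expression vanish, so it equals its limit
  at 0. There I_0 tends to 1, the \<theta>-derivative of K_0 to -1, and in the other product the
  factor t of \<open>theta_I0\<close> beats the singularity of K_0.\<close>

lemma bessel_wronskian:
  assumes t: "t > 0"
  shows "bessel_I0 t * theta_K0 t - theta_I0 t * bessel_K0 t = -1"
proof -
  define W where "W t = bessel_I0 t * theta_K0 t - theta_I0 t * bessel_K0 t" for t
  have D: "(W has_real_derivative 0) (at x)" if "x > 0" for x
  proof -
    have "(W has_real_derivative (bessel_I0 x * (x * bessel_K0 x) + theta_I0 x / x * theta_K0 x)
        - (theta_I0 x * (theta_K0 x / x) + x * bessel_I0 x * bessel_K0 x)) (at x)"
      unfolding W_def
      by (rule derivative_eq_intros refl DERIV_bessel_I0 DERIV_theta_I0 DERIV_bessel_K0 DERIV_theta_K0 that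
          | simp)+
    then show ?thesis by simp
  qed
  have const: "W b = W a" if "0 < a" "a < b" for a b
    by (rule DERIV_isconst_end[OF that(2)])
       (use that D in \<open>auto intro!: continuous_at_imp_continuous_on DERIV_isCont[OF D]\<close>)
  have Wt: "W x = W t" if "x > 0" for x
    using const[of x t] const[of t x] t that by (cases x t rule: linorder_cases) auto
  have "isCont bessel_I0 0"
  proof -
    have "isCont (\<lambda>x. \<Sum>n. 1 / (fact n)\<^sup>2 * x ^ n) ((0::real)\<^sup>2 / 4)"
      by (rule isCont_powser_converges_everywhere) (rule bessel_series)
    moreover have "isCont (\<lambda>t. t\<^sup>2 / 4) (0::real)" by (intro continuous_intros) auto
    ultimately show ?thesis unfolding bessel_I0_eq[abs_def] by (rule isCont_o2[rotated])
  qed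
  moreover have "bessel_I0 0 = 1"
    using powser_zero[of "\<lambda>n. 1 / (fact n)\<^sup>2 :: real"] by (simp add: bessel_I0_eq)
  ultimately have I: "(bessel_I0 \<longlongrightarrow> 1) (at_right 0)"
    by (auto simp: isCont_def dest: tendsto_mono[OF at_le, rotated])
  have TK: "(theta_K0 \<longlongrightarrow> - 1) (at_right 0)"
  proof (rule tendsto_sandwich)
    show "\<forall>\<^sub>F x in at_right 0. - ((1 + x) * exp (- x)) \<le> theta_K0 x"
      using cosh_laplace_1_bounds by (auto simp: theta_K0_def eventually_at_filter)
    show "\<forall>\<^sub>F x in at_right 0. theta_K0 x \<le> - exp (- x)"
      using cosh_laplace_1_bounds by (auto simp: theta_K0_def eventually_at_filter)
    show "((\<lambda>x::real. - ((1 + x) * exp (- x))) \<longlongrightarrow> - 1) (at_right 0)" by real_asymp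
    show "((\<lambda>x::real. - exp (- x)) \<longlongrightarrow> - 1) (at_right 0)" by real_asymp
  qed
  have Z: "((\<lambda>x. theta_I0 x * bessel_K0 x) \<longlongrightarrow> 0) (at_right 0)"
  proof (rule Lim_null_comparison)
    have "theta_I0 x * bessel_K0 x \<le> x * exp x * (4 * x powr (- (1 / 2)))" if "x > 0" for x
      using that bessel_I0_bounds[of x] bessel_K0_le_powr[of x "1/2"] bessel_K0_nonneg[of x]
      by (intro mult_mono) auto
    then show "\<forall>\<^sub>F x in at_right 0. norm (theta_I0 x * bessel_K0 x) \<le> x * exp x * (4 * x powr (- (1 / 2)))"
      using bessel_I0_bounds bessel_K0_nonneg by (auto simp: eventually_at_filter abs_mult)
    show "((\<lambda>x::real. x * exp x * (4 * x powr (- (1 / 2)))) \<longlongrightarrow> 0) (at_right 0)" by real_asymp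
  qed
  have "(W \<longlongrightarrow> 1 * (- 1) - 0) (at_right 0)"
    unfolding W_def by (intro tendsto_diff tendsto_mult I TK Z)
  moreover have "(W \<longlongrightarrow> W t) (at_right 0)"
    by (rule tendsto_eventually) (use Wt in \<open>auto simp: eventually_at_filter\<close>)
  ultimately have "1 * (- 1) - 0 = W t"
    by (rule tendsto_unique[OF trivial_limit_at_right_real])
  then show ?thesis by (simp add: W_def)
qed

text \<open>By the Wronskian, (I_0 / K_0)' = 1 / (t K_0^2), whose growth (2/pi) exp(2t) is known
  from K_0. L'Hospital's rule against exp(2t) yields I_0 / K_0 ~ exp(2t) / pi.\<close>

lemma bessel_I0_asymp: "((\<lambda>t. sqrt t * exp (- t) * bessel_I0 t) \<longlongrightarrow> 1 / sqrt (2 * pi)) at_top"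
proof -
  have "\<forall>\<^sub>F t in at_top. sqrt t * exp t * bessel_K0 t > 0"
    by (rule order_tendstoD[OF bessel_K0_asymp]) simp
  then have pos: "\<forall>\<^sub>F t in at_top. t > 0 \<and> bessel_K0 t > 0"
    using eventually_gt_at_top[of 0] proof eventually_elim
    case (elim t)
    then show ?case using bessel_K0_nonneg[of t] by (cases "bessel_K0 t = 0") auto
  qed
  have "((\<lambda>t. (bessel_I0 t / bessel_K0 t) / exp (2 * t)) \<longlongrightarrow> 1 / pi) at_top"
  proof (rule lhospital_at_top_at_top)
    show "LIM x at_top. exp (2 * x) :> (at_top :: real filter)" by real_asymp
    show "\<forall>\<^sub>F x::real in at_top. 2 * exp (2 * x) \<noteq> 0" by simp
    show "\<forall>\<^sub>F x::real in at_top. ((\<lambda>x. exp (2 * x)) has_real_derivative 2 * exp (2 * x)) (at x)"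
      by (auto intro!: always_eventually derivative_eq_intros)
    show "\<forall>\<^sub>F t in at_top. ((\<lambda>t. bessel_I0 t / bessel_K0 t) has_real_derivative
        1 / (t * bessel_K0 t ^ 2)) (at t)"
      using pos
    proof eventually_elim
      case (elim t)
      have "((\<lambda>t. bessel_I0 t / bessel_K0 t) has_real_derivative
        (theta_I0 t / t * bessel_K0 t - bessel_I0 t * (theta_K0 t / t)) / (bessel_K0 t * bessel_K0 t)) (at t)"
        using elim by (intro DERIV_divide DERIV_bessel_I0 DERIV_bessel_K0) auto
      also have "theta_I0 t / t * bessel_K0 t - bessel_I0 t * (theta_K0 t / t)
          = - (bessel_I0 t * theta_K0 t - theta_I0 t * bessel_K0 t) / t"
        by (simp add: diff_divide_distrib)
      also have "bessel_I0 t * theta_K0 t - theta_I0 t * bessel_K0 t = -1"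
        using elim by (intro bessel_wronskian) auto
      finally show ?case by (simp add: power2_eq_square mult_ac)
    qed
    have "((\<lambda>t. 1 / (2 * (sqrt t * exp t * bessel_K0 t) ^ 2)) \<longlongrightarrow> 1 / (2 * (sqrt (pi / 2)) ^ 2)) at_top"
      by (intro tendsto_intros bessel_K0_asymp) auto
    then have "((\<lambda>t. 1 / (2 * (sqrt t * exp t * bessel_K0 t) ^ 2)) \<longlongrightarrow> 1 / pi) at_top"
      by simp
    then show "((\<lambda>t. 1 / (t * bessel_K0 t ^ 2) / (2 * exp (2 * t))) \<longlongrightarrow> 1 / pi) at_top"
      by (rule Lim_transform_eventually)
         (use eventually_gt_at_top[of 0] in eventually_elim,
          simp add: power_mult_distrib exp_double)
  qed
  from tendsto_mult[OF this bessel_K0_asymp]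
  have "((\<lambda>t. bessel_I0 t / bessel_K0 t / exp (2 * t) * (sqrt t * exp t * bessel_K0 t))
      \<longlongrightarrow> 1 / pi * sqrt (pi / 2)) at_top" .
  also have "1 / pi * sqrt (pi / 2) = 1 / sqrt (2 * pi)"
    by (simp add: real_sqrt_divide real_sqrt_mult field_simps)
  finally show ?thesis
  proof (rule Lim_transform_eventually)
    show "\<forall>\<^sub>F t in at_top. bessel_I0 t / bessel_K0 t / exp (2 * t) * (sqrt t * exp t * bessel_K0 t)
        = sqrt t * exp (- t) * bessel_I0 t"
      using pos
    proof eventually_elim
      case (elim t)
      have "exp (2 * t) = exp t * exp t" by (simp add: exp_double power2_eq_square)
      then show ?case using elim by (simp add: exp_minus field_simps)
    qed
  qed
qed

subsection \<open>Derivatives and bounds for coefficients of polynomials depending on a parameter\<close>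

text \<open>The polynomial variable counts factors I_0 or \<theta>I_0, so one coefficientwise
  product rule handles all rows of the matrix simultaneously.\<close>

definition has_coeff_deriv :: "(real \<Rightarrow> real poly) \<Rightarrow> real poly \<Rightarrow> real \<Rightarrow> bool" where
  "has_coeff_deriv p p' t \<longleftrightarrow> (\<forall>i. ((\<lambda>x. poly.coeff (p x) i) has_real_derivative poly.coeff p' i) (at t))"

lemma has_coeff_deriv_mult:
  assumes "has_coeff_deriv p p' t" "has_coeff_deriv q q' t"
  shows "has_coeff_deriv (\<lambda>x. p x * q x) (p' * q t + p t * q') t"
  unfolding has_coeff_deriv_def
proof
  fix i
  have "((\<lambda>x. \<Sum>j\<le>i. poly.coeff (p x) j * poly.coeff (q x) (i - j)) has_real_derivative
     (\<Sum>j\<le>i. poly.coeff p' j * poly.coeff (q t) (i - j) + poly.coeff q' (i - j) * poly.coeff (p t) j)) (at t)"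
    using assms unfolding has_coeff_deriv_def by (intro DERIV_sum DERIV_mult) auto
  then show "((\<lambda>x. poly.coeff (p x * q x) i) has_real_derivative poly.coeff (p' * q t + p t * q') i) (at t)"
    by (simp add: coeff_mult sum.distrib mult.commute[of "poly.coeff q' _"])
qed

lemma has_coeff_deriv_power:
  assumes "has_coeff_deriv p p' t"
  shows "has_coeff_deriv (\<lambda>x. p x ^ n) (of_nat n * p t ^ (n - 1) * p') t"
proof (induction n)
  case 0
  then show ?case by (simp add: has_coeff_deriv_def)
next
  case (Suc n)
  have "p' * p t ^ n + p t * (of_nat n * p t ^ (n - 1) * p') = of_nat (Suc n) * p t ^ n * p'"
    by (cases n) (simp_all add: algebra_simps)
  then show ?case
    using has_coeff_deriv_mult[OF assms Suc.IH] by simp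
qed

lemma has_coeff_deriv_smult:
  assumes "has_coeff_deriv p p' t"
  shows "has_coeff_deriv (\<lambda>x. Polynomial.smult c (p x)) (Polynomial.smult c p') t"
  using assms unfolding has_coeff_deriv_def by (auto intro!: DERIV_cmult)

lemma has_coeff_deriv_linear:
  assumes "(f has_real_derivative f') (at t)" "(g has_real_derivative g') (at t)"
  shows "has_coeff_deriv (\<lambda>x. [:f x, g x:]) [:f', g':] t"
  unfolding has_coeff_deriv_def
proof
  fix i show "((\<lambda>x. poly.coeff [:f x, g x:] i) has_real_derivative poly.coeff [:f', g':] i) (at t)"
    using assms by (auto simp: coeff_pCons split: nat.split)
qed

text \<open>Models a product of n solutions: i growing factors exp(t) and n - i decaying factors
  exp(- t), with \<open>w\<close> bounding the algebraic part of each factor. The exponents add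
  under multiplication, so the property is multiplicative.\<close>

definition coeff_bounded :: "(real \<Rightarrow> real) \<Rightarrow> nat \<Rightarrow> (real \<Rightarrow> real poly) \<Rightarrow> bool" where
  "coeff_bounded w n p \<longleftrightarrow>
     (\<forall>i. \<exists>C\<ge>0. \<forall>t>0. \<bar>poly.coeff (p t) i\<bar> \<le> C * w t ^ n * exp (- (real n - 2 * real i) * t))"

lemma coeff_bounded_mult:
  assumes "coeff_bounded w m p" "coeff_bounded w n q" and w: "\<And>t. t > 0 \<Longrightarrow> w t \<ge> 0"
  shows "coeff_bounded w (m + n) (\<lambda>t. p t * q t)"
  unfolding coeff_bounded_def
proof
  fix i
  let ?e = "\<lambda>n i t. exp (- (real n - 2 * real i) * t)"
  obtain C where C: "\<And>j. C j \<ge> 0" "\<And>j t. t > 0 \<Longrightarrow> \<bar>poly.coeff (p t) j\<bar> \<le> C j * w t ^ m * ?e m j t"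
    using assms(1) unfolding coeff_bounded_def by metis
  obtain D where D: "\<And>j. D j \<ge> 0" "\<And>j t. t > 0 \<Longrightarrow> \<bar>poly.coeff (q t) j\<bar> \<le> D j * w t ^ n * ?e n j t"
    using assms(2) unfolding coeff_bounded_def by metis
  show "\<exists>C\<ge>0. \<forall>t>0. \<bar>poly.coeff (p t * q t) i\<bar> \<le> C * w t ^ (m + n) * ?e (m + n) i t"
  proof (intro exI[of _ "\<Sum>j\<le>i. C j * D (i - j)"] conjI allI impI)
    show "(\<Sum>j\<le>i. C j * D (i - j)) \<ge> 0" using C D by (intro sum_nonneg mult_nonneg_nonneg) auto
    fix t :: real assume t: "t > 0"
    have "\<bar>poly.coeff (p t * q t) i\<bar> \<le> (\<Sum>j\<le>i. \<bar>poly.coeff (p t) j * poly.coeff (q t) (i - j)\<bar>)"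
      unfolding coeff_mult by (rule sum_abs)
    also have "\<dots> \<le> (\<Sum>j\<le>i. (C j * w t ^ m * ?e m j t) * (D (i - j) * w t ^ n * ?e n (i - j) t))"
      unfolding abs_mult using C(1) D(1) w[OF t]
      by (intro sum_mono mult_mono C(2)[OF t] D(2)[OF t]) auto
    also have "\<dots> = (\<Sum>j\<le>i. C j * D (i - j) * (w t ^ (m + n) * ?e (m + n) i t))"
    proof (rule sum.cong[OF refl])
      fix j assume "j \<in> {..i}"
      then have "?e m j t * ?e n (i - j) t = ?e (m + n) i t"
        unfolding exp_add[symmetric] by (simp add: of_nat_diff algebra_simps)
      moreover have "(C j * w t ^ m * ?e m j t) * (D (i - j) * w t ^ n * ?e n (i - j) t)
          = C j * D (i - j) * (w t ^ (m + n) * (?e m j t * ?e n (i - j) t))"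
        by (simp only: power_add mult_ac)
      ultimately show "(C j * w t ^ m * ?e m j t) * (D (i - j) * w t ^ n * ?e n (i - j) t)
          = C j * D (i - j) * (w t ^ (m + n) * ?e (m + n) i t)"
        by simp
    qed
    also have "\<dots> = (\<Sum>j\<le>i. C j * D (i - j)) * w t ^ (m + n) * ?e (m + n) i t"
      by (simp only: sum_distrib_right mult.assoc)
    finally show "\<bar>poly.coeff (p t * q t) i\<bar> \<le> (\<Sum>j\<le>i. C j * D (i - j)) * w t ^ (m + n) * ?e (m + n) i t" .
  qed
qed

lemma coeff_bounded_power:
  assumes "coeff_bounded w 1 p" and w: "\<And>t. t > 0 \<Longrightarrow> w t \<ge> 0"
  shows "coeff_bounded w n (\<lambda>t. p t ^ n)"
proof (induction n)
  case 0
  have "\<exists>C\<ge>0. \<forall>t>0. \<bar>poly.coeff 1 i\<bar> \<le> C * exp (2 * real i * t)" for i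
    by (rule exI[of _ 1]) (auto simp: coeff_1)
  then show ?case by (simp add: coeff_bounded_def)
next
  case (Suc n)
  from coeff_bounded_mult[OF assms(1) Suc w] show ?case by simp
qed

lemma coeff_bounded_smult:
  assumes "coeff_bounded w n p"
  shows "coeff_bounded w n (\<lambda>t. Polynomial.smult c (p t))"
  unfolding coeff_bounded_def
proof
  fix i
  obtain C where "C \<ge> 0" "\<And>t. t > 0 \<Longrightarrow> \<bar>poly.coeff (p t) i\<bar> \<le> C * w t ^ n * exp (- (real n - 2 * real i) * t)"
    using assms unfolding coeff_bounded_def by blast
  then show "\<exists>C\<ge>0. \<forall>t>0. \<bar>poly.coeff (Polynomial.smult c (p t)) i\<bar> \<le> C * w t ^ n * exp (- (real n - 2 * real i) * t)"
    by (intro exI[of _ "\<bar>c\<bar> * C"]) (auto simp: abs_mult mult.assoc intro!: mult_left_mono)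
qed

lemma coeff_bounded_linear:
  assumes "\<And>t. t > 0 \<Longrightarrow> \<bar>f t\<bar> \<le> C * w t * exp (- t)" "C \<ge> 0"
    "\<And>t. t > 0 \<Longrightarrow> \<bar>g t\<bar> \<le> w t * exp t" and w: "\<And>t. t > 0 \<Longrightarrow> w t \<ge> 0"
  shows "coeff_bounded w 1 (\<lambda>t. [:f t, g t:])"
  unfolding coeff_bounded_def
proof
  fix i :: nat
  consider "i = 0" | "i = 1" | j where "i = Suc (Suc j)"
    by (metis One_nat_def not0_implies_Suc)
  then show "\<exists>C\<ge>0. \<forall>t>0. \<bar>poly.coeff [:f t, g t:] i\<bar> \<le> C * w t ^ 1 * exp (- (real 1 - 2 * real i) * t)"
  proof cases
    case 1
    then show ?thesis using assms by (intro exI[of _ C]) auto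
  next
    case 2
    then show ?thesis using assms by (intro exI[of _ 1]) auto
  next
    case 3
    then show ?thesis using w by (intro exI[of _ 1]) auto
  qed
qed

subsection \<open>Mellin moments of the symmetric power\<close>

text \<open>
  The coefficient of \<open>x\<^sup>i\<close> in \<open>bessel_sym k m t\<close> is a multiple of the part of degree \<open>i\<close> in
  \<open>I\<^sub>0\<close>, \<open>\<theta>I\<^sub>0\<close> of \<open>y\<^bsup>k-m\<^esup> (\<theta>y)\<^bsup>m\<^esup>\<close> for the generic solution \<open>y = K\<^sub>0 + x I\<^sub>0\<close> of \<open>\<theta>\<^sup>2 y = t\<^sup>2 y\<close>.
  The falling factorial makes \<open>bessel_sym k (Suc k)\<close> vanish, which closes the recursion.
\<close>

definition bessel_sym :: "nat \<Rightarrow> nat \<Rightarrow> real \<Rightarrow> real poly" where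
  "bessel_sym k m t = Polynomial.smult (\<Prod>l<m. real k - real l)
     ([:bessel_K0 t, bessel_I0 t:] ^ (k - m) * [:theta_K0 t, theta_I0 t:] ^ m)"

lemma bessel_sym_Suc_self: "bessel_sym k (Suc k) t = 0"
  by (simp add: bessel_sym_def)

text \<open>Product rule: \<theta> sends y^(k-m) (\<theta>y)^m to (k - m) times the term of index m
  + 1 plus m t^2 times the term of index m - 1. The falling factorial absorbs k - m in the first
  summand and, as the ratio of consecutive normalisations, puts k - m + 1 into the second.\<close>

lemma bessel_sym_deriv:
  assumes t: "t > 0" and m: "m \<le> k"
  shows "has_coeff_deriv (bessel_sym k m)
    (Polynomial.smult (1 / t) (bessel_sym k (Suc m) t
       + Polynomial.smult (real m * (real k - real m + 1) * t\<^sup>2) (bessel_sym k (m - 1) t))) t"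
proof -
  define Y where "Y t = [:bessel_K0 t, bessel_I0 t:]" for t
  define Z where "Z t = [:theta_K0 t, theta_I0 t:]" for t
  let ?f = "\<lambda>m. \<Prod>l<m. real k - real l"
  have sym: "bessel_sym k m = (\<lambda>t. Polynomial.smult (?f m) (Y t ^ (k - m) * Z t ^ m))" for m
    by (simp add: bessel_sym_def[abs_def] Y_def Z_def)
  have "has_coeff_deriv Y [:theta_K0 t / t, theta_I0 t / t:] t"
    unfolding Y_def by (intro has_coeff_deriv_linear DERIV_bessel_K0 DERIV_bessel_I0 t)
  then have DY: "has_coeff_deriv Y (Polynomial.smult (1 / t) (Z t)) t" by (simp add: Z_def)
  have "has_coeff_deriv Z [:t * bessel_K0 t, t * bessel_I0 t:] t"
    unfolding Z_def by (intro has_coeff_deriv_linear DERIV_theta_K0 DERIV_theta_I0 t)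
  then have DZ: "has_coeff_deriv Z (Polynomial.smult t (Y t)) t" by (simp add: Y_def)
  have D: "has_coeff_deriv (bessel_sym k m) (Polynomial.smult (?f m)
      (of_nat (k - m) * Y t ^ (k - m - 1) * Polynomial.smult (1 / t) (Z t) * Z t ^ m
       + Y t ^ (k - m) * (of_nat m * Z t ^ (m - 1) * Polynomial.smult t (Y t)))) t"
    unfolding sym
    by (intro has_coeff_deriv_smult has_coeff_deriv_mult has_coeff_deriv_power DY DZ)
  have 1: "Polynomial.smult (?f m) (of_nat (k - m) * Y t ^ (k - m - 1) * Polynomial.smult (1 / t) (Z t) * Z t ^ m)
      = Polynomial.smult (1 / t) (bessel_sym k (Suc m) t)"
    using m by (simp add: sym of_nat_diff of_nat_poly mult_ac)
  have 2: "Polynomial.smult (?f m) (Y t ^ (k - m) * (of_nat m * Z t ^ (m - 1) * Polynomial.smult t (Y t)))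
      = Polynomial.smult (1 / t) (Polynomial.smult (real m * (real k - real m + 1) * t\<^sup>2) (bessel_sym k (m - 1) t))"
  proof (cases m)
    case (Suc l)
    then have "k - l = Suc (k - m)" using m by simp
    then show ?thesis
      using Suc t by (simp add: sym of_nat_poly power2_eq_square mult_ac)
  qed simp
  show ?thesis
    using D unfolding smult_add_right 1 2 .
qed

lemma coeff_bessel_sym_0: "i \<le> k \<Longrightarrow> poly.coeff (bessel_sym k 0 t) i
    = real (k choose i) * (bessel_I0 t ^ i * bessel_K0 t ^ (k - i))"
  by (simp add: bessel_sym_def coeff_linear_poly_power)

lemma bessel_sym_bounded:
  assumes m: "m \<le> k" and i: "2 * i < k"
  obtains C where "C \<ge> 0"
    "\<And>t. t > 0 \<Longrightarrow> \<bar>poly.coeff (bessel_sym k m t) i\<bar> \<le> C * t powr (- (1 / 2)) * exp (- t / 2)"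
proof -
  \<comment> \<open>This choice makes the k-th power of t^(-e) equal to t^(-1/2), still integrable
    at 0.\<close>
  define e where "e = 1 / (2 * real k)"
  have k: "k \<ge> 1" using i by simp
  have e: "0 < e" "e \<le> 1 / 2" "e * real k = 1 / 2" using k by (auto simp: e_def field_simps)
  \<comment> \<open>One factor 1 + t compensates t^(-e) for large t, the other bounds the additional
    factor 1 + t of the \<theta>-derivatives.\<close>
  define w where "w t = t powr (- e) * (1 + t)\<^sup>2" for t
  have w1: "1 + t \<le> w t" if t: "t > 0" for t
  proof -
    have "t powr e \<le> 1 + t"
    proof (cases "t \<ge> 1")
      case True
      then have "t powr e \<le> t powr 1" using e by (intro powr_mono) auto
      then show ?thesis using t by simp
    next
      case False
      then have "t powr e \<le> 1 powr e" using e t by (intro powr_mono2) auto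
      then show ?thesis using t by simp
    qed
    then have "1 \<le> t powr (- e) * (1 + t)" using t by (simp add: powr_minus field_simps)
    from mult_right_mono[OF this, of "1 + t"] t show ?thesis
      by (simp add: w_def power2_eq_square mult_ac)
  qed
  have w0: "w t \<ge> 0" if "t > 0" for t using w1[OF that] that by simp
  obtain C where C: "C \<ge> 1" "\<And>t. t > 0 \<Longrightarrow> bessel_K0 t \<le> C * t powr (- e) * exp (- t)"
    using bessel_K0_bound[OF e(1,2)] by blast
  have Y: "coeff_bounded w 1 (\<lambda>t. [:bessel_K0 t, bessel_I0 t:])"
  proof (rule coeff_bounded_linear[where C = C])
    fix t :: real assume t: "t > 0"
    have "C * t powr (- e) * 1 * exp (- t) \<le> C * t powr (- e) * (1 + t)\<^sup>2 * exp (- t)"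
      using C t by (intro mult_right_mono mult_left_mono) (auto simp: power2_eq_square algebra_simps)
    then show "\<bar>bessel_K0 t\<bar> \<le> C * w t * exp (- t)"
      using C(2)[OF t] bessel_K0_nonneg[of t] by (simp add: w_def mult_ac)
    have "1 * exp t \<le> w t * exp t" using w1[OF t] t by (intro mult_right_mono) auto
    with bessel_I0_bounds(1,2)[of t] t show "\<bar>bessel_I0 t\<bar> \<le> w t * exp t"
      by linarith
  qed (use C w0 in auto)
  have Z: "coeff_bounded w 1 (\<lambda>t. [:theta_K0 t, theta_I0 t:])"
  proof (rule coeff_bounded_linear[where C = 1])
    fix t :: real assume t: "t > 0"
    have "0 \<le> t * cosh_laplace 1 t" using cosh_laplace_1_bounds(1)[OF t] by (rule order_trans[rotated]) simp
    then have "\<bar>theta_K0 t\<bar> \<le> (1 + t) * exp (- t)"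
      using cosh_laplace_1_bounds(2)[OF t] by (simp add: theta_K0_def)
    also have "\<dots> \<le> w t * exp (- t)" using w1[OF t] by (intro mult_right_mono) auto
    finally show "\<bar>theta_K0 t\<bar> \<le> 1 * w t * exp (- t)" by simp
    have "t * exp t \<le> w t * exp t" using w1[OF t] t by (intro mult_right_mono) auto
    with bessel_I0_bounds(3,4)[of t] t show "\<bar>theta_I0 t\<bar> \<le> w t * exp t"
      by linarith
  qed (use w0 in auto)
  have "coeff_bounded w (k - m + m) (bessel_sym k m)"
    unfolding bessel_sym_def[abs_def]
    by (intro coeff_bounded_smult coeff_bounded_mult coeff_bounded_power Y Z w0)
  then obtain D where D: "D \<ge> 0" "\<And>t. t > 0 \<Longrightarrow>
      \<bar>poly.coeff (bessel_sym k m t) i\<bar> \<le> D * w t ^ k * exp (- (real k - 2 * real i) * t)"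
    using m unfolding coeff_bounded_def by auto
  define N where "N = 2 * k"
  have N: "N \<ge> 1" using k by (simp add: N_def)
  show ?thesis
  proof (rule that[of "D * (2 * real N) ^ N"])
    show "D * (2 * real N) ^ N \<ge> 0" using D by simp
    fix t :: real assume t: "t > 0"
    have "w t ^ k = t powr (- (1 / 2)) * (1 + t) ^ N"
    proof -
      have "(t powr (- e)) ^ k = t powr (- (1 / 2))"
        using t powr_power[of t "- e" k]
        by (simp only: mult_minus_right mult.commute[of "real k"] e(3))
      then show ?thesis by (simp only: w_def N_def power_mult_distrib power_mult)
    qed
    \<comment> \<open>As k - 2i \<ge> 1 the decay is at least exp(- t); half of it is spent on the
      polynomial growth of \<open>w t ^ k\<close>.\<close>
    moreover have "(1 + t) ^ N \<le> (2 * real N) ^ N * exp (t / 2)"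
    proof -
      have "2 * real N * (1 + (t / 2) / real N) = 2 * real N + t"
        using N by (simp add: field_simps)
      then have "(1 + t) ^ N \<le> (2 * real N * (1 + (t / 2) / real N)) ^ N"
        using t N by (intro power_mono) linarith+
      also have "\<dots> = (2 * real N) ^ N * (1 + (t / 2) / real N) ^ N" by (rule power_mult_distrib)
      also have "(1 + (t / 2) / real N) ^ N \<le> exp (t / 2)"
        using t N by (intro exp_ge_one_plus_x_over_n_power_n) auto
      finally show ?thesis by (simp add: mult_left_mono)
    qed
    ultimately have wk: "w t ^ k \<le> t powr (- (1 / 2)) * ((2 * real N) ^ N * exp (t / 2))"
      by (simp add: mult_left_mono)
    have "real k - 2 * real i \<ge> 1" using i by linarith
    then have "1 * t \<le> (real k - 2 * real i) * t" using t by (intro mult_right_mono) auto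
    then have ex: "exp (- (real k - 2 * real i) * t) \<le> exp (- t)"
      by (simp only: exp_le_cancel_iff mult_minus_left neg_le_iff_le mult_1)
    have "\<bar>poly.coeff (bessel_sym k m t) i\<bar> \<le> D * w t ^ k * exp (- (real k - 2 * real i) * t)"
      by (rule D(2)[OF t])
    also have "\<dots> \<le> D * (t powr (- (1 / 2)) * ((2 * real N) ^ N * exp (t / 2))) * exp (- t)"
      using wk ex D(1) w0[OF t] by (intro mult_mono mult_left_mono) auto
    also have "\<dots> = D * (2 * real N) ^ N * t powr (- (1 / 2)) * (exp (t / 2) * exp (- t))"
      by (simp only: mult_ac)
    also have "exp (t / 2) * exp (- t) = exp (- t / 2)"
      unfolding exp_add[symmetric] by simp
    finally show "\<bar>poly.coeff (bessel_sym k m t) i\<bar> \<le> D * (2 * real N) ^ N * t powr (- (1 / 2)) * exp (- t / 2)" .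
  qed
qed

section \<open>Integration by parts and the recurrence for the moments\<close>

definition sym_moment :: "nat \<Rightarrow> nat \<Rightarrow> nat \<Rightarrow> nat \<Rightarrow> real" where
  "sym_moment k i m b = (LINT t:{0<..}|lborel. t ^ b * poly.coeff (bessel_sym k m t) i)"

lemma isCont_bessel_sym:
  assumes "t > 0" "m \<le> Suc k"
  shows "isCont (\<lambda>t. poly.coeff (bessel_sym k m t) i) t"
proof (cases "m = Suc k")
  case False
  then show ?thesis
    using bessel_sym_deriv[OF assms(1), of m k] assms(2)
    unfolding has_coeff_deriv_def by (auto intro: DERIV_isCont)
qed (simp add: bessel_sym_Suc_self)

lemma set_borel_measurable_continuous_Ioi:
  fixes f :: "real \<Rightarrow> real"
  assumes "\<And>t. t > 0 \<Longrightarrow> isCont f t"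
  shows "set_borel_measurable lborel {0<..} f"
  using borel_measurable_continuous_on_indicator[of "{0<..}" f] assms
  by (auto simp: set_borel_measurable_def intro: continuous_at_imp_continuous_on)

lemma power_times_powr:
  assumes "t > 0"
  shows "t ^ b * (C * t powr (- (1 / 2)) * exp (- t / 2))
      = C * (t powr (real b + 1 / 2 - 1) * exp (- (1 / 2) * t))"
  using assms by (simp add: powr_realpow[symmetric] mult_ac flip: powr_add)

lemma sym_moment_integrable:
  assumes m: "m \<le> Suc k" and i: "2 * i < k"
  shows "set_integrable lborel {0<..} (\<lambda>t. t ^ b * poly.coeff (bessel_sym k m t) i)"
proof (cases "m = Suc k")
  case False
  with m have "m \<le> k" by simp
  then obtain C where C: "C \<ge> 0"
    "\<And>t. t > 0 \<Longrightarrow> \<bar>poly.coeff (bessel_sym k m t) i\<bar> \<le> C * t powr (- (1 / 2)) * exp (- t / 2)"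
    using bessel_sym_bounded[OF _ i] by metis
  show ?thesis
  proof (rule set_integrable_bound)
    show "set_integrable lborel {0<..} (\<lambda>t. C * (t powr (real b + 1 / 2 - 1) * exp (- (1 / 2) * t)))"
      by (rule set_integrable_mult_right, rule set_integrable_Gamma) auto
    show "set_borel_measurable lborel {0<..} (\<lambda>t. t ^ b * poly.coeff (bessel_sym k m t) i)"
      by (intro set_borel_measurable_continuous_Ioi continuous_intros isCont_bessel_sym m)
    have "\<bar>t ^ b * poly.coeff (bessel_sym k m t) i\<bar>
        \<le> \<bar>C * (t powr (real b + 1 / 2 - 1) * exp (- (1 / 2) * t))\<bar>" if t: "t > 0" for t :: real
    proof -
      have "\<bar>t ^ b * poly.coeff (bessel_sym k m t) i\<bar> = t ^ b * \<bar>poly.coeff (bessel_sym k m t) i\<bar>"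
        using t by (simp add: abs_mult)
      also have "\<dots> \<le> t ^ b * (C * t powr (- (1 / 2)) * exp (- t / 2))"
        using t by (intro mult_left_mono C(2)) auto
      also have "\<dots> = C * (t powr (real b + 1 / 2 - 1) * exp (- (1 / 2) * t))"
        by (rule power_times_powr[OF t])
      also have "\<dots> \<le> \<bar>\<dots>\<bar>" by simp
      finally show ?thesis .
    qed
    then show "AE t in lborel. t \<in> {0<..} \<longrightarrow> norm (t ^ b * poly.coeff (bessel_sym k m t) i)
        \<le> norm (C * (t powr (real b + 1 / 2 - 1) * exp (- (1 / 2) * t)))"
      by (intro AE_I2) auto
  qed
qed (simp add: bessel_sym_Suc_self set_integrable_def)

lemma powr_exp_limits:
  fixes p :: real
  assumes "p > 0"
  shows "((\<lambda>t. t powr p * exp (- (1 / 2) * t)) \<longlongrightarrow> 0) (at_right 0)"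
    "((\<lambda>t. t powr p * exp (- (1 / 2) * t)) \<longlongrightarrow> 0) at_top"
  using assms by real_asymp+

text \<open>Integrate the derivative of t^(b+1) times the coefficient function; the boundary terms
  are bounded by t^(b + 1/2) exp(- t/2) and vanish at both ends. For m = 0 the last coefficient is
  zero, so the truncated index m - 1 is harmless.\<close>

lemma sym_moment_step:
  assumes m: "m \<le> k" and i: "2 * i < k"
  shows "sym_moment k i (Suc m) b = - (real b + 1) * sym_moment k i m b
           - real m * (real k - real m + 1) * sym_moment k i (m - 1) (b + 2)"
proof -
  let ?H = "\<lambda>m t. poly.coeff (bessel_sym k m t) i"
  let ?c = "real m * (real k - real m + 1)"
  let ?f = "\<lambda>t. (real b + 1) * (t ^ b * ?H m t) + (t ^ b * ?H (Suc m) t + ?c * (t ^ (b + 2) * ?H (m - 1) t))"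
  have int: "set_integrable lborel {0<..} (\<lambda>t. t ^ b * ?H l t)" if "l \<le> Suc k" for l b
    using sym_moment_integrable[OF that i] .
  have i1: "set_integrable lborel {0<..} (\<lambda>t. t ^ b * ?H m t)" by (rule int) (use m in simp)
  have i2: "set_integrable lborel {0<..} (\<lambda>t. t ^ b * ?H (Suc m) t)" by (rule int) (use m in simp)
  have i3: "set_integrable lborel {0<..} (\<lambda>t. t ^ (b + 2) * ?H (m - 1) t)" by (rule int) (use m in simp)
  obtain C where C: "C \<ge> 0" "\<And>t. t > 0 \<Longrightarrow> \<bar>?H m t\<bar> \<le> C * t powr (- (1 / 2)) * exp (- t / 2)"
    using bessel_sym_bounded[OF m i] by metis
  have bd: "norm (t ^ Suc b * ?H m t) \<le> C * (t powr (real b + 1 / 2) * exp (- (1 / 2) * t))"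
    if t: "t > 0" for t
  proof -
    have "norm (t ^ Suc b * ?H m t) = t ^ Suc b * \<bar>?H m t\<bar>"
      using t by (simp add: abs_mult)
    also have "\<dots> \<le> t ^ Suc b * (C * t powr (- (1 / 2)) * exp (- t / 2))"
      using t by (intro mult_left_mono C(2)) auto
    also have "\<dots> = C * (t powr (real (Suc b) + 1 / 2 - 1) * exp (- (1 / 2) * t))"
      by (rule power_times_powr[OF t])
    finally show ?thesis by (simp add: add_ac)
  qed
  have "(LINT t:{0<..}|lborel. ?f t) = 0 - 0"
  proof (rule set_integral_FTC_Ioi[where F = "\<lambda>t. t ^ Suc b * ?H m t"])
    fix t :: real assume t: "t > 0"
    have D: "(?H m has_real_derivative 1 / t * (?H (Suc m) t + ?c * t\<^sup>2 * ?H (m - 1) t)) (at t)"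
      using bessel_sym_deriv[OF t m] unfolding has_coeff_deriv_def by simp
    have P: "((\<lambda>t. t ^ Suc b) has_real_derivative (real b + 1) * t ^ b) (at t)"
      using DERIV_pow[of "Suc b" t] by (simp add: add.commute)
    have eq: "(real b + 1) * t ^ b * ?H m t + 1 / t * (?H (Suc m) t + ?c * t\<^sup>2 * ?H (m - 1) t) * t ^ Suc b = ?f t"
      using t by (simp add: power_add power2_eq_square distrib_left distrib_right)
    show "((\<lambda>t. t ^ Suc b * ?H m t) has_real_derivative ?f t) (at t)"
      by (rule DERIV_cong[OF DERIV_mult[OF P D] eq])
    show "isCont ?f t"
      using m by (intro continuous_intros isCont_bessel_sym t) auto
  next
    show "set_integrable lborel {0<..} ?f"
      by (rule set_integral_add(1), rule set_integrable_mult_right, rule i1,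
          rule set_integral_add(1), rule i2, rule set_integrable_mult_right, rule i3)
    have "((\<lambda>t. C * (t powr (real b + 1 / 2) * exp (- (1 / 2) * t))) \<longlongrightarrow> 0) (at_right 0)"
      by (intro tendsto_mult_right_zero powr_exp_limits) auto
    then show "((\<lambda>t. t ^ Suc b * ?H m t) \<longlongrightarrow> 0) (at_right 0)"
      by (rule Lim_null_comparison[rotated]) (use bd in \<open>auto simp: eventually_at_filter\<close>)
    have "((\<lambda>t. C * (t powr (real b + 1 / 2) * exp (- (1 / 2) * t))) \<longlongrightarrow> 0) at_top"
      by (intro tendsto_mult_right_zero powr_exp_limits) auto
    then show "((\<lambda>t. t ^ Suc b * ?H m t) \<longlongrightarrow> 0) at_top"
      by (rule Lim_null_comparison[rotated])
         (use bd in \<open>auto intro: eventually_mono[OF eventually_gt_at_top[of 0]]\<close>)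
  qed
  moreover have "(LINT t:{0<..}|lborel. ?f t) = (real b + 1) * sym_moment k i m b
      + (sym_moment k i (Suc m) b + ?c * sym_moment k i (m - 1) (b + 2))"
  proof -
    show ?thesis
      unfolding sym_moment_def
      by (simp only: set_integral_add(2) set_integral_add(1) set_integrable_mult_right
          set_integral_mult_right i1 i2 i3)
  qed
  ultimately show ?thesis by (simp add: algebra_simps del: power_Suc)
qed

lemma sym_moment_0:
  assumes "i \<le> k"
  shows "sym_moment k i 0 b = real (k choose i) * IKM k i b"
proof -
  have "sym_moment k i 0 b = (LINT t:{0<..}|lborel.
      real (k choose i) * (bessel_I0 t ^ i * bessel_K0 t ^ (k - i) * t ^ b))"
    unfolding sym_moment_def coeff_bessel_sym_0[OF assms] by (simp add: mult_ac)
  then show ?thesis unfolding IKM_def by simp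
qed

text \<open>Unrolling \<open>sym_moment_step\<close> down to m = 0 expresses the m-th moment at s
  through moments of index 0 at s + 2j; these are the coefficients. Reducing m by one keeps s,
  reducing it by two raises s by 2. The argument s is real so that the coefficients are visibly
  polynomials in it.\<close>

fun moment_coeff :: "nat \<Rightarrow> nat \<Rightarrow> nat \<Rightarrow> real \<Rightarrow> real" where
  "moment_coeff k 0 j s = (if j = 0 then 1 else 0)"
| "moment_coeff k (Suc 0) j s = (if j = 0 then - (s + 1) else 0)"
| "moment_coeff k (Suc (Suc m)) j s = - (s + 1) * moment_coeff k (Suc m) j s
     - real (Suc m) * (real k - real m) * (if j = 0 then 0 else moment_coeff k m (j - 1) (s + 2))"

lemma moment_coeff_eq_0: "m < 2 * j \<Longrightarrow> moment_coeff k m j s = 0"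
  by (induction k m j s rule: moment_coeff.induct) auto

lemma moment_coeff_0: "moment_coeff k m 0 s = (- (s + 1)) ^ m"
proof (induction m rule: induct_nat_012)
  case (ge2 n)
  then show ?case by simp
qed auto

lemma sym_moment_expansion:
  assumes i: "2 * i < k"
  shows "m \<le> Suc k \<Longrightarrow> sym_moment k i m b
     = (\<Sum>j\<le>m div 2. moment_coeff k m j (real b) * sym_moment k i 0 (b + 2 * j))"
proof (induction m arbitrary: b rule: induct_nat_012)
  case 1
  then show ?case using sym_moment_step[OF _ i, of 0 b] by simp
next
  case (ge2 m)
  let ?h = "sym_moment k i" and ?M = "m div 2"
  have "?h (Suc (Suc m)) b = - (real b + 1) * ?h (Suc m) b
      - real (Suc m) * (real k - real m) * ?h m (b + 2)"
    using sym_moment_step[OF _ i, of "Suc m" b] ge2.prems by simp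
  also have "?h (Suc m) b = (\<Sum>j\<le>Suc ?M. moment_coeff k (Suc m) j (real b) * ?h 0 (b + 2 * j))"
  proof -
    have "?h (Suc m) b = (\<Sum>j\<le>Suc m div 2. moment_coeff k (Suc m) j (real b) * ?h 0 (b + 2 * j))"
      using ge2 by simp
    \<comment> \<open>For even m the added index \<open>Suc ?M\<close> has coefficient zero; the
      common range allows termwise merging with the shifted sum.\<close>
    also have "\<dots> = (\<Sum>j\<le>Suc ?M. moment_coeff k (Suc m) j (real b) * ?h 0 (b + 2 * j))"
      by (rule sum.mono_neutral_left) (auto intro!: moment_coeff_eq_0)
    finally show ?thesis .
  qed
  also have "?h m (b + 2) = (\<Sum>j\<le>?M. moment_coeff k m j (real b + 2) * ?h 0 (b + 2 * Suc j))"
  proof -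
    have e: "b + 2 + 2 * j = b + 2 * Suc j" "real (b + 2) = real b + 2" for j by simp_all
    have "m \<le> Suc k" using ge2.prems by simp
    from ge2.IH(1)[OF this, of "b + 2"] show ?thesis unfolding e .
  qed
  also have "\<dots> = (\<Sum>j\<le>Suc ?M. (if j = 0 then 0 else moment_coeff k m (j - 1) (real b + 2))
      * ?h 0 (b + 2 * j))"
    by (subst sum.atMost_Suc_shift) simp
  finally have "?h (Suc (Suc m)) b
      = (\<Sum>j\<le>Suc ?M. - (real b + 1) * (moment_coeff k (Suc m) j (real b) * ?h 0 (b + 2 * j))
          - real (Suc m) * (real k - real m)
            * ((if j = 0 then 0 else moment_coeff k m (j - 1) (real b + 2)) * ?h 0 (b + 2 * j)))"
    by (simp only: sum_subtractf sum_distrib_left)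
  also have "\<dots> = (\<Sum>j\<le>Suc ?M. moment_coeff k (Suc (Suc m)) j (real b) * ?h 0 (b + 2 * j))"
    by (rule sum.cong) (simp_all only: moment_coeff.simps left_diff_distrib mult.assoc)
  finally show ?case by simp
qed simp

text \<open>At m = k + 1 the left side of the expansion vanishes. The binomial coefficient common to
  all terms divides out, so the recurrence has the same coefficients for every row i.\<close>

lemma IKM_recurrence:
  assumes "2 * i < k"
  shows "(\<Sum>j\<le>Suc k div 2. moment_coeff k (Suc k) j (real b) * IKM k i (b + 2 * j)) = 0"
proof -
  have "sym_moment k i (Suc k) b = 0"
    by (simp add: sym_moment_def bessel_sym_Suc_self)
  then have "real (k choose i) * (\<Sum>j\<le>Suc k div 2. moment_coeff k (Suc k) j (real b) * IKM k i (b + 2 * j)) = 0"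
    using sym_moment_expansion[OF assms, of "Suc k" b] assms
    by (simp add: sym_moment_0 sum_distrib_left mult.left_commute[of _ "real (k choose i)"])
  then show ?thesis using assms by simp
qed

subsection \<open>Determinants\<close>

lemma permutes_less: "p permutes {0..<n::nat} \<Longrightarrow> i < n \<Longrightarrow> p i < n"
  using permutes_in_image[of p "{0..<n}" i] by simp

lemma det_mat_eq: "Determinant.det (Matrix.mat n n (\<lambda>(i, j). c i j))
    = (\<Sum>p | p permutes {0..<n}. signof p * (\<Prod>i = 0..<n. c i (p i)))"
  for c :: "nat \<Rightarrow> nat \<Rightarrow> 'a::comm_ring_1"
  by (subst det_def'[of _ n])
     (auto intro!: sum.cong prod.cong arg_cong2[where f = "(*)"] simp: permutes_less)

lemma det_mat_scale:
  fixes c :: "nat \<Rightarrow> nat \<Rightarrow> 'a::comm_ring_1"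
  shows "Determinant.det (Matrix.mat n n (\<lambda>(i, j). a i * c i j * b j))
    = (\<Prod>i<n. a i) * (\<Prod>j<n. b j) * Determinant.det (Matrix.mat n n (\<lambda>(i, j). c i j))"
proof -
  have "(\<Prod>i = 0..<n. a i * c i (p i) * b (p i)) = (\<Prod>i<n. a i) * (\<Prod>j<n. b j) * (\<Prod>i = 0..<n. c i (p i))"
    if "p permutes {0..<n}" for p
    using prod.permute[OF that, of b] by (simp add: prod.distrib o_def mult_ac atLeast0LessThan)
  then show ?thesis
    unfolding det_mat_eq sum_distrib_left by (intro sum.cong) (auto simp: mult_ac)
qed

lemma tendsto_det_mat:
  fixes c :: "nat \<Rightarrow> nat \<Rightarrow> 'b \<Rightarrow> real"
  assumes "\<And>i j. i < n \<Longrightarrow> j < n \<Longrightarrow> ((\<lambda>x. c i j x) \<longlongrightarrow> d i j) F"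
  shows "((\<lambda>x. Determinant.det (Matrix.mat n n (\<lambda>(i, j). c i j x)))
     \<longlongrightarrow> Determinant.det (Matrix.mat n n (\<lambda>(i, j). d i j))) F"
  unfolding det_mat_eq
  by (intro tendsto_sum tendsto_mult tendsto_const tendsto_prod assms) (auto simp: permutes_less)

lemma det_vandermonde:
  fixes x :: "nat \<Rightarrow> 'a::idom"
  shows "Determinant.det (Matrix.mat n n (\<lambda>(i, j). x i ^ j)) = (\<Prod>i<n. \<Prod>j<i. x i - x j)"
proof -
  \<comment> \<open>Right multiplication by a unitriangular matrix replaces the monomials by the Newton basis,
    in which the matrix is lower triangular.\<close>
  define q where "q j = (\<Prod>l<j. [:- x l, 1:])" for j
  have deg: "degree (q j) = j" for j
    unfolding q_def by (subst degree_prod_eq_sum_degree) auto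
  have lead: "poly.coeff (q j) j = 1" for j
    using lead_coeff_prod[of "\<lambda>l. [:- x l, 1:]" "{..<j}"] deg[of j] by (simp add: q_def)
  let ?V = "Matrix.mat n n (\<lambda>(i, j). x i ^ j)"
  let ?U = "Matrix.mat n n (\<lambda>(l, j). poly.coeff (q j) l)"
  let ?L = "Matrix.mat n n (\<lambda>(i, j). poly (q j) (x i))"
  have "?V * ?U = ?L"
  proof (rule eq_matI)
    fix i j assume "i < dim_row ?L" "j < dim_col ?L"
    then have ij: "i < n" "j < n" by auto
    have "(?V * ?U) $$ (i, j) = (\<Sum>l = 0..<n. x i ^ l * poly.coeff (q j) l)"
      using ij by (simp add: scalar_prod_def)
    also have "\<dots> = (\<Sum>l\<le>degree (q j). poly.coeff (q j) l * x i ^ l)"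
      using ij deg[of j]
      by (intro sum.mono_neutral_cong_right) (auto intro!: coeff_eq_0 simp: mult.commute)
    also have "\<dots> = ?L $$ (i, j)" using ij by (simp add: poly_altdef)
    finally show "(?V * ?U) $$ (i, j) = ?L $$ (i, j)" .
  qed auto
  moreover have "Determinant.det (?V * ?U) = Determinant.det ?V * Determinant.det ?U"
    by (rule Determinant.det_mult) auto
  moreover have "Determinant.det ?U = 1"
  proof -
    have "Determinant.det ?U = prod_list (diag_mat ?U)"
      by (rule det_upper_triangular[of _ n]) (auto simp: upper_triangular_def intro!: coeff_eq_0 simp: deg)
    also have "\<dots> = 1" unfolding prod_list_diag_prod by (simp add: lead)
    finally show ?thesis .
  qed
  moreover have "Determinant.det ?L = (\<Prod>i<n. \<Prod>j<i. x i - x j)"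
  proof -
    have poly_q: "poly (q j) y = (\<Prod>l<j. y - x l)" for j y
      by (simp add: q_def poly_prod)
    have "Determinant.det ?L = prod_list (diag_mat ?L)"
      by (rule det_lower_triangular[of n]) (auto simp: poly_q)
    also have "\<dots> = (\<Prod>i<n. \<Prod>j<i. x i - x j)"
      unfolding prod_list_diag_prod by (simp add: poly_q atLeast0LessThan)
    finally show ?thesis .
  qed
  ultimately show ?thesis by simp
qed

text \<open>In the first row only the last entry can be nonzero, and deleting its row and column
  leaves the identity; for n = 0 the matrix is that entry alone.\<close>

lemma det_companion:
  fixes \<alpha> :: "nat \<Rightarrow> 'a::comm_ring_1"
  shows "Determinant.det (Matrix.mat (Suc n) (Suc n)
      (\<lambda>(l, j). if j = n then \<alpha> l else if l = Suc j then 1 else 0)) = (-1) ^ n * \<alpha> 0"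
    (is "Determinant.det ?A = _")
proof -
  have "Determinant.det ?A = (\<Sum>j<Suc n. ?A $$ (0, j) * cofactor ?A 0 j)"
    by (rule laplace_expansion_row[of _ "Suc n"]) auto
  also have "\<dots> = (\<Sum>j<Suc n. if j = n then \<alpha> 0 * cofactor ?A 0 n else 0)"
    by (intro sum.cong) auto
  also have "\<dots> = \<alpha> 0 * cofactor ?A 0 n" by simp
  also have "mat_delete ?A 0 n = 1\<^sub>m n"
    by (rule eq_matI) (auto simp: mat_delete_def)
  then have "cofactor ?A 0 n = (-1) ^ n" by (simp add: cofactor_def)
  finally show ?thesis by (simp add: mult.commute)
qed

text \<open>The discrete form of Abel's identity: advancing all columns by one is right
  multiplication by the companion matrix of the recurrence.\<close>

lemma det_linear_recurrence:
  fixes c :: "nat \<Rightarrow> nat \<Rightarrow> 'a::comm_ring_1"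
  assumes "\<And>i. i < Suc n \<Longrightarrow> c i (Suc n) = (\<Sum>j\<le>n. \<alpha> j * c i j)"
  shows "Determinant.det (Matrix.mat (Suc n) (Suc n) (\<lambda>(i, j). c i (Suc j)))
     = (-1) ^ n * \<alpha> 0 * Determinant.det (Matrix.mat (Suc n) (Suc n) (\<lambda>(i, j). c i j))"
proof -
  let ?C = "Matrix.mat (Suc n) (Suc n) (\<lambda>(i, j). c i j)"
  let ?A = "Matrix.mat (Suc n) (Suc n) (\<lambda>(l, j). if j = n then \<alpha> l else if l = Suc j then 1 else 0)"
  have "Matrix.mat (Suc n) (Suc n) (\<lambda>(i, j). c i (Suc j)) = ?C * ?A"
  proof (rule eq_matI)
    fix i j assume "i < dim_row (?C * ?A)" "j < dim_col (?C * ?A)"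
    then have ij: "i < Suc n" "j < Suc n" by auto
    have "(?C * ?A) $$ (i, j) = (\<Sum>l = 0..<Suc n. c i l * (if j = n then \<alpha> l else if l = Suc j then 1 else 0))"
      using ij by (simp add: scalar_prod_def)
    also have "\<dots> = c i (Suc j)"
    proof (cases "j = n")
      case True
      then show ?thesis using assms[OF ij(1)]
        by (simp add: atLeast0LessThan lessThan_Suc_atMost mult.commute del: sum.op_ivl_Suc)
    next
      case False
      then have "(\<Sum>l = 0..<Suc n. c i l * (if j = n then \<alpha> l else if l = Suc j then 1 else 0))
          = (\<Sum>l = 0..<Suc n. if l = Suc j then c i (Suc j) else 0)"
        by (intro sum.cong) auto
      then show ?thesis using False ij by (subst (asm) sum.delta) auto
    qed
    finally show "Matrix.mat (Suc n) (Suc n) (\<lambda>(i, j). c i (Suc j)) $$ (i, j) = (?C * ?A) $$ (i, j)"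
      using ij by simp
  qed auto
  then have "Determinant.det (Matrix.mat (Suc n) (Suc n) (\<lambda>(i, j). c i (Suc j)))
      = Determinant.det ?C * Determinant.det ?A"
    by (simp only:) (rule Determinant.det_mult; auto)
  then show ?thesis unfolding det_companion by (simp add: mult_ac)
qed

subsection \<open>Asymptotics of the Gamma function and of moments\<close>

text \<open>Euler's limit formula for Gamma(a), after writing the rising factorial as Gamma(n + a) /
  Gamma(a).\<close>

lemma Gamma_shift_asymp:
  fixes a :: real
  assumes a: "a > 0"
  shows "(\<lambda>n. Gamma (real n + a) / (fact n * real n powr (a - 1))) \<longlonglongrightarrow> 1"
proof -
  have na: "a \<notin> \<int>\<^sub>\<le>\<^sub>0" using a by (auto elim!: nonpos_Ints_cases)
  have G: "Gamma a > 0" using a by (rule Gamma_real_pos)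
  have "(\<lambda>n. Gamma a / Gamma_series' a n) \<longlonglongrightarrow> Gamma a / Gamma a"
    using G by (intro tendsto_divide tendsto_const Gamma_series'_LIMSEQ) auto
  then have "(\<lambda>n. Gamma a / Gamma_series' a n) \<longlonglongrightarrow> 1" using G by simp
  then show ?thesis
  proof (rule Lim_transform_eventually)
    show "\<forall>\<^sub>F n in sequentially. Gamma a / Gamma_series' a n
        = Gamma (real n + a) / (fact n * real n powr (a - 1))"
      using eventually_gt_at_top[of 0]
    proof eventually_elim
      case (elim n)
      have "fact n = real n * fact (n - 1)" using elim by (simp add: fact_reduce)
      moreover have "exp (a * ln (real n)) = real n powr a" using elim by (simp add: powr_def)
      ultimately show ?case
        using elim G na
        by (simp add: Gamma_series'_def pochhammer_Gamma powr_diff add.commute)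
    qed
  qed
qed

lemma pochhammer_asymp:
  fixes z :: "nat \<Rightarrow> real"
  assumes z: "filterlim z at_top sequentially"
  shows "(\<lambda>n. pochhammer (z n) m / z n ^ m) \<longlonglongrightarrow> 1"
proof -
  have nz: "\<forall>\<^sub>F n in sequentially. z n \<noteq> 0"
    using filterlim_at_top_dense[THEN iffD1, OF z, rule_format, of 0] by (auto elim: eventually_mono)
  have lim: "(\<lambda>n. \<Prod>l = 0..<m. 1 + real l / z n) \<longlonglongrightarrow> (\<Prod>l = 0..<m. 1 + 0)"
    by (intro tendsto_prod tendsto_add tendsto_const tendsto_divide_0[OF tendsto_const]
        filterlim_at_top_imp_at_infinity z)
  have "(\<lambda>n. \<Prod>l = 0..<m. 1 + real l / z n) \<longlonglongrightarrow> 1" using lim by simp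
  then show ?thesis
  proof (rule Lim_transform_eventually)
    show "\<forall>\<^sub>F n in sequentially. (\<Prod>l = 0..<m. 1 + real l / z n) = pochhammer (z n) m / z n ^ m"
      using nz
    proof eventually_elim
      case (elim n)
      have "(\<Prod>l = 0..<m. 1 + real l / z n) = (\<Prod>l = 0..<m. (z n + real l) / z n)"
        using elim by (intro prod.cong) (auto simp: field_simps)
      also have "\<dots> = pochhammer (z n) m / z n ^ m"
        by (simp add: prod_dividef pochhammer_prod)
      finally show ?case .
    qed
  qed
qed

lemma power_over_Gamma_tendsto_0:
  fixes x p :: real
  shows "(\<lambda>n. x ^ n / Gamma (real n + 1 - p)) \<longlonglongrightarrow> 0"
proof (rule summable_LIMSEQ_zero)
  obtain N :: nat where N: "real N > p + 2 * \<bar>x\<bar>" using reals_Archimedean2 by blast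
  show "summable (\<lambda>n. x ^ n / Gamma (real n + 1 - p))"
  proof (rule summable_ratio_test[of "1/2" N])
    fix n assume "n \<ge> N"
    then have n: "real n + 1 - p > 2 * \<bar>x\<bar>" "real n + 1 - p > 0" using N by linarith+
    have G: "Gamma (real n + 1 - p) > 0" using n by (intro Gamma_real_pos)
    have "Gamma (real (Suc n) + 1 - p) = (real n + 1 - p) * Gamma (real n + 1 - p)"
    proof -
      have "real n + 1 - p \<notin> \<int>\<^sub>\<le>\<^sub>0" using n by (auto elim!: nonpos_Ints_cases)
      from Gamma_plus1[OF this] show ?thesis by (simp add: algebra_simps)
    qed
    then have "norm (x ^ Suc n / Gamma (real (Suc n) + 1 - p))
        = (\<bar>x\<bar> / (real n + 1 - p)) * norm (x ^ n / Gamma (real n + 1 - p))"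
      using n G by (simp add: abs_mult)
    also have "\<dots> \<le> 1 / 2 * norm (x ^ n / Gamma (real n + 1 - p))"
      using n by (intro mult_right_mono) (auto simp: field_simps)
    finally show "norm (x ^ Suc n / Gamma (real (Suc n) + 1 - p))
        \<le> 1 / 2 * norm (x ^ n / Gamma (real n + 1 - p))" .
  qed simp
qed

text \<open>High moments see only large t. Beyond T the function differs from \<kappa> h by at most
  (e/2) h, where h = t^(-p) exp(- l t) has the Gamma value as its exact moment. Below T one has t^n
  \<le> T^n t^N, and T^n is negligible against the Gamma function.\<close>

lemma moment_asymp:
  fixes f :: "real \<Rightarrow> real"
  assumes int: "\<And>n. set_integrable lborel {0<..} (\<lambda>t. t ^ n * f t)" and l: "l > 0"
    and lim: "((\<lambda>t. t powr p * exp (l * t) * f t) \<longlongrightarrow> \<kappa>) at_top"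
  shows "(\<lambda>n. (LINT t:{0<..}|lborel. t ^ n * f t) * l powr (real n + 1 - p) / Gamma (real n + 1 - p))
    \<longlonglongrightarrow> \<kappa>"
proof (rule tendstoI)
  fix e :: real assume e: "e > 0"
  define h where "h t = t powr (- p) * exp (- l * t)" for t
  define G where "G n = Gamma (real n + 1 - p) / l powr (real n + 1 - p)" for n
  let ?J = "\<lambda>n. LINT t:{0<..}|lborel. t ^ n * f t"
  have hh: "t ^ n * h t = t powr (real n + 1 - p - 1) * exp (- l * t)" if "t > 0" for t n
    using that by (simp add: h_def powr_realpow[symmetric] powr_diff powr_minus field_simps)
  have h_int: "set_integrable lborel {0<..} (\<lambda>t. t ^ n * h t)"
    and h_val: "(LINT t:{0<..}|lborel. t ^ n * h t) = G n" if "real n + 1 - p > 0" for n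
  proof -
    show "set_integrable lborel {0<..} (\<lambda>t. t ^ n * h t)"
      using set_integrable_Gamma[OF that l] by (subst set_integrable_cong[OF refl refl hh]) auto
    have "(LINT t:{0<..}|lborel. t ^ n * h t)
        = (LINT t:{0<..}|lborel. t powr (real n + 1 - p - 1) * exp (- l * t))"
      by (rule set_lebesgue_integral_cong) (auto simp: hh)
    then show "(LINT t:{0<..}|lborel. t ^ n * h t) = G n"
      using set_integral_Gamma[OF that l] by (simp add: G_def)
  qed
  obtain T where T: "T \<ge> 1" "\<And>t. t \<ge> T \<Longrightarrow> \<bar>t powr p * exp (l * t) * f t - \<kappa>\<bar> \<le> e / 2"
  proof -
    have "\<forall>\<^sub>F t in at_top. dist (t powr p * exp (l * t) * f t) \<kappa> < e / 2"
      by (rule tendstoD[OF lim]) (use e in simp)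
    then obtain T0 where "\<And>t. t \<ge> T0 \<Longrightarrow> dist (t powr p * exp (l * t) * f t) \<kappa> < e / 2"
      by (auto simp: eventually_at_top_linorder)
    then show ?thesis by (intro that[of "max 1 T0"]) (auto simp: dist_real_def less_imp_le)
  qed
  have hpos: "h t > 0" if "t > 0" for t using that by (simp add: h_def)
  have far: "\<bar>f t - \<kappa> * h t\<bar> \<le> e / 2 * h t" if "t \<ge> T" for t
  proof -
    have t: "t > 0" using that T by simp
    have "t powr p * exp (l * t) * h t = 1"
      using t by (simp add: h_def powr_minus exp_minus field_simps)
    then have "(t powr p * exp (l * t) * f t - \<kappa>) * h t = f t - \<kappa> * h t"
      by (simp add: algebra_simps)
    then have "\<bar>f t - \<kappa> * h t\<bar> = \<bar>t powr p * exp (l * t) * f t - \<kappa>\<bar> * h t"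
      using hpos[OF t] by (metis abs_mult abs_of_pos)
    also have "\<dots> \<le> e / 2 * h t" using T(2)[OF that] hpos[OF t] by (intro mult_right_mono) auto
    finally show ?thesis .
  qed
  \<comment> \<open>The model h need not be integrable at 0 when p is large; the factor t^N repairs
    this and gives a fixed integral X for the part below T.\<close>
  obtain N :: nat where N: "real N > p" using reals_Archimedean2 by blast
  define d where "d t = \<bar>f t\<bar> + \<bar>\<kappa>\<bar> * h t" for t
  have d_eq: "\<bar>t ^ N * f t\<bar> + \<bar>\<kappa>\<bar> * (t ^ N * h t) = t ^ N * d t" if "t \<in> {0<..}" for t
    using that by (simp add: d_def abs_mult algebra_simps)
  have "set_integrable lborel {0<..} (\<lambda>t. \<bar>t ^ N * f t\<bar> + \<bar>\<kappa>\<bar> * (t ^ N * h t))"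
    by (rule set_integral_add(1), rule set_integrable_abs[OF int], rule set_integrable_mult_right,
        rule h_int) (use N in simp)
  then have d_int: "set_integrable lborel {0<..} (\<lambda>t. t ^ N * d t)"
    by (subst (asm) set_integrable_cong[OF refl refl d_eq]) auto
  define X where "X = (LINT t:{0<..}|lborel. t ^ N * d t)"
  have main: "\<bar>?J n - \<kappa> * G n\<bar> \<le> e / 2 * G n + T ^ n * X" if n: "n \<ge> N" for n
  proof -
    have pn: "real n + 1 - p > 0" using n N by linarith
    note hn = h_int[OF pn]
    have i1: "set_integrable lborel {0<..} (\<lambda>t. t ^ n * f t - \<kappa> * (t ^ n * h t))"
      by (rule set_integral_diff(1), rule int, rule set_integrable_mult_right, rule hn)
    have i2: "set_integrable lborel {0<..} (\<lambda>t. e / 2 * (t ^ n * h t) + T ^ n * (t ^ N * d t))"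
      by (rule set_integral_add(1), rule set_integrable_mult_right, rule hn,
          rule set_integrable_mult_right, rule d_int)
    have "?J n - \<kappa> * G n = (LINT t:{0<..}|lborel. t ^ n * f t - \<kappa> * (t ^ n * h t))"
      using set_integral_diff(2)[OF int set_integrable_mult_right[OF hn]] h_val[OF pn] by simp
    then have "\<bar>?J n - \<kappa> * G n\<bar> = \<bar>LINT t:{0<..}|lborel. t ^ n * f t - \<kappa> * (t ^ n * h t)\<bar>"
      by (rule arg_cong)
    also have "\<dots> \<le> (LINT t:{0<..}|lborel. \<bar>t ^ n * f t - \<kappa> * (t ^ n * h t)\<bar>)"
      unfolding set_lebesgue_integral_def by (rule order_trans[OF integral_abs_bound]) (simp add: abs_mult)
    also have "\<dots> \<le> (LINT t:{0<..}|lborel. e / 2 * (t ^ n * h t) + T ^ n * (t ^ N * d t))"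
    proof (rule set_integral_mono)
      show "set_integrable lborel {0<..} (\<lambda>t. \<bar>t ^ n * f t - \<kappa> * (t ^ n * h t)\<bar>)"
        using i1 by (rule set_integrable_abs)
      fix t :: real assume "t \<in> {0<..}"
      then have t: "t > 0" by simp
      have "t ^ n * f t - \<kappa> * (t ^ n * h t) = t ^ n * (f t - \<kappa> * h t)"
        by (simp add: algebra_simps)
      then have eq: "\<bar>t ^ n * f t - \<kappa> * (t ^ n * h t)\<bar> = t ^ n * \<bar>f t - \<kappa> * h t\<bar>"
        using t by (simp add: abs_mult)
      have d0: "d t \<ge> 0" using hpos[OF t] by (simp add: d_def)
      show "\<bar>t ^ n * f t - \<kappa> * (t ^ n * h t)\<bar> \<le> e / 2 * (t ^ n * h t) + T ^ n * (t ^ N * d t)"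
      proof (cases "t \<ge> T")
        case True
        have "t ^ n * \<bar>f t - \<kappa> * h t\<bar> \<le> t ^ n * (e / 2 * h t)"
          using far[OF True] t by (intro mult_left_mono) auto
        moreover have "0 \<le> T ^ n * (t ^ N * d t)" using T t d0 by simp
        ultimately show ?thesis unfolding eq by (simp add: mult_ac)
      next
        case False
        have "t ^ n = t ^ (n - N) * t ^ N" using n by (simp flip: power_add)
        also have "\<dots> \<le> T ^ (n - N) * t ^ N"
          using False t by (intro mult_right_mono power_mono) auto
        also have "\<dots> \<le> T ^ n * t ^ N"
          using T t by (intro mult_right_mono power_increasing) auto
        finally have tn: "t ^ n \<le> T ^ n * t ^ N" .
        have "\<bar>f t - \<kappa> * h t\<bar> \<le> d t"
          unfolding d_def using hpos[OF t] abs_triangle_ineq4[of "f t" "\<kappa> * h t"] by (simp add: abs_mult)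
        then have "t ^ n * \<bar>f t - \<kappa> * h t\<bar> \<le> T ^ n * t ^ N * d t"
          using tn t T by (intro mult_mono) auto
        moreover have "0 \<le> e / 2 * (t ^ n * h t)" using e t hpos[OF t] by simp
        ultimately show ?thesis unfolding eq by (simp add: mult_ac)
      qed
    qed (rule i2)
    also have "\<dots> = e / 2 * G n + T ^ n * X"
      using set_integral_add(2)[OF set_integrable_mult_right[OF hn] set_integrable_mult_right[OF d_int],
          of "e / 2" "T ^ n"] h_val[OF pn] by (simp add: X_def)
    finally show ?thesis .
  qed
  have "(\<lambda>n. (T * l) ^ n / Gamma (real n + 1 - p) * (l powr (1 - p) * X)) \<longlonglongrightarrow> 0 * (l powr (1 - p) * X)"
    by (intro tendsto_mult power_over_Gamma_tendsto_0 tendsto_const)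
  then have "(\<lambda>n. (T * l) ^ n / Gamma (real n + 1 - p) * (l powr (1 - p) * X)) \<longlonglongrightarrow> 0" by simp
  then have "\<forall>\<^sub>F n in sequentially. dist ((T * l) ^ n / Gamma (real n + 1 - p) * (l powr (1 - p) * X)) 0 < e / 2"
    by (rule tendstoD) (use e in simp)
  then show "\<forall>\<^sub>F n in sequentially.
      dist (?J n * l powr (real n + 1 - p) / Gamma (real n + 1 - p)) \<kappa> < e"
    using eventually_ge_at_top[of N]
  proof eventually_elim
    case (elim n)
    have pn: "real n + 1 - p > 0" using elim N by linarith
    have Gpos: "G n > 0" using pn l by (simp add: G_def Gamma_real_pos)
    have GG: "?J n * l powr (real n + 1 - p) / Gamma (real n + 1 - p) = ?J n / G n"
      by (simp add: G_def)
    have "?J n / G n - \<kappa> = (?J n - \<kappa> * G n) / G n" using Gpos by (simp add: field_simps)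
    then have "\<bar>?J n / G n - \<kappa>\<bar> = \<bar>?J n - \<kappa> * G n\<bar> / G n"
      using Gpos by (simp add: abs_divide)
    also have "\<dots> \<le> (e / 2 * G n + T ^ n * X) / G n"
      using main[OF elim(2)] Gpos by (intro divide_right_mono) auto
    also have "\<dots> = e / 2 + T ^ n * X / G n" using Gpos by (simp add: field_simps)
    also have "T ^ n * X / G n = (T * l) ^ n / Gamma (real n + 1 - p) * (l powr (1 - p) * X)"
    proof -
      have "l powr (real n + 1 - p) = l ^ n * l powr (1 - p)"
        using l by (simp add: powr_realpow[symmetric] add_diff_eq flip: powr_add)
      then show ?thesis by (simp add: G_def power_mult_distrib)
    qed
    also have "e / 2 + \<dots> < e" using elim(1) unfolding dist_real_def by linarith
    finally show ?case unfolding GG dist_real_def .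
  qed
qed

subsection \<open>The first-order recurrence for the determinants\<close>

text \<open>Reaching q shifts from level 2q forces a double step at every stage, so a single product
  survives and s drops out.\<close>

lemma moment_coeff_even_top:
  "moment_coeff k (2 * q) q s = (\<Prod>l<q. - ((2 * real l + 1) * (real k - 2 * real l)))"
proof (induction q arbitrary: s)
  case (Suc q)
  have "moment_coeff k (Suc (2 * q)) (Suc q) s = 0" by (rule moment_coeff_eq_0) simp
  then show ?case using Suc.IH[of "s + 2"] by (simp add: algebra_simps)
qed simp

text \<open>Of 2q + 1 levels, q double steps leave exactly one single step, and p counts the double
  steps below it. Those below start from even levels, those above from odd ones; the q - p above
  have already raised s by 2 each when the factor -(s + 1) is taken.\<close>

lemma moment_coeff_odd_top:
  "moment_coeff k (Suc (2 * q)) q s = (-1) ^ Suc q *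
     (\<Sum>p\<le>q. (\<Prod>l<p. (2 * real l + 1) * (real k - 2 * real l))
        * (\<Prod>l\<in>{p..<q}. (2 * real l + 2) * (real k - 2 * real l - 1))
        * (s + 1 + 2 * (real q - real p)))"
proof (induction q arbitrary: s)
  case (Suc q)
  let ?A = "\<lambda>p. \<Prod>l<p. (2 * real l + 1) * (real k - 2 * real l)"
  let ?B = "\<lambda>p q. \<Prod>l\<in>{p..<q}. (2 * real l + 2) * (real k - 2 * real l - 1)"
  have top: "moment_coeff k (2 * Suc q) (Suc q) s = (-1) ^ Suc q * ?A (Suc q)"
    unfolding moment_coeff_even_top by (simp only: prod_uminus card_lessThan)
  have "moment_coeff k (Suc (2 * Suc q)) (Suc q) s = - (s + 1) * moment_coeff k (2 * Suc q) (Suc q) s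
      - (2 * real q + 2) * (real k - 2 * real q - 1) * moment_coeff k (Suc (2 * q)) q (s + 2)"
    by (simp add: algebra_simps)
  also have "\<dots> = (-1) ^ Suc (Suc q) * (?A (Suc q) * (s + 1)
      + (2 * real q + 2) * (real k - 2 * real q - 1)
        * (\<Sum>p\<le>q. ?A p * ?B p q * (s + 2 + 1 + 2 * (real q - real p))))"
    unfolding top Suc.IH by (simp add: algebra_simps)
  also have "(2 * real q + 2) * (real k - 2 * real q - 1)
        * (\<Sum>p\<le>q. ?A p * ?B p q * (s + 2 + 1 + 2 * (real q - real p)))
      = (\<Sum>p\<le>q. ?A p * ?B p (Suc q) * (s + 1 + 2 * (real (Suc q) - real p)))"
    unfolding sum_distrib_left
  proof (rule sum.cong[OF refl])
    fix p assume p: "p \<in> {..q}"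
    have B: "?B p (Suc q) = ?B p q * ((2 * real q + 2) * (real k - 2 * real q - 1))"
      using p by simp
    have e: "s + 1 + 2 * (real (Suc q) - real p) = s + 2 + 1 + 2 * (real q - real p)" by simp
    show "(2 * real q + 2) * (real k - 2 * real q - 1) * (?A p * ?B p q * (s + 2 + 1 + 2 * (real q - real p)))
        = ?A p * ?B p (Suc q) * (s + 1 + 2 * (real (Suc q) - real p))"
      unfolding B e by (simp only: mult_ac)
  qed
  also have "?A (Suc q) * (s + 1) + (\<Sum>p\<le>q. ?A p * ?B p (Suc q) * (s + 1 + 2 * (real (Suc q) - real p)))
      = (\<Sum>p\<le>Suc q. ?A p * ?B p (Suc q) * (s + 1 + 2 * (real (Suc q) - real p)))"
    by (simp add: add.commute)
  finally show ?case .
qed simp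

lemma prod_odd_reverse: "(\<Prod>l<n. 2 * real n - 2 * real l - 1) = (\<Prod>l<n. 2 * real l + 1)"
proof -
  have "(\<Prod>l<n. 2 * real n - 2 * real l - 1) = (\<Prod>l<n. 2 * real (n - Suc l) + 1)"
    by (intro prod.cong) (auto simp: of_nat_diff)
  then show ?thesis
    using prod.nat_diff_reindex[of "\<lambda>l. 2 * real l + 1" n] by simp
qed

lemma prod_odd_pochhammer: "(\<Prod>l<n. 2 * real l + 1) = 2 ^ n * pochhammer (1 / 2) n"
  by (induction n) (simp_all add: pochhammer_Suc algebra_simps)

text \<open>The two factors of each double step run through the same odd numbers in opposite order,
  hence the square.\<close>

lemma moment_coeff_top_odd_index:
  "moment_coeff (2 * n + 1) (2 * n + 2) (Suc n) s = (-1) ^ Suc n * (\<Prod>l<Suc n. 2 * real l + 1)\<^sup>2"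
proof -
  have "moment_coeff (2 * n + 1) (2 * Suc n) (Suc n) s
      = (\<Prod>l<Suc n. - ((2 * real l + 1) * (2 * real (Suc n) - 2 * real l - 1)))"
    unfolding moment_coeff_even_top by (intro prod.cong) auto
  also have "\<dots> = (-1) ^ Suc n * ((\<Prod>l<Suc n. 2 * real l + 1) * (\<Prod>l<Suc n. 2 * real (Suc n) - 2 * real l - 1))"
    by (simp only: prod_uminus card_lessThan prod.distrib)
  finally show ?thesis unfolding prod_odd_reverse by (simp add: power2_eq_square)
qed

text \<open>Up to a constant the weights of the sum are \<open>T p\<close>. They add up to (1)_r =
  r! by the Vandermonde convolution of rising factorials at 1/2 + 1/2, and they are symmetric under
  p \<mapsto> r - p. The average of 2(r - p) is therefore r, which gives the linear factor s + 1 +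
  r.\<close>

lemma moment_coeff_top_even_index:
  "moment_coeff (2 * r) (Suc (2 * r)) r s = (-1) ^ Suc r * (2 ^ r * fact r)\<^sup>2 * (s + 1 + real r)"
proof -
  define T where "T p = real (r choose p) * pochhammer (1 / 2) p * pochhammer (1 / 2) (r - p)" for p
  have term_eq: "(\<Prod>l<p. (2 * real l + 1) * (real (2 * r) - 2 * real l))
      * (\<Prod>l\<in>{p..<r}. (2 * real l + 2) * (real (2 * r) - 2 * real l - 1)) = 4 ^ r * fact r * T p"
    if p: "p \<le> r" for p
  proof -
    have a: "(\<Prod>l<p. real (2 * r) - 2 * real l) = 2 ^ p * (fact r / fact (r - p))"
    proof -
      have "(\<Prod>l<p. real (2 * r) - 2 * real l) = (\<Prod>l<p. 2 * real (r - l))"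
        using p by (intro prod.cong) (auto simp: of_nat_diff)
      also have "\<dots> = 2 ^ p * (\<Prod>l<p. real (r - l))" by (simp add: prod.distrib)
      also have "(\<Prod>l<p. real (r - l)) = fact r / fact (r - p)"
        using p
      proof (induction p)
        case (Suc p)
        then have "r - p = Suc (r - Suc p)" by simp
        then have "(fact (r - p) :: real) = real (r - p) * fact (r - Suc p)"
          by (metis fact_Suc)
        then show ?case using Suc by simp
      qed simp
      finally show ?thesis .
    qed
    have b: "(\<Prod>l\<in>{p..<r}. 2 * real l + 2) = 2 ^ (r - p) * (fact r / fact p)"
    proof -
      have "(\<Prod>l\<in>{p..<r}. 2 * real l + 2) = (\<Prod>l\<in>{p..<r}. 2 * real (Suc l))"
        by (intro prod.cong) auto
      also have "\<dots> = 2 ^ (r - p) * (\<Prod>l\<in>{p..<r}. real (Suc l))"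
        by (simp only: prod.distrib prod_constant card_atLeastLessThan)
      also have "(\<Prod>l\<in>{p..<r}. real (Suc l)) = fact r / fact p"
        using p by (induction r rule: dec_induct) (auto simp: field_simps)
      finally show ?thesis .
    qed
    have c: "(\<Prod>l\<in>{p..<r}. real (2 * r) - 2 * real l - 1) = 2 ^ (r - p) * pochhammer (1 / 2) (r - p)"
    proof -
      have "(\<Prod>l\<in>{p..<r}. real (2 * r) - 2 * real l - 1)
          = (\<Prod>l<r - p. 2 * real (r - p) - 2 * real l - 1)"
        using p by (intro prod.reindex_bij_witness[of _ "\<lambda>l. l + p" "\<lambda>l. l - p"]) (auto simp: of_nat_diff)
      then show ?thesis unfolding prod_odd_reverse prod_odd_pochhammer .
    qed
    have pow: "(4::real) ^ r = 2 ^ p * 2 ^ p * 2 ^ (r - p) * 2 ^ (r - p)"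
    proof -
      have "(4::real) ^ r = (2 * 2) ^ (p + (r - p))" using p by simp
      then show ?thesis by (simp only: power_add power_mult_distrib mult_ac)
    qed
    have "real (r choose p) = fact r / (fact p * fact (r - p))"
      using p by (rule binomial_fact)
    then show ?thesis
      unfolding prod.distrib a b c prod_odd_pochhammer T_def pow by (simp add: mult_ac)
  qed
  have T_sum: "(\<Sum>p\<le>r. T p) = fact r"
    using pochhammer_binomial_sum[of "1 / 2 :: real" "1 / 2" r] by (simp add: T_def pochhammer_fact)
  have T_sym: "(\<Sum>p\<le>r. T p * real p) = (\<Sum>p\<le>r. T p * (real r - real p))"
    by (rule sum.reindex_bij_witness[of _ "\<lambda>p. r - p" "\<lambda>p. r - p"])
       (auto simp: T_def of_nat_diff binomial_symmetric[symmetric] mult_ac)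
  have "(\<Sum>p\<le>r. T p * (real r - real p)) = real r * fact r - (\<Sum>p\<le>r. T p * real p)"
    unfolding T_sum[symmetric] by (simp add: right_diff_distrib sum_subtractf sum_distrib_left mult.commute)
  with T_sym have T_moment: "2 * (\<Sum>p\<le>r. T p * (real r - real p)) = real r * fact r" by simp
  have "(\<Sum>p\<le>r. (\<Prod>l<p. (2 * real l + 1) * (real (2 * r) - 2 * real l))
      * (\<Prod>l\<in>{p..<r}. (2 * real l + 2) * (real (2 * r) - 2 * real l - 1))
      * (s + 1 + 2 * (real r - real p)))
    = (\<Sum>p\<le>r. 4 ^ r * fact r * (T p * (s + 1) + 2 * (T p * (real r - real p))))"
    by (intro sum.cong refl, simp only: term_eq atMost_iff) (simp add: algebra_simps)
  also have "\<dots> = 4 ^ r * fact r * ((\<Sum>p\<le>r. T p) * (s + 1) + 2 * (\<Sum>p\<le>r. T p * (real r - real p)))"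
    by (simp only: sum_distrib_left sum_distrib_right sum.distrib distrib_left)
  also have "\<dots> = (2 ^ r * fact r)\<^sup>2 * (s + 1 + real r)"
    unfolding T_sum T_moment
    by (simp add: power_mult_distrib power2_eq_square power_mult_distrib[symmetric] algebra_simps)
  finally show ?thesis unfolding moment_coeff_odd_top by (simp only: mult.assoc)
qed

section \<open>Determinants with shifted exponent\<close>

definition IKM_det :: "nat \<Rightarrow> nat \<Rightarrow> nat \<Rightarrow> real" where
  "IKM_det k r b = Determinant.det (Matrix.mat r r (\<lambda>(i, j). IKM k i (b + 2 * j)))"

lemma IKM_det_step:
  assumes k: "Suc k div 2 = Suc n" and nz: "moment_coeff k (Suc k) (Suc n) (real b) \<noteq> 0"
  shows "IKM_det k (Suc n) (b + 2) = (-1) ^ n * (- (moment_coeff k (Suc k) 0 (real b))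
      / moment_coeff k (Suc k) (Suc n) (real b)) * IKM_det k (Suc n) b"
proof -
  let ?m = "\<lambda>j. moment_coeff k (Suc k) j (real b)"
  have "IKM k i (b + 2 * Suc n) = (\<Sum>j\<le>n. (- ?m j / ?m (Suc n)) * IKM k i (b + 2 * j))"
    if "i < Suc n" for i
  proof -
    have "2 * i < k" using that k by linarith
    from IKM_recurrence[OF this, of b]
    have "(\<Sum>j\<le>n. ?m j * IKM k i (b + 2 * j)) + ?m (Suc n) * IKM k i (b + 2 * Suc n) = 0"
      unfolding k sum.atMost_Suc .
    then have "IKM k i (b + 2 * Suc n) = - (\<Sum>j\<le>n. ?m j * IKM k i (b + 2 * j)) / ?m (Suc n)"
      using nz by (simp add: eq_divide_eq_1 field_simps)
    also have "\<dots> = (\<Sum>j\<le>n. (- ?m j / ?m (Suc n)) * IKM k i (b + 2 * j))"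
      by (simp add: sum_negf sum_divide_distrib)
    finally show ?thesis .
  qed
  from det_linear_recurrence[of n "\<lambda>i j. IKM k i (b + 2 * j)" "\<lambda>j. - ?m j / ?m (Suc n)", OF this]
  show ?thesis by (simp add: IKM_det_def)
qed

text \<open>The signs from the companion determinant, from solving for the last column and from the
  top coefficient cancel; the bottom coefficient is positive because its exponent 2n + 2 is
  even.\<close>

lemma IKM_det_step_odd:
  "IKM_det (2 * n + 1) (Suc n) (b + 2)
     = (real b + 1) ^ (2 * Suc n) / (\<Prod>l<Suc n. 2 * real l + 1)\<^sup>2 * IKM_det (2 * n + 1) (Suc n) b"
proof -
  have top: "moment_coeff (2 * n + 1) (Suc (2 * n + 1)) (Suc n) (real b)
      = (-1) ^ Suc n * (\<Prod>l<Suc n. 2 * real l + 1)\<^sup>2"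
    using moment_coeff_top_odd_index[of n "real b"] by simp
  have Q: "(\<Prod>l<Suc n. 2 * real l + 1) > 0" by (intro prod_pos) auto
  have nz: "moment_coeff (2 * n + 1) (Suc (2 * n + 1)) (Suc n) (real b) \<noteq> 0"
    unfolding top using Q by simp
  have bottom: "moment_coeff (2 * n + 1) (Suc (2 * n + 1)) 0 (real b) = (real b + 1) ^ (2 * Suc n)"
    unfolding moment_coeff_0 uminus_power_if by simp
  have "IKM_det (2 * n + 1) (Suc n) (b + 2) = (-1) ^ n * (- ((real b + 1) ^ (2 * Suc n))
      / ((-1) ^ Suc n * (\<Prod>l<Suc n. 2 * real l + 1)\<^sup>2)) * IKM_det (2 * n + 1) (Suc n) b"
    unfolding top[symmetric] bottom[symmetric] by (rule IKM_det_step[OF _ nz]) simp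
  also have "(-1) ^ n * (- ((real b + 1) ^ (2 * Suc n)) / ((-1) ^ Suc n * (\<Prod>l<Suc n. 2 * real l + 1)\<^sup>2))
      = (real b + 1) ^ (2 * Suc n) / (\<Prod>l<Suc n. 2 * real l + 1)\<^sup>2"
    by (cases "even n") (simp_all del: prod.lessThan_Suc power_Suc)
  finally show ?thesis .
qed

lemma IKM_det_step_even:
  assumes r: "r = Suc n"
  shows "IKM_det (2 * r) r (b + 2)
     = (real b + 1) ^ (2 * r + 1) / ((2 ^ r * fact r)\<^sup>2 * (real b + 1 + real r)) * IKM_det (2 * r) r b"
proof -
  let ?Q = "(2 ^ r * fact r)\<^sup>2 * (real b + 1 + real r)"
  have top: "moment_coeff (2 * r) (Suc (2 * r)) r (real b) = (-1) ^ Suc r * ?Q"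
    unfolding moment_coeff_top_even_index by (simp only: mult.assoc)
  have Q: "?Q > 0" by (intro mult_pos_pos) auto
  have nz: "moment_coeff (2 * r) (Suc (2 * r)) r (real b) \<noteq> 0"
    unfolding top using Q by simp
  have bottom: "moment_coeff (2 * r) (Suc (2 * r)) 0 (real b) = - ((real b + 1) ^ (2 * r + 1))"
    unfolding moment_coeff_0 by (subst power_minus_odd) auto
  have "IKM_det (2 * r) r (b + 2) = (-1) ^ n * (- (- ((real b + 1) ^ (2 * r + 1)))
      / ((-1) ^ Suc r * ?Q)) * IKM_det (2 * r) r b"
    unfolding top[symmetric] bottom[symmetric] unfolding r
    by (rule IKM_det_step[OF _ nz[unfolded r]]) simp
  also have "(-1) ^ n * (- (- ((real b + 1) ^ (2 * r + 1))) / ((-1) ^ Suc r * ?Q))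
      = (real b + 1) ^ (2 * r + 1) / ?Q"
    unfolding minus_minus r by (cases "even n") (simp_all del: fact_Suc)
  finally show ?thesis .
qed

subsection \<open>Asymptotics of the determinants\<close>

lemma IKM_integrable:
  assumes "2 * i < k"
  shows "set_integrable lborel {0<..} (\<lambda>t. t ^ b * (bessel_I0 t ^ i * bessel_K0 t ^ (k - i)))"
proof -
  have "set_integrable lborel {0<..} (\<lambda>t. inverse (real (k choose i)) * (t ^ b * poly.coeff (bessel_sym k 0 t) i))"
    by (rule set_integrable_mult_right, rule sym_moment_integrable) (use assms in auto)
  moreover have "inverse (real (k choose i)) * (t ^ b * poly.coeff (bessel_sym k 0 t) i)
      = t ^ b * (bessel_I0 t ^ i * bessel_K0 t ^ (k - i))" for t
    using assms by (simp add: coeff_bessel_sym_0)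
  ultimately show ?thesis by simp
qed

text \<open>The k factors 1 / sqrt t give p = k/2, the i growing and k - i decaying exponentials
  give the rate k - 2i, and the limit is the product of the constants of I_0 and K_0.\<close>

lemma IKM_asymp:
  assumes i: "2 * i < k"
  shows "(\<lambda>n. IKM k i n * real (k - 2 * i) powr (real n + 1 - real k / 2) / Gamma (real n + 1 - real k / 2))
    \<longlonglongrightarrow> sqrt pi ^ (k - 2 * i) / sqrt 2 ^ k"
proof -
  let ?l = "real (k - 2 * i)"
  let ?f = "\<lambda>t. bessel_I0 t ^ i * bessel_K0 t ^ (k - i)"
  have "((\<lambda>t. (sqrt t * exp (- t) * bessel_I0 t) ^ i * (sqrt t * exp t * bessel_K0 t) ^ (k - i))
      \<longlongrightarrow> (1 / sqrt (2 * pi)) ^ i * sqrt (pi / 2) ^ (k - i)) at_top"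
    by (intro tendsto_mult tendsto_power bessel_I0_asymp bessel_K0_asymp)
  also have "(1 / sqrt (2 * pi)) ^ i * sqrt (pi / 2) ^ (k - i) = sqrt pi ^ (k - 2 * i) / sqrt 2 ^ k"
  proof -
    have "k - i = i + (k - 2 * i)" "k = i + (i + (k - 2 * i))" using i by simp_all
    then have e: "sqrt pi ^ (k - i) = sqrt pi ^ i * sqrt pi ^ (k - 2 * i)"
      "sqrt 2 ^ k = sqrt 2 ^ i * sqrt 2 ^ (k - i)"
      by (metis power_add)+
    show ?thesis
      unfolding e(2) by (simp add: real_sqrt_mult real_sqrt_divide power_mult_distrib power_divide e(1))
  qed
  finally have lim: "((\<lambda>t. t powr (real k / 2) * exp (?l * t) * ?f t) \<longlongrightarrow> sqrt pi ^ (k - 2 * i) / sqrt 2 ^ k) at_top"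
  proof (rule Lim_transform_eventually)
    show "\<forall>\<^sub>F t in at_top. (sqrt t * exp (- t) * bessel_I0 t) ^ i * (sqrt t * exp t * bessel_K0 t) ^ (k - i)
        = t powr (real k / 2) * exp (?l * t) * ?f t"
      using eventually_gt_at_top[of 0]
    proof eventually_elim
      case (elim t)
      have s: "t powr (real k / 2) = sqrt t ^ i * sqrt t ^ (k - i)"
      proof -
        have "sqrt t ^ i * sqrt t ^ (k - i) = (t powr (1 / 2)) ^ k"
          using elim i by (simp add: powr_half_sqrt flip: power_add)
        then show ?thesis using elim powr_power[of t "1 / 2" k] by simp
      qed
      have x: "exp (?l * t) = exp (- t) ^ i * exp t ^ (k - i)"
        unfolding exp_of_nat_mult[symmetric] exp_add[symmetric]
        using i by (simp add: of_nat_diff algebra_simps)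
      show ?case unfolding s x by (simp only: power_mult_distrib mult_ac)
    qed
  qed
  have "(\<lambda>n. (LINT t:{0<..}|lborel. t ^ n * ?f t) * ?l powr (real n + 1 - real k / 2)
      / Gamma (real n + 1 - real k / 2)) \<longlonglongrightarrow> sqrt pi ^ (k - 2 * i) / sqrt 2 ^ k"
    using i by (intro moment_asymp[OF IKM_integrable[OF i] _ lim]) simp
  then show ?thesis unfolding IKM_def by (simp add: mult.commute)
qed

lemma filterlim_affine_nat: "filterlim (\<lambda>n. 2 * real n + c) at_top sequentially"
  by real_asymp

text \<open>Row i is scaled by its exponential and Gamma factor at column 0, column j by z^(-2j).
  Since Gamma(z + 2j) / Gamma(z) ~ z^(2j), what remains of the column dependence is the power (k -
  2i)^(-2j), a Vandermonde entry.\<close>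

lemma IKM_det_asymp:
  assumes k: "\<And>i. i < r \<Longrightarrow> 2 * i < k"
  defines "z \<equiv> \<lambda>n. 2 * real n + (1 - real k / 2)"
  shows "(\<lambda>n. IKM_det k r (2 * n) * (\<Prod>i<r. real (k - 2 * i) powr z n) / (Gamma (z n) * z n ^ (r - 1)) ^ r)
    \<longlonglongrightarrow> (\<Prod>i<r. sqrt pi ^ (k - 2 * i) / sqrt 2 ^ k)
      * (\<Prod>i<r. \<Prod>j<i. 1 / real (k - 2 * i) ^ 2 - 1 / real (k - 2 * j) ^ 2)"
proof -
  let ?l = "\<lambda>i. real (k - 2 * i)"
  let ?\<kappa> = "\<lambda>i. sqrt pi ^ (k - 2 * i) / sqrt 2 ^ k"
  have z: "filterlim z at_top sequentially" unfolding z_def by (rule filterlim_affine_nat)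
  have zpos: "\<forall>\<^sub>F n in sequentially. z n > 0"
    using filterlim_at_top_dense[THEN iffD1, OF z, rule_format, of 0] .
  have entry: "(\<lambda>n. (?l i powr z n / Gamma (z n)) * IKM k i (2 * n + 2 * j) * (1 / z n ^ (2 * j)))
      \<longlonglongrightarrow> ?\<kappa> i * (1 / ?l i ^ 2) ^ j * 1" if i: "i < r" for i j
  proof -
    have lpos: "?l i > 0" using k[OF i] by simp
    have sub: "filterlim (\<lambda>n. 2 * n + 2 * j) at_top sequentially"
      by (rule filterlim_subseq) (auto simp: strict_mono_def)
    have "(\<lambda>n. IKM k i (2 * n + 2 * j) * ?l i powr (z n + 2 * real j) / Gamma (z n + 2 * real j)) \<longlonglongrightarrow> ?\<kappa> i"
      using filterlim_compose[OF IKM_asymp[OF k[OF i]] sub] by (simp add: z_def algebra_simps)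
    from tendsto_mult[OF this pochhammer_asymp[OF z, of "2 * j"]]
    have "(\<lambda>n. IKM k i (2 * n + 2 * j) * ?l i powr (z n + 2 * real j) / Gamma (z n + 2 * real j)
        * (pochhammer (z n) (2 * j) / z n ^ (2 * j)) * (1 / ?l i ^ 2) ^ j) \<longlonglongrightarrow> ?\<kappa> i * 1 * (1 / ?l i ^ 2) ^ j"
      by (rule tendsto_mult[OF _ tendsto_const])
    then have "(\<lambda>n. IKM k i (2 * n + 2 * j) * ?l i powr (z n + 2 * real j) / Gamma (z n + 2 * real j)
        * (pochhammer (z n) (2 * j) / z n ^ (2 * j)) * (1 / ?l i ^ 2) ^ j) \<longlonglongrightarrow> ?\<kappa> i * (1 / ?l i ^ 2) ^ j * 1"
      by (simp only: mult_1_right)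
    then show ?thesis
    proof (rule Lim_transform_eventually)
      show "\<forall>\<^sub>F n in sequentially. IKM k i (2 * n + 2 * j) * ?l i powr (z n + 2 * real j) / Gamma (z n + 2 * real j)
          * (pochhammer (z n) (2 * j) / z n ^ (2 * j)) * (1 / ?l i ^ 2) ^ j
          = (?l i powr z n / Gamma (z n)) * IKM k i (2 * n + 2 * j) * (1 / z n ^ (2 * j))"
        using zpos
      proof eventually_elim
        case (elim n)
        have nz: "z n \<notin> \<int>\<^sub>\<le>\<^sub>0" using elim by (auto elim!: nonpos_Ints_cases)
        have G: "Gamma (z n + 2 * real j) > 0" using elim by (intro Gamma_real_pos) auto
        have P: "pochhammer (z n) (2 * j) = Gamma (z n + 2 * real j) / Gamma (z n)"
          using pochhammer_Gamma[OF nz, of "2 * j"] by simp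
        have L: "?l i powr (z n + 2 * real j) * (1 / ?l i ^ 2) ^ j = ?l i powr z n"
        proof -
          have "?l i powr (2 * real j) = (?l i ^ 2) ^ j"
            using lpos powr_realpow[of "?l i" "2 * j"] by (simp add: power_mult)
          then show ?thesis using lpos by (simp add: powr_add power_divide)
        qed
        have "IKM k i (2 * n + 2 * j) * ?l i powr (z n + 2 * real j) / Gamma (z n + 2 * real j)
            * (pochhammer (z n) (2 * j) / z n ^ (2 * j)) * (1 / ?l i ^ 2) ^ j
          = IKM k i (2 * n + 2 * j) * (?l i powr (z n + 2 * real j) * (1 / ?l i ^ 2) ^ j)
            / Gamma (z n) * (1 / z n ^ (2 * j))"
          unfolding P using G by simp
        then show ?case unfolding L by simp
      qed
    qed
  qed
  have "(\<lambda>n. Determinant.det (Matrix.mat r r (\<lambda>(i, j).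
          (?l i powr z n / Gamma (z n)) * IKM k i (2 * n + 2 * j) * (1 / z n ^ (2 * j)))))
      \<longlonglongrightarrow> Determinant.det (Matrix.mat r r (\<lambda>(i, j). ?\<kappa> i * (1 / ?l i ^ 2) ^ j * 1))"
    by (intro tendsto_det_mat entry)
  also have "(\<lambda>n. Determinant.det (Matrix.mat r r (\<lambda>(i, j).
          (?l i powr z n / Gamma (z n)) * IKM k i (2 * n + 2 * j) * (1 / z n ^ (2 * j)))))
      = (\<lambda>n. IKM_det k r (2 * n) * (\<Prod>i<r. ?l i powr z n) / (Gamma (z n) * z n ^ (r - 1)) ^ r)"
  proof
    fix n
    have "(\<Prod>j<r. 1 / z n ^ (2 * j)) = 1 / (z n ^ (r - 1)) ^ r"
    proof -
      \<comment> \<open>The total column scaling, written as an r-th power so that it combines with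
        Gamma(z)^r.\<close>
      have "(\<Sum>j<r. 2 * j) = (r - 1) * r"
      proof (induction r)
        case (Suc r)
        then show ?case by (cases r) simp_all
      qed simp
      then have "z n ^ (\<Sum>j<r. 2 * j) = (z n ^ (r - 1)) ^ r"
        by (simp only:) (rule power_mult)
      then have "(\<Prod>j<r. z n ^ (2 * j)) = (z n ^ (r - 1)) ^ r"
        unfolding power_sum .
      then show ?thesis by (simp add: prod_dividef)
    qed
    moreover have "(\<Prod>i<r. ?l i powr z n / Gamma (z n)) = (\<Prod>i<r. ?l i powr z n) / Gamma (z n) ^ r"
      by (simp add: prod_dividef)
    ultimately show "Determinant.det (Matrix.mat r r (\<lambda>(i, j).
          (?l i powr z n / Gamma (z n)) * IKM k i (2 * n + 2 * j) * (1 / z n ^ (2 * j))))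
      = IKM_det k r (2 * n) * (\<Prod>i<r. ?l i powr z n) / (Gamma (z n) * z n ^ (r - 1)) ^ r"
      unfolding det_mat_scale IKM_det_def by (simp add: power_mult_distrib)
  qed
  also have "Determinant.det (Matrix.mat r r (\<lambda>(i, j). ?\<kappa> i * (1 / ?l i ^ 2) ^ j * 1))
      = (\<Prod>i<r. ?\<kappa> i) * (\<Prod>i<r. \<Prod>j<i. 1 / ?l i ^ 2 - 1 / ?l j ^ 2)"
    unfolding det_mat_scale[of r ?\<kappa> "\<lambda>i j. (1 / ?l i ^ 2) ^ j" "\<lambda>j. 1"] det_vandermonde by simp
  finally show ?thesis .
qed

section \<open>Limits of Gamma quotients\<close>

lemma Gamma_half_asymp: "(\<lambda>n. Gamma (real n + 1 / 2) * sqrt (real n) / fact n) \<longlonglongrightarrow> 1"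
proof (rule Lim_transform_eventually[OF Gamma_shift_asymp[of "1 / 2"]])
  show "\<forall>\<^sub>F n in sequentially. Gamma (real n + 1 / 2) / (fact n * real n powr (1 / 2 - 1))
      = Gamma (real n + 1 / 2) * sqrt (real n) / fact n"
    using eventually_gt_at_top[of 0]
    by eventually_elim (simp add: powr_minus powr_half_sqrt field_simps)
qed simp

text \<open>The base is (2n - 1)!!. One factor of the square combines with n! to (2n)!, the other is
  kept as a Gamma value at a half-integer; the pair can then be compared with Gamma at arguments
  near 2n.\<close>

lemma double_pochhammer_half:
  "(2 ^ n * pochhammer (1 / 2) n)\<^sup>2 = fact (2 * n) * Gamma (real n + 1 / 2) / (sqrt pi * fact n)"
proof -
  have "(1 / 2 :: real) \<notin> \<int>\<^sub>\<le>\<^sub>0" by (auto elim!: nonpos_Ints_cases)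
  from pochhammer_Gamma[OF this, of n]
  have p: "pochhammer (1 / 2) n = Gamma (real n + 1 / 2) / sqrt pi"
    by (simp add: Gamma_one_half_real add.commute)
  have "(fact (2 * n) :: real) = 2 ^ (2 * n) * pochhammer (1 / 2) n * fact n"
    using fact_double[of n, where 'a = real] by simp
  moreover have "(2::real) ^ n * 2 ^ n = 4 ^ n" by (simp flip: power_mult_distrib)
  ultimately show ?thesis
    by (simp add: power2_eq_square power_mult_distrib power_mult p)
qed

lemma Gamma_times_power_asymp:
  fixes c :: real
  shows "(\<lambda>n. Gamma (2 * real n + c + real m) / (Gamma (2 * real n + c) * (2 * real n + c) ^ m)) \<longlonglongrightarrow> 1"
proof (rule Lim_transform_eventually[OF pochhammer_asymp[OF filterlim_affine_nat[of c], of m]])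
  show "\<forall>\<^sub>F n in sequentially. pochhammer (2 * real n + c) m / (2 * real n + c) ^ m
      = Gamma (2 * real n + c + real m) / (Gamma (2 * real n + c) * (2 * real n + c) ^ m)"
    using filterlim_at_top_dense[THEN iffD1, OF filterlim_affine_nat[of c], rule_format, of 0]
  proof eventually_elim
    case (elim n)
    then have "2 * real n + c \<notin> \<int>\<^sub>\<le>\<^sub>0" by (auto elim!: nonpos_Ints_cases)
    from pochhammer_Gamma[OF this, of m] show ?case by simp
  qed
qed

subsection \<open>Evaluation of the limits\<close>

lemma IKM_det_even_moments_odd:
  "IKM_det (2 * n + 1) (Suc n) (2 * m) = (2 ^ m * pochhammer (1 / 2) m) ^ (2 * Suc n)
     / (\<Prod>l<Suc n. 2 * real l + 1) ^ (2 * m) * IKM_det (2 * n + 1) (Suc n) 0"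
proof (induction m)
  case (Suc m)
  let ?Q = "\<Prod>l<Suc n. 2 * real l + 1"
  have 1: "IKM_det (2 * n + 1) (Suc n) (2 * Suc m)
      = (real (2 * m) + 1) ^ (2 * Suc n) / ?Q\<^sup>2 * IKM_det (2 * n + 1) (Suc n) (2 * m)"
    using IKM_det_step_odd[of n "2 * m"] by simp
  have 2: "?Q ^ (2 * Suc m) = ?Q\<^sup>2 * ?Q ^ (2 * m)"
    by (simp only: power_add[symmetric]) simp
  have 3: "2 ^ Suc m * pochhammer (1 / 2) (Suc m) = (real (2 * m) + 1) * (2 ^ m * pochhammer (1 / 2 :: real) m)"
    by (simp add: pochhammer_Suc algebra_simps)
  show ?case
    unfolding 1 2 3 Suc.IH
    by (simp only: power_mult_distrib times_divide_times_eq mult_ac times_divide_eq_right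
        times_divide_eq_left divide_divide_eq_left)
qed simp

text \<open>The factors 2l + 1 + r of the top coefficients multiply to 2^m ((r + 1)/2)_m, from which
  Gamma((r + 1)/2) emerges in the limit.\<close>

lemma IKM_det_even_moments_even:
  assumes r: "r = Suc n"
  shows "IKM_det (2 * r) r (2 * m) = (2 ^ m * pochhammer (1 / 2) m) ^ (2 * r + 1)
     / ((2 ^ r * fact r) ^ (2 * m) * (2 ^ m * pochhammer ((real r + 1) / 2) m)) * IKM_det (2 * r) r 0"
proof (induction m)
  case (Suc m)
  let ?Q = "2 ^ r * fact r :: real"
  have 1: "IKM_det (2 * r) r (2 * Suc m)
      = (real (2 * m) + 1) ^ (2 * r + 1) / (?Q\<^sup>2 * (real (2 * m) + 1 + real r)) * IKM_det (2 * r) r (2 * m)"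
    using IKM_det_step_even[OF r, of "2 * m"] by simp
  have 2: "?Q ^ (2 * Suc m) = ?Q\<^sup>2 * ?Q ^ (2 * m)"
    by (simp only: power_add[symmetric]) simp
  have 3: "2 ^ Suc m * pochhammer (1 / 2) (Suc m) = (real (2 * m) + 1) * (2 ^ m * pochhammer (1 / 2 :: real) m)"
    by (simp add: pochhammer_Suc algebra_simps)
  have 4: "2 ^ Suc m * pochhammer ((real r + 1) / 2) (Suc m)
      = (real (2 * m) + 1 + real r) * (2 ^ m * pochhammer ((real r + 1) / 2) m)"
    by (simp add: pochhammer_Suc field_simps)
  show ?case
    unfolding 1 2 3 4 Suc.IH
    by (simp only: power_mult_distrib times_divide_times_eq mult_ac times_divide_eq_right
        times_divide_eq_left divide_divide_eq_left)
qed simp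

text \<open>Both sides are limits of one sequence. The rates k - 2i multiply to Q, so the Q^(2m) of
  the solved recurrence cancels against the row scaling up to a constant power; the rest is the r-th
  power of a single quotient \<open>y m\<close>.\<close>

lemma IKM_det_odd_value:
  fixes n :: nat
  defines "r \<equiv> Suc n" and "k \<equiv> 2 * n + 1"
  defines "Q \<equiv> \<Prod>l<r. 2 * real l + 1"
  shows "IKM_det k r 0 * ((sqrt 2 / sqrt pi) ^ r * Q powr (1 - real k / 2))
    = (\<Prod>i<r. sqrt pi ^ (k - 2 * i) / sqrt 2 ^ k)
      * (\<Prod>i<r. \<Prod>j<i. 1 / real (k - 2 * i) ^ 2 - 1 / real (k - 2 * j) ^ 2)"
proof (rule LIMSEQ_unique)
  define z where "z m = 2 * real m + (1 - real k / 2)" for m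
  define y where "y m = (2 ^ m * pochhammer (1 / 2) m)\<^sup>2 / (Gamma (z m) * z m ^ n)" for m
  have Q: "Q > 0" unfolding Q_def by (intro prod_pos) auto
  have prod_l: "(\<Prod>i<r. real (k - 2 * i) powr z m) = Q powr z m" for m
  proof -
    have "(\<Prod>i<r. real (k - 2 * i)) = (\<Prod>l<r. 2 * real r - 2 * real l - 1)"
      by (intro prod.cong) (auto simp: k_def r_def of_nat_diff)
    then have "(\<Prod>i<r. real (k - 2 * i)) = Q" unfolding prod_odd_reverse Q_def .
    then show ?thesis by (subst prod_powr_distrib[symmetric]) auto
  qed
  have "IKM_det k r (2 * m) * (\<Prod>i<r. real (k - 2 * i) powr z m) / (Gamma (z m) * z m ^ (r - 1)) ^ r
      = IKM_det k r 0 * (y m ^ r * Q powr (1 - real k / 2))" for m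
  proof -
    have 1: "Q powr z m / Q ^ (2 * m) = Q powr (1 - real k / 2)"
      using Q by (simp add: z_def powr_add powr_realpow[symmetric])
    have 2: "y m ^ r = (2 ^ m * pochhammer (1 / 2) m) ^ (2 * r) / (Gamma (z m) * z m ^ (r - 1)) ^ r"
      unfolding y_def power_divide power_mult by (simp add: r_def)
    have 3: "IKM_det k r (2 * m) = (2 ^ m * pochhammer (1 / 2) m) ^ (2 * r) / Q ^ (2 * m) * IKM_det k r 0"
      unfolding k_def r_def Q_def by (rule IKM_det_even_moments_odd)
    show ?thesis
      unfolding prod_l 1[symmetric] 2 3 by (simp only: times_divide_times_eq times_divide_eq_right
          times_divide_eq_left divide_divide_eq_left mult_ac)
  qed
  with IKM_det_asymp[of r k]
  show "(\<lambda>m. IKM_det k r 0 * (y m ^ r * Q powr (1 - real k / 2)))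
      \<longlonglongrightarrow> (\<Prod>i<r. sqrt pi ^ (k - 2 * i) / sqrt 2 ^ k)
      * (\<Prod>i<r. \<Prod>j<i. 1 / real (k - 2 * i) ^ 2 - 1 / real (k - 2 * j) ^ 2)"
    by (simp add: z_def r_def k_def)
  have sub: "filterlim (\<lambda>m. 2 * m :: nat) at_top sequentially"
    by (rule filterlim_subseq) (auto simp: strict_mono_def)
  have 1: "(\<lambda>m. inverse (Gamma (2 * real m + 1 / 2) * sqrt (2 * real m) / fact (2 * m))) \<longlonglongrightarrow> inverse 1"
    by (intro tendsto_inverse) (use filterlim_compose[OF Gamma_half_asymp sub] in simp_all)
  \<comment> \<open>Here z + n = 2m + 1/2 because k = 2n + 1.\<close>
  have 2: "(\<lambda>m. Gamma (2 * real m + 1 / 2) / (Gamma (z m) * z m ^ n)) \<longlonglongrightarrow> 1"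
    using Gamma_times_power_asymp[of "1 - real k / 2" n] by (simp add: z_def k_def add_divide_distrib)
  have "(\<lambda>m. inverse (Gamma (2 * real m + 1 / 2) * sqrt (2 * real m) / fact (2 * m))
      * (Gamma (real m + 1 / 2) * sqrt (real m) / fact m)
      * (Gamma (2 * real m + 1 / 2) / (Gamma (z m) * z m ^ n)) * (sqrt 2 / sqrt pi))
    \<longlonglongrightarrow> inverse 1 * 1 * 1 * (sqrt 2 / sqrt pi)"
    by (intro tendsto_mult tendsto_const 1 2 Gamma_half_asymp)
  then have "(\<lambda>m. inverse (Gamma (2 * real m + 1 / 2) * sqrt (2 * real m) / fact (2 * m))
      * (Gamma (real m + 1 / 2) * sqrt (real m) / fact m)
      * (Gamma (2 * real m + 1 / 2) / (Gamma (z m) * z m ^ n)) * (sqrt 2 / sqrt pi))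
    \<longlonglongrightarrow> sqrt 2 / sqrt pi" by simp
  then have "y \<longlonglongrightarrow> sqrt 2 / sqrt pi"
  proof (rule Lim_transform_eventually)
    show "\<forall>\<^sub>F m in sequentially. inverse (Gamma (2 * real m + 1 / 2) * sqrt (2 * real m) / fact (2 * m))
      * (Gamma (real m + 1 / 2) * sqrt (real m) / fact m)
      * (Gamma (2 * real m + 1 / 2) / (Gamma (z m) * z m ^ n)) * (sqrt 2 / sqrt pi) = y m"
      using eventually_gt_at_top[of 0]
    proof eventually_elim
      case (elim m)
      have "Gamma (2 * real m + 1 / 2) > 0" by (intro Gamma_real_pos) auto
      then have H: "Gamma (2 * real m + 1 / 2) \<noteq> 0" by (metis less_irrefl)
      have s: "sqrt (2 * real m) = sqrt 2 * sqrt (real m)" by (rule real_sqrt_mult)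
      have aux: "inverse (H * (t * s) / E) * (G * s / F) * (H / D) * (t / p) = E * G / (p * F) / D"
        if "H \<noteq> 0" "s \<noteq> 0" "t \<noteq> 0" for H t s E G F D p :: real
        using that by (simp add: mult_ac)
      show ?case
        unfolding y_def double_pochhammer_half s by (rule aux, rule H) (use elim in simp_all)
    qed
  qed
  then show "(\<lambda>m. IKM_det k r 0 * (y m ^ r * Q powr (1 - real k / 2)))
      \<longlonglongrightarrow> IKM_det k r 0 * ((sqrt 2 / sqrt pi) ^ r * Q powr (1 - real k / 2))"
    by (intro tendsto_mult tendsto_power tendsto_const)
qed

text \<open>Now z + n = 2m, and the quotient used for odd k would grow like sqrt m. This growth is
  divided out in \<open>y\<close> and returned in \<open>x\<close>, where sqrt(m)^r balances (1/2)_m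
  / (a)_m ~ const m^(1/2 - a) because a - 1/2 = r/2.\<close>

lemma IKM_det_even_value:
  fixes n :: nat
  defines "r \<equiv> Suc n"
  defines "k \<equiv> 2 * r" and "Q \<equiv> 2 ^ r * fact r :: real" and "a \<equiv> (real r + 1) / 2"
  shows "IKM_det k r 0 * ((2 / sqrt pi) ^ r * (Gamma a / sqrt pi) * Q powr (1 - real k / 2))
    = (\<Prod>i<r. sqrt pi ^ (k - 2 * i) / sqrt 2 ^ k)
      * (\<Prod>i<r. \<Prod>j<i. 1 / real (k - 2 * i) ^ 2 - 1 / real (k - 2 * j) ^ 2)"
proof (rule LIMSEQ_unique)
  define z where "z m = 2 * real m + (1 - real k / 2)" for m
  define y where "y m = (2 ^ m * pochhammer (1 / 2) m)\<^sup>2 / (Gamma (z m) * z m ^ n) / sqrt (real m)" for m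
  define x where "x m = sqrt (real m) ^ r * (pochhammer (1 / 2) m / pochhammer a m)" for m
  have Q: "Q > 0" by (simp add: Q_def)
  have a: "a > 0" by (simp add: a_def)
  have prod_l: "(\<Prod>i<r. real (k - 2 * i) powr z m) = Q powr z m" for m
  proof -
    have "(\<Prod>i<r. real (k - 2 * i)) = (\<Prod>l<r. 2 * real (Suc (r - Suc l)))"
      by (intro prod.cong) (auto simp: k_def of_nat_diff)
    also have "\<dots> = (\<Prod>l<r. 2 * real (Suc l))"
      using prod.nat_diff_reindex[of "\<lambda>l. 2 * real (Suc l)" r] .
    also have "\<dots> = Q" unfolding Q_def by (induction r) auto
    finally have "(\<Prod>i<r. real (k - 2 * i)) = Q" .
    then show ?thesis by (subst prod_powr_distrib[symmetric]) auto
  qed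
  have eq: "IKM_det k r (2 * m) * (\<Prod>i<r. real (k - 2 * i) powr z m) / (Gamma (z m) * z m ^ (r - 1)) ^ r
      = IKM_det k r 0 * (y m ^ r * x m * Q powr (1 - real k / 2))" if m: "m > 0" for m
  proof -
    let ?p = "2 ^ m * pochhammer (1 / 2) m :: real"
    have 1: "Q powr z m / Q ^ (2 * m) = Q powr (1 - real k / 2)"
      using Q by (simp add: z_def powr_add powr_realpow[symmetric])
    have 2: "y m ^ r * x m = ?p ^ (2 * r) / (Gamma (z m) * z m ^ (r - 1)) ^ r * (?p / (2 ^ m * pochhammer a m))"
      unfolding y_def x_def power_divide power_mult using m by (simp add: r_def)
    have 3: "IKM_det k r (2 * m) = ?p ^ (2 * r) * ?p / (Q ^ (2 * m) * (2 ^ m * pochhammer a m)) * IKM_det k r 0"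
      using IKM_det_even_moments_even[of r n m] by (simp add: k_def r_def Q_def a_def)
    show ?thesis
      unfolding prod_l 1[symmetric] 2 3 by (simp only: times_divide_times_eq times_divide_eq_right
          times_divide_eq_left divide_divide_eq_left mult_ac)
  qed
  have "(\<lambda>m. IKM_det k r (2 * m) * (\<Prod>i<r. real (k - 2 * i) powr z m) / (Gamma (z m) * z m ^ (r - 1)) ^ r)
      \<longlonglongrightarrow> (\<Prod>i<r. sqrt pi ^ (k - 2 * i) / sqrt 2 ^ k)
      * (\<Prod>i<r. \<Prod>j<i. 1 / real (k - 2 * i) ^ 2 - 1 / real (k - 2 * j) ^ 2)"
    unfolding z_def by (rule IKM_det_asymp) (simp add: k_def)
  then show "(\<lambda>m. IKM_det k r 0 * (y m ^ r * x m * Q powr (1 - real k / 2)))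
      \<longlonglongrightarrow> (\<Prod>i<r. sqrt pi ^ (k - 2 * i) / sqrt 2 ^ k)
      * (\<Prod>i<r. \<Prod>j<i. 1 / real (k - 2 * i) ^ 2 - 1 / real (k - 2 * j) ^ 2)"
    by (rule Lim_transform_eventually) (use eq in \<open>auto intro: eventually_mono[OF eventually_gt_at_top[of 0]]\<close>)
  have 2: "(\<lambda>m. Gamma (2 * real m) / (Gamma (z m) * z m ^ n)) \<longlonglongrightarrow> 1"
  proof -
    have "2 * real m + (1 - real k / 2) + real n = 2 * real m" for m
      by (simp add: k_def r_def field_simps)
    with Gamma_times_power_asymp[of "1 - real k / 2" n] show ?thesis by (simp only: z_def)
  qed
  have "(\<lambda>m. (Gamma (real m + 1 / 2) * sqrt (real m) / fact m)
      * (Gamma (2 * real m) / (Gamma (z m) * z m ^ n)) * (2 / sqrt pi))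
    \<longlonglongrightarrow> 1 * 1 * (2 / sqrt pi)"
    by (intro tendsto_mult tendsto_const 2 Gamma_half_asymp)
  then have "(\<lambda>m. (Gamma (real m + 1 / 2) * sqrt (real m) / fact m)
      * (Gamma (2 * real m) / (Gamma (z m) * z m ^ n)) * (2 / sqrt pi)) \<longlonglongrightarrow> 2 / sqrt pi" by simp
  then have y: "y \<longlonglongrightarrow> 2 / sqrt pi"
  proof (rule Lim_transform_eventually)
    show "\<forall>\<^sub>F m in sequentially. (Gamma (real m + 1 / 2) * sqrt (real m) / fact m)
      * (Gamma (2 * real m) / (Gamma (z m) * z m ^ n)) * (2 / sqrt pi) = y m"
      using eventually_gt_at_top[of 0]
    proof eventually_elim
      case (elim m)
      have "fact (2 * m) = 2 * real m * Gamma (2 * real m)"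
        using Gamma_fact[of "2 * m - 1", where 'a = real] fact_reduce[of "2 * m", where 'a = real] elim
        by (simp add: of_nat_diff)
      then have f: "fact (2 * m) = 2 * (sqrt (real m) * sqrt (real m)) * Gamma (2 * real m)" by simp
      have aux: "G * s / F * (H / D) * (2 / p) = 2 * (s * s) * H * G / (p * F) / D / s"
        if "s \<noteq> 0" for G s F H D p :: real
        using that by (simp add: mult_ac)
      then show ?case
        unfolding y_def double_pochhammer_half f using elim by (intro aux) simp
    qed
  qed
  have "(\<lambda>m. (Gamma (real m + 1 / 2) / (fact m * real m powr (1 / 2 - 1)))
      / (Gamma (real m + a) / (fact m * real m powr (a - 1))) * (Gamma a / sqrt pi))
    \<longlonglongrightarrow> 1 / 1 * (Gamma a / sqrt pi)"
    by (rule tendsto_mult[OF tendsto_divide[OF Gamma_shift_asymp Gamma_shift_asymp] tendsto_const])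
       (use a in simp_all)
  then have "(\<lambda>m. (Gamma (real m + 1 / 2) / (fact m * real m powr (1 / 2 - 1)))
      / (Gamma (real m + a) / (fact m * real m powr (a - 1))) * (Gamma a / sqrt pi))
    \<longlonglongrightarrow> Gamma a / sqrt pi" by simp
  then have x: "x \<longlonglongrightarrow> Gamma a / sqrt pi"
  proof (rule Lim_transform_eventually)
    show "\<forall>\<^sub>F m in sequentially. (Gamma (real m + 1 / 2) / (fact m * real m powr (1 / 2 - 1)))
      / (Gamma (real m + a) / (fact m * real m powr (a - 1))) * (Gamma a / sqrt pi) = x m"
      using eventually_gt_at_top[of 0]
    proof eventually_elim
      case (elim m)
      have na: "a \<notin> \<int>\<^sub>\<le>\<^sub>0" using a by (auto elim!: nonpos_Ints_cases)
      have nh: "(1 / 2 :: real) \<notin> \<int>\<^sub>\<le>\<^sub>0" by (auto elim!: nonpos_Ints_cases)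
      have s: "sqrt (real m) ^ r = real m powr (a - 1) / real m powr (1 / 2 - 1)"
      proof -
        have "sqrt (real m) ^ r = (real m powr (1 / 2)) ^ r" by (simp add: powr_half_sqrt)
        also have "\<dots> = real m powr (real r * (1 / 2))" using elim by (intro powr_power) auto
        also have "\<dots> = real m powr ((a - 1) - (1 / 2 - 1))" by (simp add: a_def field_simps)
        finally show ?thesis unfolding powr_diff .
      qed
      have p: "pochhammer (1 / 2) m = Gamma (real m + 1 / 2) / sqrt pi"
        "pochhammer a m = Gamma (real m + a) / Gamma a"
        using pochhammer_Gamma[OF nh, of m] pochhammer_Gamma[OF na, of m]
        by (simp_all add: Gamma_one_half_real add.commute)
      have aux: "G / (F * h) / (B / (F * w)) * (A / q) = w / h * (G / q / (B / A))"
        if "F \<noteq> 0" for G F h B w A q :: real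
        using that by (simp add: mult_ac)
      show ?case
        unfolding x_def s p by (rule aux) simp
    qed
  qed
  show "(\<lambda>m. IKM_det k r 0 * (y m ^ r * x m * Q powr (1 - real k / 2)))
      \<longlonglongrightarrow> IKM_det k r 0 * ((2 / sqrt pi) ^ r * (Gamma a / sqrt pi) * Q powr (1 - real k / 2))"
    by (intro tendsto_mult tendsto_power tendsto_const x y)
qed

subsection \<open>Closed forms\<close>

text \<open>The nodes k - 2i decrease in i, while the closed forms use increasing nodes. Reversing
  the indices also exchanges the two members of each pair, so no sign arises.\<close>

lemma prod_pairs_reverse:
  fixes g :: "nat \<Rightarrow> nat \<Rightarrow> 'a::comm_monoid_mult"
  shows "(\<Prod>i<r. \<Prod>j<i. g (r - 1 - i) (r - 1 - j)) = (\<Prod>q<r. \<Prod>p<q. g p q)"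
proof -
  have "(\<Prod>x\<in>Sigma {..<r} lessThan. g (r - 1 - fst x) (r - 1 - snd x))
      = (\<Prod>x\<in>Sigma {..<r} lessThan. g (snd x) (fst x))"
    by (rule prod.reindex_bij_witness[of _ "\<lambda>x. (r - 1 - snd x, r - 1 - fst x)" "\<lambda>x. (r - 1 - snd x, r - 1 - fst x)"])
       auto
  then show ?thesis by (simp add: prod.Sigma split_beta)
qed

text \<open>Multiplying by the power 2r of the node product clears all denominators. In the
  induction the denominator of row r cancels completely and leaves f r and one square of the new
  node, which extends the squared product.\<close>

lemma prod_pairs_closed_form:
  fixes \<mu> f :: "nat \<Rightarrow> real"
  assumes pos: "\<And>l. \<mu> l > 0"
    and row: "\<And>q. (\<Prod>p<q. 1 / \<mu> p ^ 2 - 1 / \<mu> q ^ 2) = f q / ((\<Prod>l<q. \<mu> l)\<^sup>2 * \<mu> q ^ (2 * q))"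
  shows "(\<Prod>q<r. \<Prod>p<q. 1 / \<mu> p ^ 2 - 1 / \<mu> q ^ 2) * (\<Prod>l<r. \<mu> l) ^ (2 * r)
    = (\<Prod>l<r. \<mu> l)\<^sup>2 * (\<Prod>q<r. f q)"
proof (induction r)
  case (Suc r)
  let ?Q = "\<Prod>l<r. \<mu> l" and ?V = "\<Prod>q<r. \<Prod>p<q. 1 / \<mu> p ^ 2 - 1 / \<mu> q ^ 2"
  have Q: "?Q \<noteq> 0" "\<mu> r \<noteq> 0" using pos by (metis less_irrefl prod_pos, metis less_irrefl)
  have "(\<Prod>q<Suc r. \<Prod>p<q. 1 / \<mu> p ^ 2 - 1 / \<mu> q ^ 2) * (\<Prod>l<Suc r. \<mu> l) ^ (2 * Suc r)
      = ?V * (f r / (?Q\<^sup>2 * \<mu> r ^ (2 * r))) * (?Q * \<mu> r) ^ (2 * Suc r)"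
    by (simp add: row)
  also have "(?Q * \<mu> r) ^ (2 * Suc r) = ?Q ^ (2 * r) * ?Q\<^sup>2 * (\<mu> r ^ (2 * r) * (\<mu> r)\<^sup>2)"
    by (simp add: power_mult_distrib power_add[symmetric] power2_eq_square mult_ac)
  also have "?V * (f r / (?Q\<^sup>2 * \<mu> r ^ (2 * r))) * (?Q ^ (2 * r) * ?Q\<^sup>2 * (\<mu> r ^ (2 * r) * (\<mu> r)\<^sup>2))
      = (?V * ?Q ^ (2 * r)) * f r * (\<mu> r)\<^sup>2"
    using Q by simp
  finally show ?case unfolding Suc.IH by (simp add: power_mult_distrib mult_ac)
qed simp

lemma prod_diff_fact: "(\<Prod>p<q. real q - real p) = fact q"
proof -
  have "(\<Prod>p<q. real q - real p) = (\<Prod>p<q. real (Suc (q - Suc p)))"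
    by (intro prod.cong) (auto simp: of_nat_diff)
  also have "\<dots> = (\<Prod>p<q. real (Suc p))" using prod.nat_diff_reindex[of "\<lambda>l. real (Suc l)" q] .
  also have "\<dots> = fact q" by (induction q) (auto simp: mult.commute)
  finally show ?thesis .
qed

lemma prod_shift_fact: "(\<Prod>p<m. real q + real p + 1) = fact (q + m) / fact q"
proof (induction m)
  case (Suc m)
  have "fact (q + Suc m) = (real q + real m + 1) * fact (q + m)" by (simp add: add_ac)
  then show ?case by (simp add: Suc.IH)
qed simp

text \<open>Difference of squares: the numerators factor as 4 (q - p)(q + p + c). The nodes are the
  odd numbers for c = 1 and the positive even numbers for c = 2.\<close>

lemma prod_inverse_square_diff:
  fixes c :: real
  assumes c: "c > 0"
  shows "(\<Prod>p<q. 1 / (2 * real p + c)\<^sup>2 - 1 / (2 * real q + c)\<^sup>2)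
    = 4 ^ q * fact q * (\<Prod>p<q. real q + real p + c) / ((\<Prod>p<q. 2 * real p + c)\<^sup>2 * (2 * real q + c) ^ (2 * q))"
proof -
  have "1 / (2 * real p + c)\<^sup>2 - 1 / (2 * real q + c)\<^sup>2
      = 4 * ((real q - real p) * (real q + real p + c)) / ((2 * real p + c)\<^sup>2 * (2 * real q + c)\<^sup>2)" for p
  proof -
    have "2 * real p + c \<noteq> 0" "2 * real q + c \<noteq> 0" using c by linarith+
    then have "1 / (2 * real p + c)\<^sup>2 - 1 / (2 * real q + c)\<^sup>2
        = ((2 * real q + c)\<^sup>2 - (2 * real p + c)\<^sup>2) / ((2 * real p + c)\<^sup>2 * (2 * real q + c)\<^sup>2)"
      by (simp add: diff_frac_eq)
    also have "(2 * real q + c)\<^sup>2 - (2 * real p + c)\<^sup>2 = 4 * ((real q - real p) * (real q + real p + c))"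
      by (simp add: power2_eq_square algebra_simps)
    finally show ?thesis .
  qed
  then show ?thesis
    by (simp add: prod_dividef prod.distrib prod_diff_fact prod_power_distrib[symmetric] power_mult mult.assoc)
qed

lemma prod_pairs_odd:
  "(\<Prod>q<r. \<Prod>p<q. 1 / (2 * real p + 1)\<^sup>2 - 1 / (2 * real q + 1)\<^sup>2) * (\<Prod>l<r. 2 * real l + 1) ^ (2 * r)
    = (\<Prod>l<r. 2 * real l + 1)\<^sup>2 * (\<Prod>q<r. 4 ^ q * fact (2 * q))"
proof (rule prod_pairs_closed_form)
  fix q
  have "fact q * (\<Prod>p<q. real q + real p + 1) = fact (2 * q)"
    unfolding prod_shift_fact by (simp add: mult_2)
  moreover have "(0::real) < 1" by simp
  note prod_inverse_square_diff[OF this, of q]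
  ultimately show "(\<Prod>p<q. 1 / (2 * real p + 1)\<^sup>2 - 1 / (2 * real q + 1)\<^sup>2)
      = 4 ^ q * fact (2 * q) / ((\<Prod>l<q. 2 * real l + 1)\<^sup>2 * (2 * real q + 1) ^ (2 * q))"
    by (simp only: mult.assoc)
qed simp

lemma prod_pairs_even:
  "(\<Prod>q<r. \<Prod>p<q. 1 / (2 * real p + 2)\<^sup>2 - 1 / (2 * real q + 2)\<^sup>2) * (\<Prod>l<r. 2 * real l + 2) ^ (2 * r)
    = (\<Prod>l<r. 2 * real l + 2)\<^sup>2 * (\<Prod>q<r. 4 ^ q * (fact (2 * q + 1) / (real q + 1)))"
proof (rule prod_pairs_closed_form)
  fix q
  have "(\<Prod>p<q. real q + real p + 2) = (\<Prod>p<q. real (Suc q) + real p + 1)"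
    by (intro prod.cong) auto
  also have "\<dots> = fact (Suc q + q) / fact (Suc q)" by (rule prod_shift_fact)
  also have "Suc q + q = 2 * q + 1" by simp
  also have "fact (Suc q) = (real q + 1) * fact q" by simp
  finally have "fact q * (\<Prod>p<q. real q + real p + 2) = fact (2 * q + 1) / (real q + 1)" by simp
  moreover have "(0::real) < 2" by simp
  note prod_inverse_square_diff[OF this, of q]
  ultimately show "(\<Prod>p<q. 1 / (2 * real p + 2)\<^sup>2 - 1 / (2 * real q + 2)\<^sup>2)
      = 4 ^ q * (fact (2 * q + 1) / (real q + 1)) / ((\<Prod>l<q. 2 * real l + 2)\<^sup>2 * (2 * real q + 2) ^ (2 * q))"
    by (simp only: mult.assoc)
qed simp

lemma prod_even_fact: "(\<Prod>l<r. 2 * real l + 2) = 2 ^ r * fact r"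
  by (induction r) (auto simp: algebra_simps)

text \<open>Double counting of pairs a \<le> q \<le> n: the factor f a occurs once for each of the n
  + 1 - a values of q.\<close>

lemma prod_power_staircase:
  fixes f :: "nat \<Rightarrow> 'a::comm_monoid_mult"
  shows "(\<Prod>a = 1..n. f a ^ (Suc n - a)) = (\<Prod>q<Suc n. \<Prod>a = 1..q. f a)"
proof (induction n)
  case (Suc n)
  have "(\<Prod>a = 1..Suc n. f a ^ (Suc (Suc n) - a)) = (\<Prod>a = 1..n. f a ^ (Suc (Suc n) - a)) * f (Suc n)"
    by simp
  also have "(\<Prod>a = 1..n. f a ^ (Suc (Suc n) - a)) = (\<Prod>a = 1..n. f a ^ (Suc n - a) * f a)"
    by (intro prod.cong) (auto simp: Suc_diff_le mult.commute)
  also have "\<dots> = (\<Prod>a = 1..n. f a ^ (Suc n - a)) * (\<Prod>a = 1..n. f a)" by (rule prod.distrib)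
  finally show ?case unfolding Suc.IH by (simp add: mult.assoc)
qed simp

lemma fact_double_odd: "(fact (2 * q) :: real) = 2 ^ q * fact q * (\<Prod>l<q. 2 * real l + 1)"
  by (induction q) (simp_all add: algebra_simps)

text \<open>Passing from r to r + 1 multiplies both sides by (2^r / 2) r! / sqrt(2r + 1)^(2r+1). The
  integer power is required since r(r - 3) is negative for r = 1 and r = 2.\<close>

lemma odd_constant:
  "(\<Prod>q<r. 4 ^ q * fact (2 * q)) * sqrt (\<Prod>l<r. 2 * real l + 1)
      / (2 ^ r\<^sup>2 * (\<Prod>l<r. 2 * real l + 1) ^ r)
    = sqrt 2 powi (int r * (int r - 3)) * (\<Prod>q<r. fact q / sqrt (2 * real q + 1) ^ (2 * q + 1))"
proof (induction r)
  case (Suc r)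
  let ?Q = "\<lambda>r. \<Prod>l<r. 2 * real l + 1" and ?F = "\<lambda>r. \<Prod>q<r. 4 ^ q * fact (2 * q) :: real"
  let ?s = "sqrt (2 * real r + 1)"
  have Q: "?Q r > 0" by (intro prod_pos) auto
  have s: "?s > 0" "2 * real r + 1 = ?s ^ 2" by simp_all
  have e: "sqrt 2 powi (int (Suc r) * (int (Suc r) - 3)) = sqrt 2 powi (int r * (int r - 3)) * (2 ^ r / 2)"
  proof -
    \<comment> \<open>The exponent grows by 2r - 2, which is negative at r = 0; hence the integer
      difference.\<close>
    have "int (Suc r) * (int (Suc r) - 3) = int r * (int r - 3) + (int (2 * r) - int 2)"
      by (simp add: algebra_simps)
    then have "sqrt 2 powi (int (Suc r) * (int (Suc r) - 3))
        = sqrt 2 powi (int r * (int r - 3) + (int (2 * r) - int 2))" by (simp only:)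
    also have "\<dots> = sqrt 2 powi (int r * (int r - 3)) * sqrt 2 powi (int (2 * r) - int 2)"
      by (rule power_int_add) simp
    also have "sqrt 2 powi (int (2 * r) - int 2) = sqrt 2 powi int (2 * r) / sqrt 2 powi int 2"
      by (rule power_int_diff) simp
    finally have "sqrt 2 powi (int (Suc r) * (int (Suc r) - 3))
        = sqrt 2 powi (int r * (int r - 3)) * (sqrt 2 ^ (2 * r) / sqrt 2 ^ 2)"
      unfolding power_int_of_nat .
    then show ?thesis by (simp add: power_mult)
  qed
  have p: "(2::real) ^ (Suc r)\<^sup>2 = 2 ^ r\<^sup>2 * (4 ^ r * 2)"
  proof -
    have "(Suc r)\<^sup>2 = r\<^sup>2 + (2 * r + 1)" by (simp add: power2_eq_square)
    then show ?thesis by (simp add: power_add power_mult)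
  qed
  have s2: "(2 * real r + 1) ^ Suc r = ?s ^ (2 * r + 1) * ?s"
  proof -
    have "(2 * real r + 1) ^ Suc r = (?s ^ 2) ^ Suc r" using s(2) by (rule arg_cong)
    also have "\<dots> = ?s ^ (2 * Suc r)" by (rule power_mult[symmetric])
    also have "2 * Suc r = Suc (2 * r + 1)" by simp
    finally show ?thesis by (simp only: power_Suc2)
  qed
  have "?F (Suc r) * sqrt (?Q (Suc r)) / (2 ^ (Suc r)\<^sup>2 * ?Q (Suc r) ^ Suc r)
      = ?F r * (4 ^ r * (2 ^ r * fact r * ?Q r)) * (sqrt (?Q r) * ?s)
        / (2 ^ r\<^sup>2 * (4 ^ r * 2) * (?Q r ^ r * ?Q r * (?s ^ (2 * r + 1) * ?s)))"
  proof -
    have "?F (Suc r) = ?F r * (4 ^ r * (2 ^ r * fact r * ?Q r))"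
      unfolding fact_double_odd[symmetric] by simp
    moreover have "?Q (Suc r) ^ Suc r = ?Q r ^ r * ?Q r * (2 * real r + 1) ^ Suc r"
      by (simp only: prod.lessThan_Suc power_mult_distrib power_Suc2 mult_ac)
    moreover have "sqrt (?Q (Suc r)) = sqrt (?Q r) * ?s"
      by (simp add: real_sqrt_mult)
    ultimately show ?thesis unfolding p s2[symmetric] by (simp only:)
  qed
  also have "\<dots> = ?F r * sqrt (?Q r) / (2 ^ r\<^sup>2 * ?Q r ^ r) * (2 ^ r / 2 * (fact r / ?s ^ (2 * r + 1)))"
  proof -
    have aux: "F * (a * (b * f * Q)) * (w * t) / (B * (a * 2) * (P * Q * (y * t)))
        = F * w / (B * P) * (b / 2 * (f / y))"
      if "a \<noteq> 0" "Q \<noteq> 0" "t \<noteq> 0" for F a b f Q w t B P y :: real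
      using that by (simp add: mult_ac)
    show ?thesis by (rule aux) (use Q s(1) in auto)
  qed
  finally show ?case unfolding Suc.IH e prod.lessThan_Suc by (simp only: mult_ac)
qed simp

text \<open>Each step contributes (2r + 1)!! / (4 2^r (r + 1)^(r+1)) to both sides; the double
  factorial is (2r + 1)! divided by 2^r r!.\<close>

lemma even_constant:
  "(\<Prod>q<r. 4 ^ q * (fact (2 * q + 1) / (real q + 1))) * (2 ^ r * fact r)
      / (2 ^ (r\<^sup>2 + r) * (2 ^ r * fact r) ^ r)
    = 1 / sqrt 2 ^ (r * (r + 3)) * (\<Prod>q<r. (\<Prod>a = 1..q. 2 * real a + 1) / (real q + 1) ^ (q + 1))"
proof (induction r)
  case (Suc r)
  let ?Q = "\<lambda>r. 2 ^ r * fact r :: real" and ?F = "\<lambda>r. \<Prod>q<r. 4 ^ q * (fact (2 * q + 1) / (real q + 1)) :: real"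
  let ?W = "\<Prod>a = 1..r. 2 * real a + 1"
  have Q: "?Q r > 0" by simp
  have QS: "?Q (Suc r) = ?Q r * (2 * (real r + 1))" by (simp add: algebra_simps)
  have W: "(fact (2 * r + 1) :: real) = ?Q r * ?W"
  proof -
    have "?W = (\<Prod>l<Suc r. 2 * real l + 1)"
      by (induction r) auto
    moreover have "fact (2 * r + 1) = (2 * real r + 1) * fact (2 * r)" by simp
    ultimately show ?thesis unfolding fact_double_odd by (simp add: mult_ac)
  qed
  have e: "sqrt 2 ^ (Suc r * (Suc r + 3)) = sqrt 2 ^ (r * (r + 3)) * (2 ^ r * 4)"
  proof -
    have "Suc r * (Suc r + 3) = r * (r + 3) + 2 * (r + 2)" by (simp add: algebra_simps)
    then have "sqrt 2 ^ (Suc r * (Suc r + 3)) = sqrt 2 ^ (r * (r + 3)) * (sqrt 2 ^ 2) ^ (r + 2)"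
      by (simp only: power_add power_mult)
    then show ?thesis by (simp add: power_add)
  qed
  have p: "(2::real) ^ ((Suc r)\<^sup>2 + Suc r) = 2 ^ (r\<^sup>2 + r) * (4 ^ r * 4)"
  proof -
    have "(Suc r)\<^sup>2 + Suc r = (r\<^sup>2 + r) + 2 * (r + 1)" by (simp add: power2_eq_square)
    then have "(2::real) ^ ((Suc r)\<^sup>2 + Suc r) = 2 ^ (r\<^sup>2 + r) * (2 ^ 2) ^ (r + 1)"
      by (simp only: power_add power_mult)
    then show ?thesis by simp
  qed
  have q: "?Q (Suc r) ^ Suc r = ?Q r ^ r * ?Q r * (2 ^ r * 2 * (real r + 1) ^ (r + 1))"
    unfolding QS by (simp only: power_mult_distrib Suc_eq_plus1 power_add power_one_right mult_ac)
  have "?F (Suc r) * ?Q (Suc r) / (2 ^ ((Suc r)\<^sup>2 + Suc r) * ?Q (Suc r) ^ Suc r)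
      = ?F r * (4 ^ r * (?Q r * ?W / (real r + 1))) * (?Q r * (2 * (real r + 1)))
        / (2 ^ (r\<^sup>2 + r) * (4 ^ r * 4) * (?Q r ^ r * ?Q r * (2 ^ r * 2 * (real r + 1) ^ (r + 1))))"
  proof -
    have "?F (Suc r) = ?F r * (4 ^ r * (?Q r * ?W / (real r + 1)))"
      unfolding W[symmetric] by simp
    then show ?thesis unfolding p q unfolding QS by (simp only:)
  qed
  also have "\<dots> = ?F r * ?Q r / (2 ^ (r\<^sup>2 + r) * ?Q r ^ r) * (1 / (2 ^ r * 4) * (?W / (real r + 1) ^ (r + 1)))"
  proof -
    have aux: "F * (c * (Q * W / x)) * (Q * (2 * x)) / (B * (c * 4) * (P * Q * (d * 2 * y)))
        = F * Q / (B * P) * (1 / (d * 4) * (W / y))"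
      if "c \<noteq> 0" "Q \<noteq> 0" "x \<noteq> 0" for F c Q W x B P d y :: real
      using that by (simp add: mult_ac)
    show ?thesis by (rule aux) auto
  qed
  moreover have "1 / A * V * (1 / d * W) = 1 / (A * d) * (V * W)" for A V d W :: real by simp
  ultimately show ?case unfolding Suc.IH e prod.lessThan_Suc by (simp only:)
qed simp

lemma prod_lessThan_Suc_eq_atLeast1:
  fixes h :: "nat \<Rightarrow> 'a::comm_monoid_mult"
  assumes "h 0 = 1"
  shows "(\<Prod>q<Suc n. h q) = (\<Prod>a = 1..n. h a)"
  using assms by (simp add: prod.lessThan_Suc_shift prod.atLeast1_atMost_eq del: prod.lessThan_Suc)

lemma prod_fact_eq: "(\<Prod>a = 1..q. real a) = fact q"
  by (induction q) auto

text \<open>The exponents k - 2i sum to r^2 and the Gamma limit contributes another r, giving sqrt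
  pi to the power r(r + 1); likewise the powers of sqrt 2 combine to 2^(r^2).\<close>

lemma IKM_det_odd_closed:
  fixes n :: nat
  defines "r \<equiv> Suc n"
  shows "IKM_det (2 * n + 1) r 0 = sqrt pi ^ (r * (r + 1)) * sqrt 2 powi (int r * (int r - 3))
    * (\<Prod>q<r. fact q / sqrt (2 * real q + 1) ^ (2 * q + 1))"
proof -
  let ?k = "2 * n + 1" and ?D = "IKM_det (2 * n + 1) r 0"
  define Q where "Q = (\<Prod>l<r. 2 * real l + 1)"
  define V where "V = (\<Prod>q<r. \<Prod>p<q. 1 / (2 * real p + 1)\<^sup>2 - 1 / (2 * real q + 1)\<^sup>2)"
  define F where "F = (\<Prod>q<r. 4 ^ q * fact (2 * q) :: real)"
  \<comment> \<open>The exponent 1 - k/2 = 3/2 - r is half-integral; with Q = w w the final identity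
    is purely rational and \<open>aux\<close> can settle it by cancellation.\<close>
  define w where "w = sqrt Q"
  have "Q > 0" unfolding Q_def by (intro prod_pos) auto
  then have w: "w > 0" "Q = w * w" by (simp_all add: w_def)
  have VQ: "V * (Q ^ r * Q ^ r) = Q * Q * F"
    using prod_pairs_odd[of r] unfolding Q_def V_def F_def
    by (simp only: power_add[symmetric] mult_2[symmetric] power2_eq_square)
  have "(\<Prod>i<r. \<Prod>j<i. 1 / real (?k - 2 * i) ^ 2 - 1 / real (?k - 2 * j) ^ 2)
      = (\<Prod>i<r. \<Prod>j<i. 1 / (2 * real (r - 1 - i) + 1)\<^sup>2 - 1 / (2 * real (r - 1 - j) + 1)\<^sup>2)"
  proof -
    have "real (?k - 2 * i) = 2 * real (r - 1 - i) + 1" if "i < r" for i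
      using that by (simp add: r_def of_nat_diff)
    then show ?thesis by (intro prod.cong) auto
  qed
  also have "\<dots> = V" unfolding V_def by (rule prod_pairs_reverse)
  finally have V: "(\<Prod>i<r. \<Prod>j<i. 1 / real (?k - 2 * i) ^ 2 - 1 / real (?k - 2 * j) ^ 2) = V" .
  have \<kappa>: "(\<Prod>i<r. sqrt pi ^ (?k - 2 * i) / sqrt 2 ^ ?k) = sqrt pi ^ (r * r) / sqrt 2 ^ (?k * r)"
  proof -
    have "(\<Sum>i<r. ?k - 2 * i) = (\<Sum>i<r. 2 * (r - Suc i) + 1)"
      by (intro sum.cong) (auto simp: r_def)
    also have "\<dots> = (\<Sum>l<r. 2 * l + 1)" using sum.nat_diff_reindex[of "\<lambda>l. 2 * l + 1" r] .
    also have "\<dots> = r * r" by (induction r) auto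
    finally have "(\<Prod>i<r. sqrt pi ^ (?k - 2 * i)) = sqrt pi ^ (r * r)"
      unfolding power_sum[symmetric] by (rule arg_cong)
    then show ?thesis by (simp only: prod_dividef prod_constant card_lessThan power_mult)
  qed
  have P: "Q powr (1 - real ?k / 2) = Q * w / Q ^ r"
  proof -
    have "1 - real ?k / 2 = 1 + 1 / 2 - real r" by (simp add: r_def field_simps)
    then have "Q powr (1 - real ?k / 2) = Q powr (1 + 1 / 2 - real r)" by (simp only:)
    also have "\<dots> = Q powr 1 * Q powr (1 / 2) / Q powr real r"
      by (simp only: powr_diff powr_add)
    also have "\<dots> = Q * w / Q ^ r"
      using \<open>Q > 0\<close> by (simp add: powr_realpow powr_half_sqrt w_def)
    finally show ?thesis .
  qed
  have eq: "?D * (sqrt 2 ^ r / sqrt pi ^ r * (Q * w / Q ^ r)) = sqrt pi ^ (r * r) / sqrt 2 ^ (?k * r) * V"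
    using IKM_det_odd_value[of n] unfolding r_def[symmetric] Q_def[symmetric] P V \<kappa> power_divide .
  have aux: "D = a * P * (F * w / (c * T * R))"
    if "D * (T / P * (Q * w / R)) = a / c * V" "V * (R * R) = Q * Q * F" "Q = w * w"
      "w \<noteq> 0" "R \<noteq> 0" "T \<noteq> 0" "P \<noteq> 0" "c \<noteq> 0" for D T P Q w R a c V F :: real
  proof -
    have "V = V * (R * R) / (R * R)" using that(5) by simp
    then have "V = Q * Q * F / (R * R)" unfolding that(2) .
    moreover have "D = D * (T / P * (Q * w / R)) * (P * R / (T * Q * w))" using that(3-8) by simp
    then have "D = a / c * V * (P * R / (T * Q * w))" unfolding that(1) .
    ultimately have "D = a / c * (Q * Q * F / (R * R)) * (P * R / (T * Q * w))" by (simp only:)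
    also have "\<dots> = a * P * (F * w / (c * T * R))" using that(3-8) by (simp add: mult_ac)
    finally show ?thesis .
  qed
  have "?D = sqrt pi ^ (r * r) * sqrt pi ^ r * (F * w / (sqrt 2 ^ (?k * r) * sqrt 2 ^ r * Q ^ r))"
    by (rule aux[OF eq VQ w(2)]) (use w \<open>Q > 0\<close> in auto)
  also have "sqrt pi ^ (r * r) * sqrt pi ^ r = sqrt pi ^ (r * (r + 1))"
    by (simp add: power_add)
  also have "sqrt 2 ^ (?k * r) * sqrt 2 ^ r = 2 ^ r\<^sup>2"
  proof -
    have "?k * r + r = 2 * r\<^sup>2" by (simp add: r_def power2_eq_square)
    then have "sqrt 2 ^ (?k * r) * sqrt 2 ^ r = sqrt 2 ^ (2 * r\<^sup>2)"
      unfolding power_add[symmetric] by (rule arg_cong)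
    then have "sqrt 2 ^ (?k * r) * sqrt 2 ^ r = (sqrt 2 ^ 2) ^ r\<^sup>2"
      unfolding power_mult[of "sqrt 2" 2] .
    then show ?thesis by simp
  qed
  also have "F * w / (2 ^ r\<^sup>2 * Q ^ r) = sqrt 2 powi (int r * (int r - 3))
      * (\<Prod>q<r. fact q / sqrt (2 * real q + 1) ^ (2 * q + 1))"
    unfolding F_def w_def Q_def by (rule odd_constant)
  finally show ?thesis by (simp only: mult.assoc)
qed

text \<open>Here 1 - k/2 = 1 - r is an integer, so no root of Q appears. The factor Gamma / sqrt pi
  of the limit supplies the last sqrt pi: r(r + 1) + r + 1 = (r + 1)^2.\<close>

lemma IKM_det_even_closed:
  fixes n :: nat
  defines "r \<equiv> Suc n"
  shows "IKM_det (2 * r) r 0 = sqrt pi ^ ((r + 1)\<^sup>2) / Gamma ((real r + 1) / 2) * (1 / sqrt 2 ^ (r * (r + 3)))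
    * (\<Prod>q<r. (\<Prod>a = 1..q. 2 * real a + 1) / (real q + 1) ^ (q + 1))"
proof -
  let ?k = "2 * r" and ?D = "IKM_det (2 * r) r 0" and ?G = "Gamma ((real r + 1) / 2)"
  define Q where "Q = (2 ^ r * fact r :: real)"
  define V where "V = (\<Prod>q<r. \<Prod>p<q. 1 / (2 * real p + 2)\<^sup>2 - 1 / (2 * real q + 2)\<^sup>2)"
  define F where "F = (\<Prod>q<r. 4 ^ q * (fact (2 * q + 1) / (real q + 1)) :: real)"
  have Q: "Q > 0" by (simp add: Q_def)
  have VQ: "V * (Q ^ r * Q ^ r) = Q * Q * F"
    using prod_pairs_even[of r] unfolding Q_def V_def F_def prod_even_fact
    by (simp only: power_add[symmetric] mult_2[symmetric] power2_eq_square)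
  have "(\<Prod>i<r. \<Prod>j<i. 1 / real (?k - 2 * i) ^ 2 - 1 / real (?k - 2 * j) ^ 2)
      = (\<Prod>i<r. \<Prod>j<i. 1 / (2 * real (r - 1 - i) + 2)\<^sup>2 - 1 / (2 * real (r - 1 - j) + 2)\<^sup>2)"
  proof -
    have "real (?k - 2 * i) = 2 * real (r - 1 - i) + 2" if "i < r" for i
      using that by (simp add: r_def of_nat_diff)
    then show ?thesis by (intro prod.cong) auto
  qed
  also have "\<dots> = V" unfolding V_def by (rule prod_pairs_reverse)
  finally have V: "(\<Prod>i<r. \<Prod>j<i. 1 / real (?k - 2 * i) ^ 2 - 1 / real (?k - 2 * j) ^ 2) = V" .
  have \<kappa>: "(\<Prod>i<r. sqrt pi ^ (?k - 2 * i) / sqrt 2 ^ ?k) = sqrt pi ^ (r * (r + 1)) / sqrt 2 ^ (?k * r)"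
  proof -
    have "(\<Sum>i<r. ?k - 2 * i) = (\<Sum>i<r. 2 * (r - Suc i) + 2)"
      by (intro sum.cong) (auto simp: r_def)
    also have "\<dots> = (\<Sum>l<r. 2 * l + 2)" using sum.nat_diff_reindex[of "\<lambda>l. 2 * l + 2" r] .
    also have "\<dots> = r * (r + 1)" by (induction r) auto
    finally have "(\<Prod>i<r. sqrt pi ^ (?k - 2 * i)) = sqrt pi ^ (r * (r + 1))"
      unfolding power_sum[symmetric] by (rule arg_cong)
    then show ?thesis by (simp only: prod_dividef prod_constant card_lessThan power_mult)
  qed
  have P: "Q powr (1 - real ?k / 2) = Q / Q ^ r"
  proof -
    have "1 - real ?k / 2 = 1 - real r" by simp
    then have "Q powr (1 - real ?k / 2) = Q powr (1 - real r)" by (simp only:)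
    also have "\<dots> = Q powr 1 / Q powr real r"
      by (simp only: powr_diff)
    also have "\<dots> = Q / Q ^ r"
      using Q by (simp add: powr_realpow)
    finally show ?thesis .
  qed
  have eq: "?D * (2 ^ r / sqrt pi ^ r * (?G / sqrt pi) * (Q / Q ^ r))
      = sqrt pi ^ (r * (r + 1)) / sqrt 2 ^ (?k * r) * V"
    using IKM_det_even_value[of n] unfolding r_def[symmetric] Q_def[symmetric] P V \<kappa> power_divide .
  have G: "?G \<noteq> 0"
  proof -
    have "?G > 0" by (intro Gamma_real_pos) simp
    then show ?thesis by (metis less_irrefl)
  qed
  have aux: "D = a * (P * p) / G * (F * Q / (c * T * R))"
    if "D * (T / P * (G / p) * (Q / R)) = a / c * V" "V * (R * R) = Q * Q * F"
      "Q \<noteq> 0" "R \<noteq> 0" "T \<noteq> 0" "P \<noteq> 0" "c \<noteq> 0" "G \<noteq> 0" "p \<noteq> 0"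
    for D T P Q p R a c V F G :: real
  proof -
    have "V = V * (R * R) / (R * R)" using that(4) by simp
    then have "V = Q * Q * F / (R * R)" unfolding that(2) .
    moreover have "D = D * (T / P * (G / p) * (Q / R)) * (P * p * R / (T * G * Q))"
      using that(3-9) by simp
    then have "D = a / c * V * (P * p * R / (T * G * Q))" unfolding that(1) .
    ultimately have "D = a / c * (Q * Q * F / (R * R)) * (P * p * R / (T * G * Q))" by (simp only:)
    also have "\<dots> = a * (P * p) / G * (F * Q / (c * T * R))" using that(3-9) by (simp add: mult_ac)
    finally show ?thesis .
  qed
  have "?D = sqrt pi ^ (r * (r + 1)) * (sqrt pi ^ r * sqrt pi) / ?G
      * (F * Q / (sqrt 2 ^ (?k * r) * 2 ^ r * Q ^ r))"
    by (rule aux[OF eq VQ]) (use Q G in auto)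
  also have "sqrt pi ^ (r * (r + 1)) * (sqrt pi ^ r * sqrt pi) = sqrt pi ^ ((r + 1)\<^sup>2)"
  proof -
    have "(r + 1)\<^sup>2 = r * (r + 1) + Suc r" by (simp add: power2_eq_square)
    then show ?thesis by (simp only: power_add power_Suc2)
  qed
  also have "sqrt 2 ^ (?k * r) * 2 ^ r = 2 ^ (r\<^sup>2 + r)"
  proof -
    have "?k * r = 2 * r\<^sup>2" by (simp add: power2_eq_square)
    then have "sqrt 2 ^ (?k * r) = (sqrt 2 ^ 2) ^ r\<^sup>2"
      by (simp only:) (rule power_mult)
    then show ?thesis by (simp add: power_add)
  qed
  also have "F * Q / (2 ^ (r\<^sup>2 + r) * Q ^ r) = 1 / sqrt 2 ^ (r * (r + 3))
      * (\<Prod>q<r. (\<Prod>a = 1..q. 2 * real a + 1) / (real q + 1) ^ (q + 1))"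
    unfolding F_def Q_def by (rule even_constant)
  finally show ?thesis by (simp only: mult.assoc)
qed

(* Matrix indices run over {0..<r}, so i and j here are the usual i - 1 and j - 1. *)
theorem mainTheorem3:
  fixes r :: nat
  assumes "r \<ge> 1"
  shows "Determinant.det (Matrix.mat r r (\<lambda>(i, j). IKM (2 * r - 1) i (2 * j))) =
           sqrt pi ^ (r * (r + 1)) * sqrt 2 powi (int r * (int r - 3)) *
           (\<Prod>a = 1..r - 1. real a ^ (r - a) / sqrt (2 * real a + 1) ^ (2 * a + 1))
       \<and> Determinant.det (Matrix.mat r r (\<lambda>(i, j). IKM (2 * r) i (2 * j))) =
           sqrt pi ^ ((r + 1)\<^sup>2) / Gamma ((real r + 1) / 2) * (1 / sqrt 2 ^ (r * (r + 3))) *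
           (\<Prod>a = 1..r - 1. (2 * real a + 1) ^ (r - a) / (real a + 1) ^ (a + 1))"
proof -
  obtain n where r: "r = Suc n" using assms by (cases r) auto
  have det: "Determinant.det (Matrix.mat r r (\<lambda>(i, j). IKM k i (2 * j))) = IKM_det k r 0" for k
    by (simp add: IKM_det_def)
  have odd: "(\<Prod>a = 1..r - 1. real a ^ (r - a) / sqrt (2 * real a + 1) ^ (2 * a + 1))
      = (\<Prod>q<r. fact q / sqrt (2 * real q + 1) ^ (2 * q + 1))"
  proof -
    \<comment> \<open>The staircase exponents r - a regroup the powers into a product of factorials;
      the index q = 0 adds only factors 1.\<close>
    have "(\<Prod>a = 1..n. real a ^ (Suc n - a)) = (\<Prod>q<Suc n. fact q)"
      unfolding prod_power_staircase prod_fact_eq ..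
    moreover have "(\<Prod>a = 1..n. sqrt (2 * real a + 1) ^ (2 * a + 1))
        = (\<Prod>q<Suc n. sqrt (2 * real q + 1) ^ (2 * q + 1))"
      by (rule prod_lessThan_Suc_eq_atLeast1[symmetric]) simp
    ultimately show ?thesis unfolding r prod_dividef diff_Suc_1 by (simp only:)
  qed
  have even: "(\<Prod>a = 1..r - 1. (2 * real a + 1) ^ (r - a) / (real a + 1) ^ (a + 1))
      = (\<Prod>q<r. (\<Prod>a = 1..q. 2 * real a + 1) / (real q + 1) ^ (q + 1))"
  proof -
    have "(\<Prod>a = 1..n. (real a + 1) ^ (a + 1)) = (\<Prod>q<Suc n. (real q + 1) ^ (q + 1))"
      by (rule prod_lessThan_Suc_eq_atLeast1[symmetric]) simp
    then show ?thesis unfolding r prod_dividef diff_Suc_1 prod_power_staircase by (simp only:)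
  qed
  have "2 * r - 1 = 2 * n + 1" by (simp add: r)
  then show ?thesis
    unfolding det odd even using IKM_det_odd_closed[of n] IKM_det_even_closed[of n]
    by (simp only: r)
qed

end
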